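(* Let $k \geq 1$ be an integer and let $(X,\Sigma)$ be a standard Borel space. If $\mu$ is a fully sated strongly stationary law on $(X^{[k]^\omega},\Sigma^{\otimes[k]^\omega})$ and $\mathcal{I},\mathcal{I}' \subseteq \binom{[k]}{\geq 2}$ are two up-sets, then the oblique $\sigma$-algebras $\Phi^\dagger_{\mathcal{I}}$ and $\Phi^\dagger_{\mathcal{I}'}$ are relatively independent over $\Phi^\dagger_{\mathcal{I}\cap\mathcal{I}'}$ under $\mu^{\mathrm{line}}$.
   Context: Notation: $[n] := \{1,\ldots,n\}$ and $[k]^\omega := \bigcup_{n\geq 1}[k]^n$ is the set of finite nonempty words over $[k]$. Subspaces and lines. An (infinite-dimensional) subspace of $[k]^\omega$ is an injection $\phi:[k]^\omega \to [k]^\omega$ specified by integers $0 = N_0 < N_1 < N_2 < \cdots$, nonempty sets $I_{i+1} \subseteq [N_{i+1}]\setminus [N_i]$ and fixed words $w_i \in [k]^{N_i}$ as follows: for a word $v = v_1 v_2\cdots v_n$, $\phi(v)$ is the word of length $N_n$ with, for $N_i < m \leq N_{i+1}$ ($0\le i<n$), $\phi(v)_m = v_{i+1}$ if $m \in I_{i+1}$ and $\phi(v)_m = (w_{i+1})_m$ otherwise. A (combinatorial) line is a map $\ell:[k]\to[k]^N$ for some $N\geq 1$ given by a nonempty $I \subseteq [N]$ and $w_0 \in [k]^{[N]\setminus I}$ by $\ell(i)|_{[N]\setminus I} = w_0$, $\ell(i)|_I \equiv i$. Laws. A law is a probability measure $\mu$ on $(X^{[k]^\omega},\Sigma^{\otimes[k]^\omega})$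 for some standard Borel space $(X,\Sigma)$. For a subspace $\phi$, $\phi^*\mu$ is the law on $X^{[k]^\omega}$ that is the pushforward of $\mu$ under $(x_w)_w \mapsto (x_{\phi(w)})_w$. The law $\mu$ is strongly stationary (s.s.) if $\phi^*\mu = \mu$ for every subspace $\phi$. For an s.s. law all one-dimensional marginals coincide, and the joint laws of $(x_{\ell(1)},\ldots,x_{\ell(k)})$ coincide for all lines $\ell$; these are the point-marginal $\mu^\circ$ on $(X,\Sigma)$ and the line-marginal $\mu^{\mathrm{line}}$ on $(X^k,\Sigma^{\otimes k})$. $\pi_i:X^k\to X$ is the $i$th coordinate projection. Extensions. For a Borel map $\pi:\tilde X \to X$ of standard Borel spaces, $\pi^{[k]^\omega}:\tilde X^{[k]^\omega}\to X^{[k]^\omega}$ is the coordinatewise map. A law $\tilde\mu$ on $\tilde X^{[k]^\omega}$ is an extension of $\mu$ through $\pi$ if $(\pi^{[k]^\omega})_\#\tilde\mu = \mu$ (pushforward). Insensitive $\sigma$-algebras. For nonempty $e \subseteq [k]$ and an s.s. law $\mu$, $\Phi_e := \{A \in \Sigma:\ 1_A(x_{\ell(i)}) = 1_A(x_{\ell(j)})\ \forall i,j\in e \text{ for } \mu\text{-a.e. } (x_w)_w\}$, where $\ell$ is any line (the choice is irrelevant by strong stationarity). Let $\binom{[k]}{\geq 2}$ be the family of subsets of $[k]$ of size at least $2$; an up-set is a family $\mathcal{I} \subseteq \binom{[k]}{\geq 2}$ such that $u \in \mathcal{I}$ and $u \subseteq v\subseteq [k]$ imply $v \in \mathcal{I}$.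 Set $\Phi_{\mathcal{I}} := \bigvee_{e\in\mathcal{I}} \Phi_e$, the $\sigma$-algebra generated by the $\Phi_e$, $e\in\mathcal I$ (an empty join is the trivial $\sigma$-algebra). For an extension $\tilde\mu$ the corresponding objects are written $\tilde\Phi_e,\tilde\Phi_{\mathcal{I}}$. Oblique copies. For $e \in \binom{[k]}{\geq 2}$ the $\sigma$-algebras $\pi_i^{-1}(\Phi_e)$, $i \in e$, agree up to $\mu^{\mathrm{line}}$-negligible sets; their common $\mu^{\mathrm{line}}$-completion is the oblique copy $\Phi_e^\dagger$. For an up-set $\mathcal{I}$, $\Phi^\dagger_{\mathcal{I}} := \bigvee_{e \in \mathcal{I}}\Phi_e^\dagger$. Satedness. Two $\sigma$-algebras are relatively independent over a third, $\Xi$, if $\mathsf{E}(fg\mid\Xi) = \mathsf{E}(f\mid\Xi)\,\mathsf{E}(g\mid\Xi)$ a.s. for all bounded $f,g$ measurable with respect to the first and second respectively. For a nonempty up-set $\mathcal{I}$, an s.s. law $\mu$ on $X^{[k]^\omega}$ is $\mathcal{I}$-sated if for every s.s. extension $\tilde\mu$ of $\mu$ through a Borel map $\pi:\tilde X\to X$, the $\sigma$-algebras $\pi^{-1}(\Sigma)$ and $\tilde\Phi_{\mathcal{I}}$ are relatively independent under $\tilde\mu^\circ$ over $\pi^{-1}(\Phi_{\mathcal{I}})$. The law $\mu$ is fully sated if it is $\mathcal{I}$-sated for every nonempty up-set $\mathcal{I}\subseteq\binom{[k]}{\geq 2}$. *)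

theory Defs
  imports "HOL-Probability.Probability"
begin

definition standard_borel :: "'a measure \<Rightarrow> bool" where
  "standard_borel X \<longleftrightarrow>
     (\<exists>T. completely_metrizable_space T \<and> second_countable T \<and> topspace T = space X \<and>
          sets X = sigma_sets (topspace T) {U. openin T U})"

text \<open>Letters are the numbers \<open>1, \<dots>, k\<close>. Positions in words are counted from 1 below,
  so the \<open>m\<close>-th letter of \<open>u\<close> is \<open>u ! (m - 1)\<close>.\<close>

definition words :: "nat \<Rightarrow> nat list set" where
  "words k = {u. u \<noteq> [] \<and> set u \<subseteq> {1..k}}"

text \<open>A subspace is only constrained on \<open>words k\<close>. That it maps \<open>words k\<close> injectively into itself
  follows from the defining data, see \<open>word_subspace_maps\<close> and \<open>word_subspace_inj\<close>.\<close>

definition subspace_data ::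
  "nat \<Rightarrow> (nat \<Rightarrow> nat) \<Rightarrow> (nat \<Rightarrow> nat set) \<Rightarrow> (nat \<Rightarrow> nat list) \<Rightarrow> (nat list \<Rightarrow> nat list) \<Rightarrow> bool" where
  "subspace_data k N I w \<phi> \<longleftrightarrow>
     N 0 = 0 \<and> strict_mono N \<and>
     (\<forall>i. I (Suc i) \<noteq> {} \<and> I (Suc i) \<subseteq> {1..N (Suc i)} - {1..N i}) \<and>
     (\<forall>i. length (w (Suc i)) = N (Suc i) \<and> set (w (Suc i)) \<subseteq> {1..k}) \<and>
     (\<forall>v\<in>words k. length (\<phi> v) = N (length v) \<and>
        (\<forall>i<length v. \<forall>m. N i < m \<and> m \<le> N (Suc i) \<longrightarrow>
           \<phi> v ! (m - 1) = (if m \<in> I (Suc i) then v ! i else w (Suc i) ! (m - 1))))"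

definition word_subspace :: "nat \<Rightarrow> (nat list \<Rightarrow> nat list) \<Rightarrow> bool" where
  "word_subspace k \<phi> \<longleftrightarrow> (\<exists>N I w. subspace_data k N I w \<phi>)"

definition line_data ::
  "nat \<Rightarrow> nat \<Rightarrow> nat set \<Rightarrow> (nat \<Rightarrow> nat) \<Rightarrow> (nat \<Rightarrow> nat list) \<Rightarrow> bool" where
  "line_data k N I w l \<longleftrightarrow>
     1 \<le> N \<and> I \<noteq> {} \<and> I \<subseteq> {1..N} \<and> w \<in> {1..N} - I \<rightarrow> {1..k} \<and>
     (\<forall>i\<in>{1..k}. length (l i) = N \<and>
        (\<forall>m\<in>{1..N}. l i ! (m - 1) = (if m \<in> I then i else w m)))"

definition comb_line :: "nat \<Rightarrow> (nat \<Rightarrow> nat list) \<Rightarrow> bool" where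
  "comb_line k l \<longleftrightarrow> (\<exists>N I w. line_data k N I w l)"

text \<open>Throughout, a measurable space is represented by a measure \<open>X\<close> of which only \<open>space X\<close> and
  \<open>sets X\<close> matter. Points of the product space are functions on \<open>nat list\<close> that are \<open>undefined\<close>
  off \<open>words k\<close>.\<close>

abbreviation word_space :: "nat \<Rightarrow> 'a measure \<Rightarrow> (nat list \<Rightarrow> 'a) measure" where
  "word_space k X \<equiv> Pi\<^sub>M (words k) (\<lambda>_. X)"

definition law :: "nat \<Rightarrow> 'a measure \<Rightarrow> (nat list \<Rightarrow> 'a) measure \<Rightarrow> bool" where
  "law k X \<mu> \<longleftrightarrow> standard_borel X \<and> prob_space \<mu> \<and> sets \<mu> = sets (word_space k X)"

definition subspace_pullback ::
  "nat \<Rightarrow> 'a measure \<Rightarrow> (nat list \<Rightarrow> nat list) \<Rightarrow> (nat list \<Rightarrow> 'a) measure \<Rightarrow> (nat list \<Rightarrow> 'a) measure" where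
  "subspace_pullback k X \<phi> \<mu> = distr \<mu> (word_space k X) (\<lambda>x. \<lambda>u\<in>words k. x (\<phi> u))"

definition strongly_stationary :: "nat \<Rightarrow> 'a measure \<Rightarrow> (nat list \<Rightarrow> 'a) measure \<Rightarrow> bool" where
  "strongly_stationary k X \<mu> \<longleftrightarrow>
     law k X \<mu> \<and> (\<forall>\<phi>. word_subspace k \<phi> \<longrightarrow> subspace_pullback k X \<phi> \<mu> = \<mu>)"

text \<open>The two marginals are taken along the word \<open>[1]\<close> and the line \<open>i \<mapsto> [i]\<close>. For strongly
  stationary laws any other word or line gives the same marginal, see \<open>point_marginal_eq\<close> and
  \<open>line_marginal_eq\<close>.\<close>

definition point_marginal :: "'a measure \<Rightarrow> (nat list \<Rightarrow> 'a) measure \<Rightarrow> 'a measure" where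
  "point_marginal X \<mu> = distr \<mu> X (\<lambda>x. x [1])"

definition line_marginal :: "nat \<Rightarrow> 'a measure \<Rightarrow> (nat list \<Rightarrow> 'a) measure \<Rightarrow> (nat \<Rightarrow> 'a) measure" where
  "line_marginal k X \<mu> = distr \<mu> (Pi\<^sub>M {1..k} (\<lambda>_. X)) (\<lambda>x. \<lambda>i\<in>{1..k}. x [i])"

definition law_extension ::
  "nat \<Rightarrow> 'b measure \<Rightarrow> (nat list \<Rightarrow> 'b) measure \<Rightarrow> ('b \<Rightarrow> 'a) \<Rightarrow> 'a measure \<Rightarrow> (nat list \<Rightarrow> 'a) measure \<Rightarrow> bool" where
  "law_extension k Y \<nu> \<pi> X \<mu> \<longleftrightarrow>
     law k Y \<nu> \<and> \<pi> \<in> measurable Y X \<and>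
     distr \<nu> (word_space k X) (\<lambda>y. \<lambda>u\<in>words k. \<pi> (y u)) = \<mu>"

definition Phi :: "nat \<Rightarrow> 'a measure \<Rightarrow> (nat list \<Rightarrow> 'a) measure \<Rightarrow> nat set \<Rightarrow> 'a set set" where
  "Phi k X \<mu> e =
     {A \<in> sets X. \<forall>l. comb_line k l \<longrightarrow>
        (AE x in \<mu>. \<forall>i\<in>e. \<forall>j\<in>e. (indicator A (x (l i)) :: real) = indicator A (x (l j)))}"

definition up_set :: "nat \<Rightarrow> nat set set \<Rightarrow> bool" where
  "up_set k \<I> \<longleftrightarrow>
     \<I> \<subseteq> {e. e \<subseteq> {1..k} \<and> 2 \<le> card e} \<and>
     (\<forall>u v. u \<in> \<I> \<and> u \<subseteq> v \<and> v \<subseteq> {1..k} \<longrightarrow> v \<in> \<I>)"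

definition Phi_join :: "nat \<Rightarrow> 'a measure \<Rightarrow> (nat list \<Rightarrow> 'a) measure \<Rightarrow> nat set set \<Rightarrow> 'a measure" where
  "Phi_join k X \<mu> \<I> = sigma (space X) (\<Union>e\<in>\<I>. Phi k X \<mu> e)"

text \<open>The oblique copy adjoins to \<open>\<pi>\<^sub>i\<^sup>-\<^sup>1(\<Phi>\<^sub>e)\<close> all negligible sets of the line marginal (subsets of
  measurable null sets included), so it lives in the completion of the line marginal. The
  representative \<open>i = Min e\<close> is immaterial, see \<open>oblique_eq\<close>.\<close>

definition coordinate_copy ::
  "nat \<Rightarrow> 'a measure \<Rightarrow> (nat list \<Rightarrow> 'a) measure \<Rightarrow> nat \<Rightarrow> nat set \<Rightarrow> (nat \<Rightarrow> 'a) set set" where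
  "coordinate_copy k X \<mu> i e =
     {(\<lambda>y. y i) -` A \<inter> space (line_marginal k X \<mu>) | A. A \<in> Phi k X \<mu> e}"

definition completed_copy ::
  "nat \<Rightarrow> 'a measure \<Rightarrow> (nat list \<Rightarrow> 'a) measure \<Rightarrow> nat \<Rightarrow> nat set \<Rightarrow> (nat \<Rightarrow> 'a) set set" where
  "completed_copy k X \<mu> i e =
     sigma_sets (space (line_marginal k X \<mu>))
       (coordinate_copy k X \<mu> i e \<union> null_sets (completion (line_marginal k X \<mu>)))"

definition oblique ::
  "nat \<Rightarrow> 'a measure \<Rightarrow> (nat list \<Rightarrow> 'a) measure \<Rightarrow> nat set \<Rightarrow> (nat \<Rightarrow> 'a) set set" where
  "oblique k X \<mu> e = completed_copy k X \<mu> (Min e) e"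

definition oblique_join ::
  "nat \<Rightarrow> 'a measure \<Rightarrow> (nat list \<Rightarrow> 'a) measure \<Rightarrow> nat set set \<Rightarrow> (nat \<Rightarrow> 'a) measure" where
  "oblique_join k X \<mu> \<I> = sigma (space (line_marginal k X \<mu>)) (\<Union>e\<in>\<I>. oblique k X \<mu> e)"

definition rel_indep :: "'a measure \<Rightarrow> 'a measure \<Rightarrow> 'a measure \<Rightarrow> 'a measure \<Rightarrow> bool" where
  "rel_indep M F G H \<longleftrightarrow>
     (\<forall>f g :: 'a \<Rightarrow> real. f \<in> borel_measurable F \<longrightarrow> bounded (f ` space F) \<longrightarrow>
        g \<in> borel_measurable G \<longrightarrow> bounded (g ` space G) \<longrightarrow>
        (AE x in M. real_cond_exp M H (\<lambda>x. f x * g x) x = real_cond_exp M H f x * real_cond_exp M H g x))"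

text \<open>HOL cannot quantify over the type carrying the extension. Nothing is lost by letting it range
  over standard Borel spaces with underlying set in \<open>real\<close>: every standard Borel space is
  isomorphic to one of these, see \<open>standard_borel_iso_real\<close>. No relation between their
  \<open>\<sigma>\<close>-algebra and the usual Borel \<open>\<sigma>\<close>-algebra of \<open>real\<close> is required.\<close>

definition sated :: "nat \<Rightarrow> 'a measure \<Rightarrow> (nat list \<Rightarrow> 'a) measure \<Rightarrow> nat set set \<Rightarrow> bool" where
  "sated k X \<mu> \<I> \<longleftrightarrow>
     (\<forall>(Y :: real measure) \<nu> \<pi>. strongly_stationary k Y \<nu> \<and> law_extension k Y \<nu> \<pi> X \<mu> \<longrightarrow>
        rel_indep (point_marginal Y \<nu>)
          (vimage_algebra (space Y) \<pi> X)
          (Phi_join k Y \<nu> \<I>)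
          (vimage_algebra (space Y) \<pi> (Phi_join k X \<mu> \<I>)))"

definition fully_sated :: "nat \<Rightarrow> 'a measure \<Rightarrow> (nat list \<Rightarrow> 'a) measure \<Rightarrow> bool" where
  "fully_sated k X \<mu> \<longleftrightarrow> (\<forall>\<I>. up_set k \<I> \<and> \<I> \<noteq> {} \<longrightarrow> sated k X \<mu> \<I>)"


section \<open>Consistency of the definitions\<close>

lemma completely_metrizable_lepoll_real:
  assumes "completely_metrizable_space T" "second_countable T"
  shows "topspace T \<lesssim> (UNIV :: real set)"
proof -
  have "Hausdorff_space T"
    using assms(1) completely_metrizable_imp_metrizable_space metrizable_imp_Hausdorff_space by blast
  obtain \<B> where \<B>: "countable \<B>" "\<And>V. V \<in> \<B> \<Longrightarrow> openin T V"
    "\<And>U x. openin T U \<Longrightarrow> x \<in> U \<Longrightarrow> \<exists>V \<in> \<B>. x \<in> V \<and> V \<subseteq> U"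
    using assms(2) unfolding second_countable_def by metis
  define h where "h x = {n. \<exists>V\<in>\<B>. to_nat_on \<B> V = n \<and> x \<in> V}" for x
  have inj: "inj_on h (topspace T)"
  proof (rule inj_onI, rule ccontr)
    fix x y assume xy: "x \<in> topspace T" "y \<in> topspace T" "h x = h y" "x \<noteq> y"
    then obtain U where "openin T U" "x \<in> U" "y \<notin> U"
      using \<open>Hausdorff_space T\<close> unfolding Hausdorff_space_def disjnt_def by (metis IntI empty_iff)
    then obtain V where V: "V \<in> \<B>" "x \<in> V" "y \<notin> V"
      using \<B>(3) by blast
    then have "to_nat_on \<B> V \<in> h x" by (auto simp: h_def)
    then obtain V' where "V' \<in> \<B>" "to_nat_on \<B> V' = to_nat_on \<B> V" "y \<in> V'"
      using xy(3) by (auto simp: h_def)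
    then show False
      using V inj_on_to_nat_on[OF \<B>(1)] by (metis inj_onD)
  qed
  have "topspace T \<lesssim> (UNIV :: nat set set)"
    unfolding lepoll_def using inj by blast
  then show ?thesis
    using nat_sets_eqpoll_reals by (meson eqpoll_imp_lepoll lepoll_trans)
qed

lemma standard_borel_iso_real:
  fixes X :: "'a measure"
  assumes "standard_borel X"
  obtains Y :: "real measure" and f g where
    "standard_borel Y" "f \<in> measurable X Y" "g \<in> measurable Y X"
    "\<And>x. x \<in> space X \<Longrightarrow> g (f x) = x" "\<And>y. y \<in> space Y \<Longrightarrow> f (g y) = y"
proof -
  obtain T where T: "completely_metrizable_space T" "second_countable T" "topspace T = space X"
    "sets X = sigma_sets (topspace T) {U. openin T U}"
    using assms unfolding standard_borel_def by blast
  obtain f :: "'a \<Rightarrow> real" where f: "inj_on f (space X)"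
    using completely_metrizable_lepoll_real[OF T(1,2)] T(3) unfolding lepoll_def by auto
  define g where "g = inv_into (space X) f"
  have gf: "g (f x) = x" if "x \<in> space X" for x
    using that f by (simp add: g_def)
  define S where "S = f ` space X"
  have gS: "g y \<in> space X" "f (g y) = y" if "y \<in> S" for y
    using that gf by (auto simp: S_def)
  define T' where "T' = pullback_topology S g T"
  have top': "topspace T' = S"
    using gS(1) by (auto simp: T'_def topspace_pullback_topology T(3))
  have open': "openin T' U \<longleftrightarrow> (\<exists>V. openin T V \<and> U = g -` V \<inter> S)" for U
    unfolding T'_def openin_pullback_topology ..
  have fU: "f x \<in> U \<longleftrightarrow> x \<in> V" if "x \<in> space X" "U = g -` V \<inter> S" for x U V
    using that gf[OF that(1)] by (simp add: S_def)
  have homeo: "homeomorphic_maps T T' f g"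
    unfolding homeomorphic_maps_def
  proof (intro conjI ballI)
    show "continuous_map T' T g"
      unfolding continuous_map_def
    proof (intro conjI allI impI)
      show "g \<in> topspace T' \<rightarrow> topspace T" using gS(1) top' T(3) by auto
      fix U assume "openin T U"
      moreover have "{x \<in> topspace T'. g x \<in> U} = g -` U \<inter> S" using top' by auto
      ultimately show "openin T' {x \<in> topspace T'. g x \<in> U}" using open' by auto
    qed
    show "continuous_map T T' f"
      unfolding continuous_map_def
    proof (intro conjI allI impI)
      show "f \<in> topspace T \<rightarrow> topspace T'" using top' T(3) by (auto simp: S_def)
      fix U assume "openin T' U"
      then obtain V where V: "openin T V" "U = g -` V \<inter> S" using open' by auto
      then have "V \<subseteq> space X" using openin_subset T(3) by blast
      then have "{x \<in> topspace T. f x \<in> U} = V"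
        using V T(3) fU by blast
      then show "openin T {x \<in> topspace T. f x \<in> U}" using V by simp
    qed
  qed (use gf gS T(3) top' in auto)
  have hs: "T homeomorphic_space T'"
    using homeo unfolding homeomorphic_space_def by blast
  define Y where "Y = sigma S {U. openin T' U}"
  have sub: "{U. openin T' U} \<subseteq> Pow S"
    using openin_subset top' by blast
  have spY: "space Y = S" and setsY: "sets Y = sigma_sets S {U. openin T' U}"
    using sub by (simp_all add: Y_def)
  have "standard_borel Y"
    unfolding standard_borel_def
  proof (intro exI[of _ T'] conjI)
    show "completely_metrizable_space T'"
      using homeomorphic_completely_metrizable_space[OF hs] T(1) by simp
    show "second_countable T'"
      using homeomorphic_space_second_countability[OF hs] T(2) by simp
    show "topspace T' = space Y" "sets Y = sigma_sets (topspace T') {U. openin T' U}"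
      using spY setsY top' by simp_all
  qed
  moreover have "f \<in> measurable X Y"
  proof (rule measurable_sigma_sets[OF setsY sub])
    show "f \<in> space X \<rightarrow> S" by (auto simp: S_def)
    fix U assume "U \<in> {U. openin T' U}"
    then obtain V where V: "openin T V" "U = g -` V \<inter> S" using open' by auto
    then have "V \<subseteq> space X" using openin_subset T(3) by blast
    then have "f -` U \<inter> space X = V"
      using V T(3) fU by blast
    then show "f -` U \<inter> space X \<in> sets X"
      using V T(4) by (simp add: sigma_sets.Basic)
  qed
  moreover have "g \<in> measurable Y X"
  proof (rule measurable_sigma_sets[OF T(4)])
    show "{U. openin T U} \<subseteq> Pow (topspace T)" using openin_subset by blast
    show "g \<in> space Y \<rightarrow> topspace T" using gS(1) spY T(3) by auto
    fix U assume "U \<in> {U. openin T U}"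
    then have "openin T' (g -` U \<inter> S)" using open' by auto
    then show "g -` U \<inter> space Y \<in> sets Y"
      unfolding spY setsY by (auto intro: sigma_sets.Basic)
  qed
  ultimately show thesis
    using that gf gS(2) spY by blast
qed

lemma word_index_block:
  fixes N :: "nat \<Rightarrow> nat"
  assumes "N 0 = 0" "0 < m" "m \<le> N n"
  obtains i where "i < n" "N i < m" "m \<le> N (Suc i)"
proof -
  have "\<exists>i<n. N i < m \<and> m \<le> N (Suc i)"
    using assms(3)
  proof (induction n)
    case 0
    then show ?case using assms by simp
  next
    case (Suc n)
    then show ?case by (metis leI less_Suc_eq)
  qed
  then show thesis using that by blast
qed

lemma word_subspace_maps:
  assumes "word_subspace k \<phi>" "v \<in> words k"
  shows "\<phi> v \<in> words k"
proof -
  obtain N I w where D: "subspace_data k N I w \<phi>"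
    using assms(1) by (auto simp: word_subspace_def)
  have N: "N 0 = 0" "strict_mono N"
    and w: "\<And>i. length (w (Suc i)) = N (Suc i) \<and> set (w (Suc i)) \<subseteq> {1..k}"
    and len: "length (\<phi> v) = N (length v)"
    and \<phi>: "\<And>i m. i < length v \<Longrightarrow> N i < m \<Longrightarrow> m \<le> N (Suc i) \<Longrightarrow>
      \<phi> v ! (m - 1) = (if m \<in> I (Suc i) then v ! i else w (Suc i) ! (m - 1))"
    using D assms(2) unfolding subspace_data_def by simp_all
  have v: "v \<noteq> []" "set v \<subseteq> {1..k}" using assms(2) by (auto simp: words_def)
  have "0 < N (length v)"
    using N(1) strict_monoD[OF N(2), of 0 "length v"] v(1) by simp
  moreover have "\<phi> v ! p \<in> {1..k}" if p: "p < length (\<phi> v)" for p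
  proof -
    obtain i where i: "i < length v" "N i < Suc p" "Suc p \<le> N (Suc i)"
      using word_index_block[of N "Suc p" "length v"] N(1) p len by auto
    have "w (Suc i) ! p \<in> set (w (Suc i))" using i w[of i] by (intro nth_mem) auto
    then have "w (Suc i) ! p \<in> {1..k}" using w[of i] by blast
    moreover have "v ! i \<in> {1..k}" using v(2) nth_mem[OF i(1)] by blast
    moreover have "\<phi> v ! p = (if Suc p \<in> I (Suc i) then v ! i else w (Suc i) ! p)"
      using \<phi>[OF i] by simp
    ultimately show ?thesis by simp
  qed
  ultimately show ?thesis
    using len by (auto simp: words_def in_set_conv_nth)
qed

lemma word_subspace_inj:
  assumes "word_subspace k \<phi>"
  shows "inj_on \<phi> (words k)"
proof (rule inj_onI)
  fix u v assume uv: "u \<in> words k" "v \<in> words k" "\<phi> u = \<phi> v"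
  obtain N I w where D: "subspace_data k N I w \<phi>"
    using assms(1) by (auto simp: word_subspace_def)
  have N: "strict_mono N"
    and I: "\<And>i. I (Suc i) \<noteq> {} \<and> I (Suc i) \<subseteq> {1..N (Suc i)} - {1..N i}"
    and len: "\<And>v. v \<in> words k \<Longrightarrow> length (\<phi> v) = N (length v)"
    and \<phi>: "\<And>v i m. v \<in> words k \<Longrightarrow> i < length v \<Longrightarrow> N i < m \<Longrightarrow> m \<le> N (Suc i) \<Longrightarrow>
      \<phi> v ! (m - 1) = (if m \<in> I (Suc i) then v ! i else w (Suc i) ! (m - 1))"
    using D unfolding subspace_data_def by simp_all
  have l: "length u = length v"
    using len[OF uv(1)] len[OF uv(2)] uv(3) strict_mono_eq[OF N] by simp
  show "u = v"
  proof (rule nth_equalityI[OF l])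
    fix i assume i: "i < length u"
    obtain m where m: "m \<in> I (Suc i)" using I by blast
    then have "N i < m" "m \<le> N (Suc i)" using I[of i] by auto
    then show "u ! i = v ! i"
      using \<phi>[OF uv(1) i] \<phi>[OF uv(2), of i m] i l uv(3) m by simp
  qed
qed

lemma comb_line_in_words:
  assumes "comb_line k l" "i \<in> {1..k}"
  shows "l i \<in> words k"
proof -
  obtain N I w where D: "line_data k N I w l"
    using assms(1) by (auto simp: comb_line_def)
  have N: "1 \<le> N" and w: "w \<in> {1..N} - I \<rightarrow> {1..k}"
    and l: "length (l i) = N" "\<forall>m\<in>{1..N}. l i ! (m - 1) = (if m \<in> I then i else w m)"
    using D assms(2) unfolding line_data_def by simp_all
  have "l i ! p \<in> {1..k}" if "p < N" for p
    using l(2)[rule_format, of "Suc p"] that w assms(2) by (auto simp: Pi_iff)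
  then show ?thesis
    using N l(1) by (auto simp: words_def in_set_conv_nth)
qed

lemma comb_line_subspace:
  assumes "comb_line k l" "1 \<le> k"
  obtains \<phi> where "word_subspace k \<phi>" "\<And>i. i \<in> {1..k} \<Longrightarrow> \<phi> [i] = l i"
proof -
  obtain N I w where D: "line_data k N I w l"
    using assms(1) by (auto simp: comb_line_def)
  have N: "1 \<le> N" and I: "I \<noteq> {}" "I \<subseteq> {1..N}"
    and l: "\<And>i. i \<in> {1..k} \<Longrightarrow> length (l i) = N"
      "\<And>i m. i \<in> {1..k} \<Longrightarrow> m \<in> {1..N} \<Longrightarrow> l i ! (m - 1) = (if m \<in> I then i else w m)"
    using D unfolding line_data_def by simp_all
  define N' where "N' n = (if n = 0 then 0 else N + n - 1)" for n
  define I' where "I' n = (if n = 1 then I else {N + n - 1})" for n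
  define w' where "w' n = l 1 @ replicate (n - 1) 1" for n
  define \<phi> where "\<phi> v = l (hd v) @ tl v" for v
  have 1: "1 \<in> {1..k}" using assms by simp
  have "subspace_data k N' I' w' \<phi>"
    unfolding subspace_data_def
  proof (intro conjI allI ballI impI)
    show "N' 0 = 0" by (simp add: N'_def)
    show "strict_mono N'" using N by (auto simp: strict_mono_Suc_iff N'_def)
    show "I' (Suc i) \<noteq> {}" for i using I by (auto simp: I'_def)
    show "I' (Suc i) \<subseteq> {1..N' (Suc i)} - {1..N' i}" for i
      using I N by (auto simp: I'_def N'_def)
    show "length (w' (Suc i)) = N' (Suc i)" for i
      using l(1)[OF 1] by (simp add: w'_def N'_def)
    show "set (w' (Suc i)) \<subseteq> {1..k}" for i
      using comb_line_in_words[OF assms(1) 1] assms(2) by (auto simp: w'_def words_def)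
    fix v assume v: "v \<in> words k"
    then have hd: "hd v \<in> {1..k}" and ne: "v \<noteq> []"
      using hd_in_set by (force simp: words_def)+
    show "length (\<phi> v) = N' (length v)"
      using ne l(1)[OF hd] by (cases v) (auto simp: \<phi>_def N'_def)
    fix i m assume i: "i < length v" and "N' i < m \<and> m \<le> N' (Suc i)"
    then have m: "N' i < m" "m \<le> N' (Suc i)" by auto
    show "\<phi> v ! (m - 1) = (if m \<in> I' (Suc i) then v ! i else w' (Suc i) ! (m - 1))"
    proof (cases i)
      case 0
      then have m': "m \<in> {1..N}" using m by (auto simp: N'_def)
      then have "m - 1 < N" by auto
      then show ?thesis
        using 0 l(2)[OF hd m'] l(2)[OF 1 m'] l(1)[OF hd] l(1)[OF 1] ne
        by (simp add: \<phi>_def I'_def w'_def nth_append hd_conv_nth)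
    next
      case (Suc j)
      then have m': "m = N + i" using m by (auto simp: N'_def)
      have "m \<in> I' (Suc i)" using m' Suc by (simp add: I'_def)
      moreover have "\<phi> v ! (m - 1) = v ! i"
        using m' Suc l(1)[OF hd] i N by (cases v) (auto simp: \<phi>_def nth_append)
      ultimately show ?thesis by simp
    qed
  qed
  then have "word_subspace k \<phi>" by (auto simp: word_subspace_def)
  moreover have "\<phi> [i] = l i" for i by (simp add: \<phi>_def)
  ultimately show thesis using that by blast
qed

lemma line_marginal_eq:
  assumes ss: "strongly_stationary k X \<mu>" and k: "1 \<le> k" and l: "comb_line k l"
  shows "distr \<mu> (Pi\<^sub>M {1..k} (\<lambda>_. X)) (\<lambda>x. \<lambda>i\<in>{1..k}. x (l i)) = line_marginal k X \<mu>"
proof -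
  obtain \<phi> where \<phi>: "word_subspace k \<phi>" "\<And>i. i \<in> {1..k} \<Longrightarrow> \<phi> [i] = l i"
    using comb_line_subspace[OF l k] by blast
  have sets: "sets \<mu> = sets (word_space k X)"
    using ss by (simp add: strongly_stationary_def law_def)
  have m1: "(\<lambda>x. \<lambda>u\<in>words k. x (\<phi> u)) \<in> measurable \<mu> (word_space k X)"
    unfolding measurable_cong_sets[OF sets refl]
    by (intro measurable_restrict measurable_component_singleton word_subspace_maps[OF \<phi>(1)])
  have si: "[i] \<in> words k" if "i \<in> {1..k}" for i
    using that by (simp add: words_def)
  have m2: "(\<lambda>x. \<lambda>i\<in>{1..k}. x [i]) \<in> measurable (word_space k X) (Pi\<^sub>M {1..k} (\<lambda>_. X))"
    by (intro measurable_restrict measurable_component_singleton si)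
  have "line_marginal k X \<mu> =
      distr (subspace_pullback k X \<phi> \<mu>) (Pi\<^sub>M {1..k} (\<lambda>_. X)) (\<lambda>x. \<lambda>i\<in>{1..k}. x [i])"
    using ss \<phi>(1) by (simp add: strongly_stationary_def line_marginal_def)
  also have "\<dots> = distr \<mu> (Pi\<^sub>M {1..k} (\<lambda>_. X))
      ((\<lambda>x. \<lambda>i\<in>{1..k}. x [i]) \<circ> (\<lambda>x. \<lambda>u\<in>words k. x (\<phi> u)))"
    unfolding subspace_pullback_def by (rule distr_distr[OF m2 m1])
  also have "(\<lambda>x. \<lambda>i\<in>{1..k}. x [i]) \<circ> (\<lambda>x. \<lambda>u\<in>words k. x (\<phi> u)) = (\<lambda>x. \<lambda>i\<in>{1..k}. x (l i) :: 'a)"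
    using si \<phi>(2) by (auto simp: fun_eq_iff restrict_def)
  finally show ?thesis ..
qed

lemma distr_line_point:
  assumes ss: "strongly_stationary k X \<mu>" and k: "1 \<le> k" and l: "comb_line k l" and i: "i \<in> {1..k}"
  shows "distr \<mu> X (\<lambda>x. x (l i)) = distr \<mu> X (\<lambda>x. x [i])"
proof -
  have sets: "sets \<mu> = sets (word_space k X)"
    using ss by (simp add: strongly_stationary_def law_def)
  have *: "distr (distr \<mu> (Pi\<^sub>M {1..k} (\<lambda>_. X)) (\<lambda>x. \<lambda>i\<in>{1..k}. x (c i))) X (\<lambda>y. y i)
      = distr \<mu> X (\<lambda>x. x (c i))" if "\<And>j. j \<in> {1..k} \<Longrightarrow> c j \<in> words k" for c :: "nat \<Rightarrow> nat list"
  proof -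
    have m1: "(\<lambda>x. \<lambda>i\<in>{1..k}. x (c i)) \<in> measurable \<mu> (Pi\<^sub>M {1..k} (\<lambda>_. X))"
      unfolding measurable_cong_sets[OF sets refl]
      by (intro measurable_restrict measurable_component_singleton that)
    show ?thesis
      using i by (subst distr_distr[OF measurable_component_singleton[OF i] m1]) (simp add: o_def)
  qed
  have "distr (distr \<mu> (Pi\<^sub>M {1..k} (\<lambda>_. X)) (\<lambda>x. \<lambda>i\<in>{1..k}. x (l i))) X (\<lambda>y. y i)
      = distr (line_marginal k X \<mu>) X (\<lambda>y. y i)"
    by (simp only: line_marginal_eq[OF ss k l])
  then show ?thesis
    unfolding line_marginal_def
    using *[of l] *[of "\<lambda>i. [i]"] comb_line_in_words[OF l] by (simp add: words_def)
qed

lemma point_marginal_eq: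
  assumes ss: "strongly_stationary k X \<mu>" and k: "1 \<le> k" and u: "u \<in> words k"
  shows "distr \<mu> X (\<lambda>x. x u) = point_marginal X \<mu>"
proof -
  obtain a v where av: "u = a # v" "a \<in> {1..k}" "set v \<subseteq> {1..k}"
    using u by (cases u) (auto simp: words_def)
  have "line_data k (Suc (length v)) {1} (\<lambda>m. v ! (m - 2)) (\<lambda>i. i # v)"
    unfolding line_data_def
  proof (intro conjI ballI Pi_I)
    fix m assume "m \<in> {1..Suc (length v)} - {1}"
    then have "m - 2 < length v" by auto
    then show "v ! (m - 2) \<in> {1..k}" using av(3) nth_mem by blast
  next
    fix i m assume "m \<in> {1..Suc (length v)}"
    show "(i # v) ! (m - 1) = (if m \<in> {1} then i else v ! (m - 2))"
      using \<open>m \<in> _\<close> by (cases "m = 1") (auto simp: nth_Cons' numeral_2_eq_2)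
  qed auto
  then have "comb_line k (\<lambda>i. i # v)" by (auto simp: comb_line_def)
  then have 1: "distr \<mu> X (\<lambda>x. x u) = distr \<mu> X (\<lambda>x. x [a])"
    using distr_line_point[OF ss k, of "\<lambda>i. i # v" a] av by simp
  have "line_data k 2 {2} (\<lambda>_. 1) (\<lambda>i. [1, i])"
    using k by (auto simp: line_data_def nth_Cons')
  then have "comb_line k (\<lambda>i. [1, i])" by (auto simp: comb_line_def)
  then have 2: "distr \<mu> X (\<lambda>x. x [1, a]) = distr \<mu> X (\<lambda>x. x [a])"
    using distr_line_point[OF ss k, of "\<lambda>i. [1, i]" a] av by simp
  have "line_data k 2 {1} (\<lambda>_. a) (\<lambda>i. [i, a])"
    using av(2) by (auto simp: line_data_def nth_Cons')
  then have "comb_line k (\<lambda>i. [i, a])" by (auto simp: comb_line_def)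
  then have 3: "distr \<mu> X (\<lambda>x. x [1, a]) = distr \<mu> X (\<lambda>x. x [1])"
    using distr_line_point[OF ss k, of "\<lambda>i. [i, a]" 1] k by simp
  show ?thesis
    using 1 2 3 by (simp add: point_marginal_def)
qed

lemma prob_space_line_marginal:
  assumes "law k X \<mu>"
  shows "prob_space (line_marginal k X \<mu>)"
proof -
  have sets: "sets \<mu> = sets (word_space k X)" using assms by (simp add: law_def)
  have "(\<lambda>x. \<lambda>i\<in>{1..k}. x [i]) \<in> measurable \<mu> (Pi\<^sub>M {1..k} (\<lambda>_. X))"
    unfolding measurable_cong_sets[OF sets refl]
    by (intro measurable_restrict measurable_component_singleton) (simp add: words_def)
  then show ?thesis
    using assms unfolding law_def line_marginal_def by (metis prob_space.prob_space_distr)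
qed

lemma coordinate_copies_agree:
  assumes law: "law k X \<mu>" and A: "A \<in> Phi k X \<mu> e" and e: "e \<subseteq> {1..k}" and ij: "i \<in> e" "j \<in> e"
  shows "AE y in line_marginal k X \<mu>. y i \<in> A \<longleftrightarrow> y j \<in> A"
proof -
  have sets: "sets \<mu> = sets (word_space k X)" using law by (simp add: law_def)
  have m: "(\<lambda>x. \<lambda>i\<in>{1..k}. x [i]) \<in> measurable \<mu> (Pi\<^sub>M {1..k} (\<lambda>_. X))"
    unfolding measurable_cong_sets[OF sets refl]
    by (intro measurable_restrict measurable_component_singleton) (simp add: words_def)
  have "line_data k 1 {1} (\<lambda>_. 1) (\<lambda>i. [i])"
    by (auto simp: line_data_def)
  then have "comb_line k (\<lambda>i. [i])" by (auto simp: comb_line_def)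
  then have AE: "AE x in \<mu>. \<forall>i\<in>e. \<forall>j\<in>e. (indicator A (x [i]) :: real) = indicator A (x [j])"
    using A by (simp add: Phi_def)
  have [measurable]: "A \<in> sets X" using A by (simp add: Phi_def)
  have [measurable]: "(\<lambda>y. y i) \<in> measurable (Pi\<^sub>M {1..k} (\<lambda>_. X)) X"
    "(\<lambda>y. y j) \<in> measurable (Pi\<^sub>M {1..k} (\<lambda>_. X)) X"
    using e ij by (auto intro!: measurable_component_singleton)
  have P: "{y \<in> space (Pi\<^sub>M {1..k} (\<lambda>_. X)). y i \<in> A \<longleftrightarrow> y j \<in> A} \<in> sets (Pi\<^sub>M {1..k} (\<lambda>_. X))"
    by measurable
  show ?thesis
    unfolding line_marginal_def AE_distr_iff[OF m P]
    using AE
  proof (eventually_elim)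
    fix x assume "\<forall>i\<in>e. \<forall>j\<in>e. (indicator A (x [i]) :: real) = indicator A (x [j])"
    then have "(indicator A (x [i]) :: real) = indicator A (x [j])" using ij by blast
    then show "((\<lambda>i\<in>{1..k}. x [i]) i \<in> A) = ((\<lambda>i\<in>{1..k}. x [i]) j \<in> A)"
      using e ij by (auto simp: indicator_def split: if_splits)
  qed
qed

lemma coordinate_copy_sets:
  assumes "e \<subseteq> {1..k}" "i \<in> e"
  shows "coordinate_copy k X \<mu> i e \<subseteq> sets (line_marginal k X \<mu>)"
proof -
  have "(\<lambda>y. y i) \<in> measurable (line_marginal k X \<mu>) X"
    using assms by (auto simp: line_marginal_def intro!: measurable_component_singleton)
  then show ?thesis
    by (auto simp: coordinate_copy_def Phi_def intro: measurable_sets)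
qed

lemma coordinate_copy_completion_sets:
  assumes "e \<subseteq> {1..k}" "i \<in> e"
  shows "coordinate_copy k X \<mu> i e \<union> null_sets (completion (line_marginal k X \<mu>))
    \<subseteq> sets (completion (line_marginal k X \<mu>))"
proof (rule Un_least)
  show "coordinate_copy k X \<mu> i e \<subseteq> sets (completion (line_marginal k X \<mu>))"
    using coordinate_copy_sets[OF assms] sets_completionI_sets by (rule subset_trans[OF _ subsetI])
qed (rule subsetI, rule null_setsD2)

lemma completed_copy_mono:
  assumes law: "law k X \<mu>" and e: "e \<subseteq> {1..k}" and ij: "i \<in> e" "j \<in> e"
  shows "completed_copy k X \<mu> i e \<subseteq> completed_copy k X \<mu> j e"
proof -
  let ?L = "line_marginal k X \<mu>"
  let ?G = "coordinate_copy k X \<mu> j e \<union> null_sets (completion ?L)"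
  have "?G \<subseteq> Pow (space ?L)"
    using coordinate_copy_completion_sets[OF e ij(2)] sets.space_closed[of "completion ?L"]
    unfolding space_completion by (rule subset_trans)
  then interpret S: sigma_algebra "space ?L" "sigma_sets (space ?L) ?G"
    by (rule sigma_algebra_sigma_sets)
  have "coordinate_copy k X \<mu> i e \<union> null_sets (completion ?L) \<subseteq> sigma_sets (space ?L) ?G"
  proof
    fix B assume "B \<in> coordinate_copy k X \<mu> i e \<union> null_sets (completion ?L)"
    then consider "B \<in> null_sets (completion ?L)" | "B \<in> coordinate_copy k X \<mu> i e"
      by (elim UnE)
    then show "B \<in> sigma_sets (space ?L) ?G"
    proof cases
      case 1
      then show ?thesis by (intro sigma_sets.Basic UnI2)
    next
      case 2
      then obtain A where A: "A \<in> Phi k X \<mu> e" "B = (\<lambda>y. y i) -` A \<inter> space ?L"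
        unfolding coordinate_copy_def by blast
      define C where "C = (\<lambda>y. y j) -` A \<inter> space ?L"
      have C: "C \<in> coordinate_copy k X \<mu> j e" using A(1) unfolding C_def coordinate_copy_def by blast
      have sB: "B \<in> sets ?L" and sC: "C \<in> sets ?L"
        using 2 C coordinate_copy_sets[OF e ij(1), of X \<mu>] coordinate_copy_sets[OF e ij(2), of X \<mu>]
        by (simp_all only: subset_iff)
      have AE: "AE y in ?L. y i \<in> A \<longleftrightarrow> y j \<in> A"
        by (rule coordinate_copies_agree[OF law A(1) e ij])
      have "AE y in ?L. y \<notin> B - C" "AE y in ?L. y \<notin> C - B"
        using AE by (eventually_elim; auto simp: A(2) C_def)+
      then have "B - C \<in> null_sets ?L" "C - B \<in> null_sets ?L"
        using sB sC AE_iff_null_sets by blast+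
      then have n: "B - C \<in> null_sets (completion ?L)" "C - B \<in> null_sets (completion ?L)"
        using null_sets_completionI by blast+
      have "B = (C - (C - B)) \<union> (B - C)" by blast
      moreover have "(C - (C - B)) \<union> (B - C) \<in> sigma_sets (space ?L) ?G"
        by (rule S.Un[OF S.Diff[OF sigma_sets.Basic[OF UnI1[OF C]] sigma_sets.Basic[OF UnI2[OF n(2)]]]
              sigma_sets.Basic[OF UnI2[OF n(1)]]])
      ultimately show ?thesis by simp
    qed
  qed
  then show ?thesis
    unfolding completed_copy_def by (rule S.sigma_sets_subset)
qed

lemma oblique_eq:
  assumes "law k X \<mu>" "e \<subseteq> {1..k}" "i \<in> e"
  shows "oblique k X \<mu> e = completed_copy k X \<mu> i e"
proof -
  have "Min e \<in> e"
    using assms(2,3) by (metis Min_in empty_iff finite_atLeastAtMost finite_subset)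
  then show ?thesis
    unfolding oblique_def using completed_copy_mono[OF assms(1,2)] assms(3) by blast
qed

lemma subalgebra_oblique_join:
  assumes "up_set k \<I>"
  shows "subalgebra (completion (line_marginal k X \<mu>)) (oblique_join k X \<mu> \<I>)"
proof -
  let ?L = "line_marginal k X \<mu>"
  have *: "oblique k X \<mu> e \<subseteq> sets (completion ?L)" if "e \<in> \<I>" for e
  proof -
    have e: "e \<subseteq> {1..k}" "2 \<le> card e" using assms that unfolding up_set_def by blast+
    have "finite e" by (rule finite_subset[OF e(1)]) simp
    moreover have "e \<noteq> {}" using e(2) by force
    ultimately have "Min e \<in> e" by (rule Min_in)
    then show ?thesis
      unfolding oblique_def completed_copy_def
      using sets.sigma_sets_subset[OF coordinate_copy_completion_sets[OF e(1) \<open>Min e \<in> e\<close>]] by simp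
  qed
  then have "(\<Union>e\<in>\<I>. oblique k X \<mu> e) \<subseteq> sets (completion ?L)" by blast
  moreover from this have "(\<Union>e\<in>\<I>. oblique k X \<mu> e) \<subseteq> Pow (space ?L)"
    using sets.space_closed[of "completion ?L"] by simp
  ultimately show ?thesis
    using sets.sigma_sets_subset[of _ "completion ?L"]
    by (simp add: subalgebra_def oblique_join_def)
qed

lemma subalgebra_Phi_join: "subalgebra (point_marginal X \<mu>) (Phi_join k X \<mu> \<I>)"
proof -
  have "(\<Union>e\<in>\<I>. Phi k X \<mu> e) \<subseteq> sets X" by (auto simp: Phi_def)
  moreover from this have "(\<Union>e\<in>\<I>. Phi k X \<mu> e) \<subseteq> Pow (space X)"
    using sets.space_closed[of X] by blast
  ultimately show ?thesis
    using sets.sigma_sets_subset[of _ X]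
    by (simp add: subalgebra_def Phi_join_def point_marginal_def)
qed

lemma subalgebra_vimage_Phi_join:
  assumes "\<pi> \<in> measurable Y X"
  shows "subalgebra (point_marginal Y \<nu>) (vimage_algebra (space Y) \<pi> (Phi_join k X \<mu> \<I>))"
proof -
  have "sets (Phi_join k X \<mu> \<I>) \<subseteq> sets X" "space (Phi_join k X \<mu> \<I>) = space X"
    using subalgebra_Phi_join[of X \<mu> k \<I>] by (auto simp: subalgebra_def point_marginal_def)
  then have "\<pi> \<in> measurable Y (Phi_join k X \<mu> \<I>)"
    using assms by (auto simp: measurable_def)
  then have "sets (vimage_algebra (space Y) \<pi> (Phi_join k X \<mu> \<I>)) \<subseteq> sets Y"
    by (intro sets_image_in_sets) simp_all
  then show ?thesis
    by (simp add: subalgebra_def point_marginal_def)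
qed

end

theory Submission
  imports Defs
begin

text \<open>Write \<open>\<lambda>\<close> for the line marginal. Satedness enters through one consequence, \<open>sated_line_factor\<close>: if
\<open>A\<close> belongs to \<open>\<Phi>\<^sub>e\<close> and \<open>i \<in> e\<close>, then under \<open>\<lambda>\<close> the event \<open>x\<^sub>i \<in> A\<close> is seen by the coordinates
\<open>x\<^sub>j\<close> with \<open>j \<notin> e\<close> only through the conditional probability of \<open>A\<close> given the join of the \<open>\<Phi>\<^sub>a\<close>, where
\<open>a\<close> runs through the proper supersets of \<open>e\<close>.

Here is why. For \<open>j \<notin> e\<close> let \<open>r\<^sub>j\<close> replace every letter from \<open>e\<close> by \<open>j\<close>. The process
\<open>w \<mapsto> x(r\<^sub>j w)\<close> does not notice changes of letters inside \<open>e \<union> {j}\<close>. If \<open>u\<close> contains a letter from \<open>e\<close>,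
then the words \<open>r\<^sub>i u\<close> and \<open>r\<^sub>j u\<close>, \<open>j \<notin> e\<close>, lie on a line, and \<open>x(u) \<in> A\<close> is almost surely the same as
\<open>x(r\<^sub>i u) \<in> A\<close>. So the law of \<open>w \<mapsto> (x(w), (x(r\<^sub>j w))\<^sub>j)\<close> would be an extension of \<open>\<mu>\<close> to which satedness
applies and whose added coordinates are measurable for the right join of insensitive algebras, were it
strongly stationary. It is not, because a subspace may carry letters from \<open>e\<close> as fixed letters, and \<open>r\<^sub>j\<close> moves
them. Strong stationarity is restored by a limit along subspaces
\<open>v \<mapsto> p\<^sub>1(v\<^sub>1) p\<^sub>2(v\<^sub>2) \<dots>\<close> in which the variable words \<open>p\<^sub>1, p\<^sub>2, \<dots>\<close> tend one after the other to a fixed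
idempotent ultrafilter that absorbs the ultrafilters obtained by substituting a letter for the variable
(\<open>absorbing_ultrafilter\<close>, as in the proof of the Hales-Jewett theorem by ultrafilters). Composing
with a subspace then only multiplies this ultrafilter with itself and with its substitution instances, and this
changes nothing (\<open>stationary_ultrafilter\<close>). The limit is again a law because every coordinate keeps the same
distribution all along (\<open>ultralimit_of_laws\<close>), and it inherits the insensitivity of
the added coordinates and their joint law with \<open>\<Phi>\<^sub>e\<close> (\<open>insensitive_extension\<close>).

The theorem follows by induction on the number of sets in \<open>\<I> - \<I>'\<close> (\<open>oblique_joins_cond_indep\<close>). Remove from
\<open>\<I>\<close> a set \<open>e\<close> of minimal size in \<open>\<I> - \<I>'\<close>, so that \<open>\<I>\<^sub>0 = \<I> - {e}\<close> is still an up-set. By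
the first paragraph the conditional probability of an event from the oblique copy of \<open>\<Phi>\<^sub>e\<close>, given the join over
\<open>\<I>\<^sub>0 \<union> \<I>'\<close>, is measurable for the join over \<open>\<I>\<^sub>0\<close>. This replaces \<open>\<I>\<close> by \<open>\<I>\<^sub>0\<close>, and
\<open>\<I>\<^sub>0 \<inter> \<I>' = \<I> \<inter> \<I>'\<close>.\<close>

section \<open>Ultrafilters and idempotents\<close>

definition ultrafilter :: "'a filter \<Rightarrow> bool" where
  "ultrafilter U \<longleftrightarrow> U \<noteq> bot \<and> (\<forall>P. eventually P U \<or> eventually (\<lambda>x. \<not> P x) U)"

text \<open>A filter is used as a name for the set of ultrafilters below it; every closed set of ultrafilters arises in
this way, and it is nonempty if and only if the filter is not \<open>bot\<close>. Compactness of the space of ultrafilters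
becomes the fact that a chain of proper filters has a proper infimum, so minimal closed sets with a
property \<open>P\<close> come from Zorn's lemma without any topology.\<close>

lemma minimal_filter_exists:
  fixes F0 :: "'a filter"
  assumes F0: "F0 \<noteq> bot" "P F0"
    and chain: "\<And>C. C \<noteq> {} \<Longrightarrow> (\<And>F. F \<in> C \<Longrightarrow> F \<noteq> bot \<and> P F) \<Longrightarrow> P (Inf C)"
  obtains M where "M \<le> F0" "M \<noteq> bot" "P M" "\<And>F. F \<le> M \<Longrightarrow> F \<noteq> bot \<Longrightarrow> P F \<Longrightarrow> F = M"
proof -
  define A where "A = {F. F \<noteq> bot \<and> P F \<and> F \<le> F0}"
  have "\<exists>m\<in>A. \<forall>a\<in>A. a \<le> m \<longrightarrow> a = m"
  proof (rule predicate_Zorn[where P = "\<lambda>a b. b \<le> a"])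
    show "partial_order_on A (relation_of (\<lambda>a b. b \<le> a) A)"
      by (rule partial_order_on_relation_ofI) auto
  next
    fix C assume C: "C \<in> Chains (relation_of (\<lambda>a b. b \<le> a) A)"
    then have CA: "C \<subseteq> A" and tot: "\<And>F G. F \<in> C \<Longrightarrow> G \<in> C \<Longrightarrow> F \<le> G \<or> G \<le> F"
      by (auto simp: Chains_def relation_of_def)
    show "\<exists>u\<in>A. \<forall>a\<in>C. u \<le> a"
    proof (cases "C = {}")
      case True
      then show ?thesis using F0 by (auto simp: A_def)
    next
      case False
      have base: "eventually Q (Inf C) \<longleftrightarrow> (\<exists>F\<in>C. eventually Q F)" for Q
      proof (rule eventually_Inf_base[OF False])
        fix F G assume "F \<in> C" "G \<in> C"
        then show "\<exists>x\<in>C. x \<le> inf F G" using tot[of F G] by auto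
      qed
      have "Inf C \<noteq> bot"
        using CA by (auto simp: trivial_limit_def base A_def)
      moreover have "P (Inf C)" using CA False by (intro chain) (auto simp: A_def)
      moreover obtain F where "F \<in> C" using False by blast
      then have "Inf C \<le> F0" using CA by (intro Inf_lower2[of F]) (auto simp: A_def)
      ultimately show ?thesis by (auto simp: A_def intro: Inf_lower)
    qed
  qed
  then show thesis using that by (auto simp: A_def intro: order_trans)
qed

lemma inf_principal_neq_bot:
  assumes "\<not> eventually (\<lambda>x. \<not> P x) F"
  shows "inf F (principal {x. P x}) \<noteq> bot"
  using assms by (auto simp: trivial_limit_def eventually_inf_principal)

lemma ultra_exists:
  assumes "F \<noteq> bot"
  obtains U where "ultrafilter U" "U \<le> F"
proof -
  obtain M where M: "M \<le> F" "M \<noteq> bot" "\<And>G. G \<le> M \<Longrightarrow> G \<noteq> bot \<Longrightarrow> G = M"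
    by (rule minimal_filter_exists[OF assms, of "\<lambda>_. True"]) auto
  have "eventually P M \<or> eventually (\<lambda>x. \<not> P x) M" for P
  proof (rule disjCI)
    assume "\<not> eventually (\<lambda>x. \<not> P x) M"
    then have "inf M (principal {x. P x}) = M"
      using M(3) inf_principal_neq_bot by (metis inf.cobounded1)
    moreover have "eventually P (inf M (principal {x. P x}))"
      by (simp add: eventually_inf_principal)
    ultimately show "eventually P M" by simp
  qed
  then show thesis using that M by (auto simp: ultrafilter_def)
qed

lemma ultra_le_eq:
  assumes "ultrafilter U" "F \<le> U" "F \<noteq> bot"
  shows "F = U"
proof (rule antisym[OF assms(2)], rule filter_leI)
  fix P assume P: "eventually P F"
  show "eventually P U"
  proof (rule ccontr)
    assume "\<not> eventually P U"
    then have "eventually (\<lambda>x. \<not> P x) F" using assms by (auto simp: ultrafilter_def filter_leD)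
    with P have "eventually (\<lambda>x. False) F" by eventually_elim simp
    then show False using assms(3) by (simp add: trivial_limit_def)
  qed
qed

lemma filter_le_ultraI:
  assumes "\<And>U. ultrafilter U \<Longrightarrow> U \<le> F \<Longrightarrow> U \<le> G"
  shows "F \<le> G"
proof (rule filter_leI, rule ccontr)
  fix P assume P: "eventually P G" "\<not> eventually P F"
  then have "inf F (principal {x. \<not> P x}) \<noteq> bot" by (intro inf_principal_neq_bot) simp
  then obtain U where U: "ultrafilter U" "U \<le> inf F (principal {x. \<not> P x})" using ultra_exists by blast
  have "eventually (\<lambda>x. \<not> P x) U"
    by (rule filter_leD[OF U(2)]) (simp add: eventually_inf_principal)
  moreover have "eventually P U" using assms[OF U(1)] U(2) P(1) by (simp add: filter_leD)
  ultimately have "eventually (\<lambda>x. False) U" by eventually_elim simp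
  then show False using U(1) by (simp add: trivial_limit_def ultrafilter_def)
qed

lemma ultra_filtermap: "ultrafilter U \<Longrightarrow> ultrafilter (filtermap f U)"
  by (auto simp: ultrafilter_def eventually_filtermap filtermap_bot_iff)

lemma ultra_principal_singleton: "ultrafilter (principal {x})"
  by (auto simp: ultrafilter_def eventually_principal principal_eq_bot_iff)

lemma ultra_tendsto:
  fixes f :: "'a \<Rightarrow> real"
  assumes U: "ultrafilter U" and bound: "\<And>x. \<bar>f x\<bar> \<le> B"
  obtains c where "(f \<longlongrightarrow> c) U"
proof -
  have "ultrafilter (filtermap f U)" by (rule ultra_filtermap[OF U])
  then have uf: "filtermap f U \<noteq> bot" by (simp add: ultrafilter_def)
  have "eventually (\<lambda>x. x \<in> {-B..B}) (filtermap f U)"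
    using bound by (auto simp: eventually_filtermap abs_le_iff minus_le_iff intro!: always_eventually)
  then obtain c where c: "inf (nhds c) (filtermap f U) \<noteq> bot"
    using compact_Icc[of "-B" B] uf unfolding compact_filter by blast
  then have "inf (nhds c) (filtermap f U) = filtermap f U"
    by (intro ultra_le_eq ultra_filtermap U) auto
  then have "filtermap f U \<le> nhds c" by (metis inf.cobounded1)
  then show thesis using that by (simp add: filterlim_def)
qed

text \<open>Here \<open>y\<close> runs along \<open>G\<close> first and \<open>x\<close> along \<open>F\<close> afterwards, as in an iterated limit. For ultrafilters on
words and \<open>h = (@)\<close> this is multiplication in the Stone-Cech compactification of the free monoid,
continuous in the left factor.\<close>

definition iter_filter :: "'a filter \<Rightarrow> 'b filter \<Rightarrow> ('a \<Rightarrow> 'b \<Rightarrow> 'c) \<Rightarrow> 'c filter" where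
  "iter_filter F G h = Abs_filter (\<lambda>P. eventually (\<lambda>x. eventually (\<lambda>y. P (h x y)) G) F)"

lemma eventually_iter:
  fixes P :: "'c \<Rightarrow> bool"
  shows
  "eventually P (iter_filter F G h) \<longleftrightarrow> eventually (\<lambda>x. eventually (\<lambda>y. P (h x y)) G) F"
  unfolding iter_filter_def
proof (rule eventually_Abs_filter, rule is_filter.intro)
  fix P Q :: "'c \<Rightarrow> bool"
  assume "eventually (\<lambda>x. eventually (\<lambda>y. P (h x y)) G) F" "eventually (\<lambda>x. eventually (\<lambda>y. Q (h x y)) G) F"
  then show "eventually (\<lambda>x. eventually (\<lambda>y. P (h x y) \<and> Q (h x y)) G) F"
    by eventually_elim (auto intro: eventually_conj)
next
  fix P Q :: "'c \<Rightarrow> bool"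
  assume PQ: "\<forall>x. P x \<longrightarrow> Q x" and "eventually (\<lambda>x. eventually (\<lambda>y. P (h x y)) G) F"
  from this(2) show "eventually (\<lambda>x. eventually (\<lambda>y. Q (h x y)) G) F"
    by eventually_elim (use PQ in \<open>auto elim: eventually_mono\<close>)
qed auto

lemma iter_mono: "F \<le> F' \<Longrightarrow> G \<le> G' \<Longrightarrow> iter_filter F G h \<le> iter_filter F' G' h"
  unfolding le_filter_def eventually_iter by (metis (mono_tags, lifting) eventually_mono)

lemma ultra_iter: assumes "ultrafilter F" "ultrafilter G" shows "ultrafilter (iter_filter F G h)"
proof -
  have G: "\<not> eventually P G \<longleftrightarrow> eventually (\<lambda>y. \<not> P y) G" for P
  proof
    assume "eventually (\<lambda>y. \<not> P y) G"
    show "\<not> eventually P G"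
    proof
      assume "eventually P G"
      with \<open>eventually (\<lambda>y. \<not> P y) G\<close> have "eventually (\<lambda>y. False) G" by eventually_elim simp
      then show False using assms(2) by (simp add: trivial_limit_def ultrafilter_def)
    qed
  qed (use assms(2) in \<open>auto simp: ultrafilter_def\<close>)
  have "eventually P (iter_filter F G h) \<or> eventually (\<lambda>x. \<not> P x) (iter_filter F G h)" for P
    unfolding eventually_iter G[symmetric] using assms(1) by (auto simp: ultrafilter_def)
  moreover have "iter_filter F G h \<noteq> bot"
    using assms by (simp add: trivial_limit_def eventually_iter ultrafilter_def)
  ultimately show ?thesis by (simp add: ultrafilter_def)
qed

lemma filtermap_iter: "filtermap k (iter_filter F G h) = iter_filter F G (\<lambda>x y. k (h x y))"
  by (rule filter_eqI) (simp add: eventually_iter eventually_filtermap)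

lemma iter_filtermap: "iter_filter (filtermap f F) (filtermap g G) h = iter_filter F G (\<lambda>x y. h (f x) (g y))"
  by (rule filter_eqI) (simp add: eventually_iter eventually_filtermap)

abbreviation conc :: "'a list filter \<Rightarrow> 'a list filter \<Rightarrow> 'a list filter" (infixr "\<odot>" 70) where
  "F \<odot> G \<equiv> iter_filter F G (@)"

lemma conc_assoc: "(F \<odot> G) \<odot> H = F \<odot> (G \<odot> H)"
  by (rule filter_eqI) (simp add: eventually_iter)

text \<open>Right multiplication by the ultrafilter \<open>p\<close> is continuous, so the image of the compact set of ultrafilters below
\<open>F\<close> is closed, and it is named by \<open>F \<odot> p\<close>. A preimage of \<open>r\<close> is any ultrafilter below
\<open>F\<close> that contains the sets \<open>{s. \<forall>\<^sub>F t in p. P (s @ t)}\<close> for all \<open>P\<close> in \<open>r\<close>.\<close>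

lemma conc_lift:
  assumes p: "ultrafilter p" and r: "ultrafilter r" "r \<le> F \<odot> p"
  obtains z where "ultrafilter z" "z \<le> F" "z \<odot> p = r"
proof -
  \<comment> \<open>The closed set of all \<open>s\<close> that right multiplication by \<open>p\<close> maps to \<open>r\<close>.\<close>
  define D where "D = (INF P\<in>{P. eventually P r}. principal {s. eventually (\<lambda>t. P (s @ t)) p})"
  have D: "eventually Q D \<longleftrightarrow> (\<exists>P\<in>{P. eventually P r}. eventually Q (principal {s. eventually (\<lambda>t. P (s @ t)) p}))" for Q
    unfolding D_def
  proof (rule eventually_INF_base)
    show "{P. eventually P r} \<noteq> {}" by (auto intro: exI[of _ "\<lambda>_. True"])
    fix P Q assume "P \<in> {P. eventually P r}" "Q \<in> {P. eventually P r}"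
    then show "\<exists>x\<in>{P. eventually P r}. principal {s. eventually (\<lambda>t. x (s @ t)) p}
        \<le> inf (principal {s. eventually (\<lambda>t. P (s @ t)) p}) (principal {s. eventually (\<lambda>t. Q (s @ t)) p})"
      by (intro bexI[of _ "\<lambda>x. P x \<and> Q x"]) (auto simp: eventually_conj elim: eventually_mono)
  qed
  have "inf F D \<noteq> bot"
  proof
    assume "inf F D = bot"
    then have "eventually (\<lambda>x. False) (inf F D)" by simp
    then obtain Q R where QR: "eventually Q F" "eventually R D" "\<And>x. \<not> (Q x \<and> R x)"
      unfolding eventually_inf by auto
    then obtain P where P: "eventually P r" "\<And>s. eventually (\<lambda>t. P (s @ t)) p \<Longrightarrow> R s"
      unfolding D by (auto simp: eventually_principal)
    have "eventually (\<lambda>s. \<not> eventually (\<lambda>t. P (s @ t)) p) F"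
      using QR(1) by eventually_elim (use QR(3) P(2) in blast)
    then have "eventually (\<lambda>s. eventually (\<lambda>t. \<not> P (s @ t)) p) F"
      by eventually_elim (use p in \<open>auto simp: ultrafilter_def\<close>)
    then have "eventually (\<lambda>x. \<not> P x) r"
      using r(2) by (auto simp: le_filter_def eventually_iter)
    with P(1) have "eventually (\<lambda>x. False) r" by eventually_elim simp
    then show False using r(1) by (simp add: trivial_limit_def ultrafilter_def)
  qed
  then obtain z where z: "ultrafilter z" "z \<le> inf F D" using ultra_exists by blast
  have "z \<odot> p \<le> r"
  proof (rule filter_leI)
    fix P assume "eventually P r"
    then have "eventually (\<lambda>s. eventually (\<lambda>t. P (s @ t)) p) D"
      unfolding D by (auto simp: eventually_principal)
    then show "eventually P (z \<odot> p)"
      using z(2) unfolding eventually_iter le_inf_iff by (auto simp: le_filter_def)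
  qed
  then have "z \<odot> p = r"
    using ultra_iter[OF z(1) p] by (intro ultra_le_eq[OF r(1)]) (auto simp: ultrafilter_def)
  then show thesis using that z by simp
qed

definition closed_subsemigroup :: "'a list filter \<Rightarrow> bool" where
  "closed_subsemigroup F \<longleftrightarrow> (\<forall>p q. ultrafilter p \<longrightarrow> ultrafilter q \<longrightarrow> p \<le> F \<longrightarrow> q \<le> F \<longrightarrow> p \<odot> q \<le> F)"

text \<open>The Ellis-Numakura lemma. In a minimal closed subsemigroup \<open>M\<close> with an element \<open>p\<close>, both the set of all \<open>z p\<close> and
the set of all \<open>z\<close> with \<open>z p = p\<close> are closed subsemigroups of \<open>M\<close>, hence equal to \<open>M\<close>; the second is nonempty because
the first contains \<open>p\<close>. So \<open>p\<close> belongs to the second.\<close>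

lemma ellis:
  assumes F: "F \<noteq> bot" "closed_subsemigroup F"
  obtains p where "ultrafilter p" "p \<le> F" "p \<odot> p = p"
proof -
  obtain M where M: "M \<le> F" "M \<noteq> bot" "closed_subsemigroup M" "\<And>G. G \<le> M \<Longrightarrow> G \<noteq> bot \<Longrightarrow> closed_subsemigroup G \<Longrightarrow> G = M"
  proof (rule minimal_filter_exists[of F closed_subsemigroup])
    fix C :: "'a list filter set" assume "\<And>F. F \<in> C \<Longrightarrow> F \<noteq> bot \<and> closed_subsemigroup F"
    then show "closed_subsemigroup (Inf C)"
      unfolding closed_subsemigroup_def le_Inf_iff by blast
  qed (use F in auto)
  have sM: "x \<odot> y \<le> M" if "ultrafilter x" "x \<le> M" "ultrafilter y" "y \<le> M" for x y
    using that M(3) by (auto simp: closed_subsemigroup_def)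
  obtain p where p: "ultrafilter p" "p \<le> M" using ultra_exists M(2) by blast
  have lift: "\<exists>z. ultrafilter z \<and> z \<le> M \<and> z \<odot> p = r" if "ultrafilter r" "r \<le> M \<odot> p" for r
    using conc_lift[OF p(1) that] by metis
  have "M \<odot> p \<le> M"
  proof (rule filter_le_ultraI)
    fix r assume "ultrafilter r" "r \<le> M \<odot> p"
    then obtain z where "ultrafilter z" "z \<le> M" "z \<odot> p = r" using lift by blast
    then show "r \<le> M" using sM p by blast
  qed
  moreover have "closed_subsemigroup (M \<odot> p)"
    unfolding closed_subsemigroup_def
  proof (intro allI impI)
    fix r r' assume "ultrafilter r" "ultrafilter r'" "r \<le> M \<odot> p" "r' \<le> M \<odot> p"
    then obtain z z' where z: "ultrafilter z" "z \<le> M" "z \<odot> p = r" and z': "ultrafilter z'" "z' \<le> M" "z' \<odot> p = r'"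
      using lift by blast
    have "z \<odot> p \<le> M" "ultrafilter (z \<odot> p)" using z z' p sM ultra_iter by blast+
    then have "(z \<odot> p) \<odot> z' \<le> M" using z' sM by blast
    then have "((z \<odot> p) \<odot> z') \<odot> p \<le> M \<odot> p" by (intro iter_mono) auto
    then show "r \<odot> r' \<le> M \<odot> p" using z(3) z'(3) by (simp add: conc_assoc)
  qed
  moreover have "M \<odot> p \<noteq> bot"
    using M(2) p(1) by (simp add: trivial_limit_def eventually_iter ultrafilter_def)
  ultimately have "M \<odot> p = M" using M(4) by blast
  then obtain z where z: "ultrafilter z" "z \<le> M" "z \<odot> p = p" using lift[OF p(1)] p by auto
  \<comment> \<open>The closed set of all \<open>z\<close> below \<open>M\<close> with \<open>z p = p\<close>.\<close>
  define D where "D = inf M (INF P\<in>{P. eventually P p}. principal {s. eventually (\<lambda>t. P (s @ t)) p})"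
  have D: "x \<le> D \<longleftrightarrow> x \<le> M \<and> x \<odot> p \<le> p" for x
    unfolding D_def le_inf_iff le_INF_iff by (simp add: le_principal le_filter_def[of "x \<odot> p"] eventually_iter)
  have "z \<le> D" using z D by simp
  then have "D \<noteq> bot" using z(1) by (auto simp: ultrafilter_def bot_unique)
  moreover have "closed_subsemigroup D"
    unfolding closed_subsemigroup_def
  proof (intro allI impI)
    fix x y assume xy: "ultrafilter x" "ultrafilter y" "x \<le> D" "y \<le> D"
    then have "x \<odot> y \<le> M" using sM D by blast
    moreover have "x \<odot> (y \<odot> p) \<le> x \<odot> p" using xy D by (intro iter_mono) auto
    then have "(x \<odot> y) \<odot> p \<le> p" using xy D by (metis conc_assoc order_trans)
    ultimately show "x \<odot> y \<le> D" using D by simp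
  qed
  moreover have "D \<le> M" by (simp add: D_def)
  ultimately have "D = M" using M(4) by blast
  then have "p \<odot> p \<le> p" using p D by blast
  then have "p \<odot> p = p" using ultra_iter[OF p(1) p(1)] by (intro ultra_le_eq[OF p(1)]) (auto simp: ultrafilter_def)
  with p(1) order_trans[OF p(2) M(1)] show thesis by (rule that)
qed

text \<open>The letter \<open>0\<close> plays the role of the variable, since proper letters start at \<open>1\<close>.\<close>

definition subst :: "nat \<Rightarrow> nat list \<Rightarrow> nat list" where
  "subst c = map (\<lambda>a. if a = 0 then c else a)"

definition var_words :: "nat \<Rightarrow> nat list set" where
  "var_words k = {r. set r \<subseteq> {0..k} \<and> 0 \<in> set r}"

lemma subst_append: "subst c (r @ s) = subst c r @ subst c s"
  by (simp add: subst_def)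

lemma filtermap_subst_conc: "filtermap (subst c) (F \<odot> G) = filtermap (subst c) F \<odot> filtermap (subst c) G"
  by (simp add: filtermap_iter iter_filtermap subst_append)

text \<open>Take an idempotent \<open>q\<close> in a minimal left ideal of the ultrafilters on words without variable. The ultrafilters on
words with variable form an ideal, so they contain an idempotent \<open>p\<close> with \<open>p q = q p = p\<close>. Substituting a letter
for the variable is a homomorphism that fixes \<open>q\<close>, so the image of \<open>p\<close> is an idempotent below \<open>q\<close>, and
minimality of \<open>q\<close> forces it to be \<open>q\<close>.\<close>

lemma absorbing_ultrafilter:
  obtains p q where "ultrafilter p" "p \<le> principal (var_words k)" "p \<odot> p = p" "p \<odot> q = p" "q \<odot> p = p" "q \<odot> q = q"
    "\<And>c. c \<in> {1..k} \<Longrightarrow> filtermap (subst c) p = q"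
proof -
  define S where "S = principal (lists {1..k})"
  define V where "V = principal (var_words k)"
  have SS: "S \<odot> x \<le> S" if "x \<le> S" for x
  proof -
    have "S \<odot> x \<le> S \<odot> S" by (rule iter_mono[OF order_refl that])
    also have "\<dots> \<le> S" by (simp add: S_def le_principal eventually_iter eventually_principal)
    finally show ?thesis .
  qed
  have VS: "V \<odot> x \<le> V" if "x \<le> S" for x
  proof -
    have "V \<odot> x \<le> V \<odot> S" by (rule iter_mono[OF order_refl that])
    also have "\<dots> \<le> V"
      by (fastforce simp: S_def V_def le_principal eventually_iter eventually_principal var_words_def)
    finally show ?thesis .
  qed
  have SV: "x \<odot> y \<le> V" if "x \<le> S" "y \<le> V" for x y
  proof -
    have "x \<odot> y \<le> S \<odot> V" by (rule iter_mono[OF that])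
    also have "\<dots> \<le> V"
      by (fastforce simp: S_def V_def le_principal eventually_iter eventually_principal var_words_def)
    finally show ?thesis .
  qed
  define ideal where "ideal L \<longleftrightarrow> L \<le> S \<and> (\<forall>p. ultrafilter p \<longrightarrow> p \<le> L \<longrightarrow> S \<odot> p \<le> L)" for L
  have "ideal S" using SS by (simp add: ideal_def)
  have "S \<noteq> bot" by (auto simp: S_def principal_eq_bot_iff)
  have idealInf: "ideal (Inf C)" if C: "C \<noteq> {}" "\<And>F. F \<in> C \<Longrightarrow> F \<noteq> bot \<and> ideal F" for C
  proof -
    obtain F where "F \<in> C" "F \<le> S" using C by (auto simp: ideal_def)
    then have "Inf C \<le> S" by (rule Inf_lower2)
    moreover have "S \<odot> p \<le> Inf C" if "ultrafilter p" "p \<le> Inf C" for p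
      using C(2) that unfolding ideal_def le_Inf_iff by blast
    ultimately show ?thesis by (simp add: ideal_def)
  qed
  obtain L where L: "L \<le> S" "L \<noteq> bot" "ideal L" "\<And>G. G \<le> L \<Longrightarrow> G \<noteq> bot \<Longrightarrow> ideal G \<Longrightarrow> G = L"
    by (rule minimal_filter_exists[of S ideal, OF \<open>S \<noteq> bot\<close> \<open>ideal S\<close> idealInf]) blast+
  have minL: "S \<odot> x = L" if x: "ultrafilter x" "x \<le> L" for x
  proof (rule L(4))
    show "S \<odot> x \<le> L" using L(3) x by (simp add: ideal_def)
    show "S \<odot> x \<noteq> bot"
      using \<open>S \<noteq> bot\<close> x(1) by (simp add: trivial_limit_def eventually_iter ultrafilter_def)
    show "ideal (S \<odot> x)"
      unfolding ideal_def
    proof (intro conjI allI impI)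
      show "S \<odot> x \<le> S" using x(2) L(1) by (intro SS) (rule order_trans)
      fix r assume "ultrafilter r" "r \<le> S \<odot> x"
      then obtain z where z: "z \<le> S" "z \<odot> x = r" using conc_lift[OF x(1)] by metis
      have "S \<odot> z \<le> S" by (rule SS[OF z(1)])
      then have "(S \<odot> z) \<odot> x \<le> S \<odot> x" by (intro iter_mono) auto
      then show "S \<odot> r \<le> S \<odot> x" using z(2) by (simp add: conc_assoc)
    qed
  qed
  have "closed_subsemigroup L"
    unfolding closed_subsemigroup_def
  proof (intro allI impI)
    fix x y assume "ultrafilter x" "ultrafilter y" "x \<le> L" "y \<le> L"
    then have "x \<odot> y \<le> S \<odot> y" using L(1) by (intro iter_mono) auto
    then show "x \<odot> y \<le> L" using minL \<open>ultrafilter y\<close> \<open>y \<le> L\<close> by simp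
  qed
  \<comment> \<open>An idempotent in a minimal left ideal is minimal among the idempotents.\<close>
  then obtain q where q: "ultrafilter q" "q \<le> L" "q \<odot> q = q" using ellis L(2) by blast
  have qS: "q \<le> S" using q L by simp
  have Vq: "V \<odot> q \<le> V" by (rule VS[OF qS])
  have lift: "\<exists>z. ultrafilter z \<and> z \<le> V \<and> z \<odot> q = r" if "ultrafilter r" "r \<le> V \<odot> q" for r
    using conc_lift[OF q(1) that] by metis
  have absorb: "r \<odot> q = r" if "ultrafilter r" "r \<le> V \<odot> q" for r
    using lift[OF that] q(3) by (metis conc_assoc)
  have "[0] \<in> var_words k" by (simp add: var_words_def)
  then have "V \<noteq> bot" by (auto simp: V_def principal_eq_bot_iff)
  have "closed_subsemigroup (V \<odot> q)"
    unfolding closed_subsemigroup_def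
  proof (intro allI impI)
    fix x y assume xy: "ultrafilter x" "ultrafilter y" "x \<le> V \<odot> q" "y \<le> V \<odot> q"
    then have "x \<odot> y \<le> V \<odot> V"
      using Vq by (intro iter_mono) auto
    also have "V \<odot> V \<le> V"
      by (fastforce simp: V_def le_principal eventually_iter eventually_principal var_words_def)
    finally have "(x \<odot> y) \<odot> q \<le> V \<odot> q" by (intro iter_mono) auto
    then show "x \<odot> y \<le> V \<odot> q" using absorb[OF xy(2,4)] by (simp add: conc_assoc)
  qed
  moreover have "V \<odot> q \<noteq> bot"
    using \<open>V \<noteq> bot\<close> q(1) by (simp add: trivial_limit_def eventually_iter ultrafilter_def)
  ultimately obtain p' where p': "ultrafilter p'" "p' \<le> V \<odot> q" "p' \<odot> p' = p'" using ellis by blast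
  \<comment> \<open>The idempotent \<open>p'\<close> satisfies only \<open>p' q = p'\<close>; multiplying by \<open>q\<close> on the left gives both identities.\<close>
  define p where "p = q \<odot> p'"
  have p'q: "p' \<odot> q = p'" by (rule absorb) fact+
  have pp: "p \<odot> p = p" "p \<odot> q = p" "q \<odot> p = p" "ultrafilter p"
    unfolding p_def using p'q p'(3) q(3) ultra_iter[OF q(1) p'(1)] conc_assoc by metis+
  have pV: "p \<le> V"
    unfolding p_def using p'(2) Vq by (intro SV[OF qS]) (rule order_trans)
  have "filtermap (subst c) p = q" if c: "c \<in> {1..k}" for c
  proof -
    let ?t = "filtermap (subst c) p"
    have tq: "filtermap (subst c) q = q"
    proof (rule filter_eqI)
      fix P
      have "eventually (\<lambda>x. x \<in> lists {1..k}) S" by (simp add: S_def eventually_principal)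
      then have "eventually (\<lambda>x. x \<in> lists {1..k}) q" using qS by (simp add: filter_leD)
      then have "eventually (\<lambda>x. subst c x = x) q"
        by eventually_elim (force simp: subst_def intro!: map_idI)
      then have "eventually (\<lambda>x. P (subst c x) \<longleftrightarrow> P x) q"
        by eventually_elim simp
      then show "eventually P (filtermap (subst c) q) \<longleftrightarrow> eventually P q"
        unfolding eventually_filtermap by (rule eventually_subst)
    qed
    have t: "ultrafilter ?t" "?t \<odot> ?t = ?t" "?t \<odot> q = ?t" "q \<odot> ?t = ?t"
      using ultra_filtermap[OF pp(4)] pp(1,2,3) tq by (metis filtermap_subst_conc)+
    have "?t \<le> S"
    proof -
      have "eventually (\<lambda>x. x \<in> var_words k) V" by (simp add: V_def eventually_principal)
      then have "eventually (\<lambda>x. x \<in> var_words k) p" using pV by (simp add: filter_leD)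
      then have "eventually (\<lambda>x. subst c x \<in> lists {1..k}) p"
        by eventually_elim (use c in \<open>auto simp: var_words_def subst_def Suc_le_eq\<close>)
      then show ?thesis by (simp add: S_def le_principal eventually_filtermap)
    qed
    then have "?t \<odot> q \<le> S \<odot> q" by (intro iter_mono) auto
    then have "?t \<le> L" using t(3) minL[OF q(1,2)] by simp
    then have "q \<le> S \<odot> ?t" using minL[OF t(1)] q(2) by simp
    then obtain z where "z \<odot> ?t = q" using conc_lift[OF t(1) q(1)] by metis
    then have "q \<odot> ?t = q" using t(2) by (metis conc_assoc)
    then show ?thesis using t(4) by simp
  qed
  with pp(4) pV[unfolded V_def] pp(1-3) q(3) show thesis by (rule that)
qed

section \<open>Limits along subspaces\<close>

lemma iter_cong:
  assumes "eventually (\<lambda>x. \<forall>y. h x y = h' x y) F"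
  shows "iter_filter F G h = iter_filter F G h'"
proof (rule filter_eqI)
  fix P
  have "eventually (\<lambda>x. eventually (\<lambda>y. P (h x y)) G \<longleftrightarrow> eventually (\<lambda>y. P (h' x y)) G) F"
    using assms by eventually_elim simp
  then show "eventually P (iter_filter F G h) \<longleftrightarrow> eventually P (iter_filter F G h')"
    unfolding eventually_iter by (rule eventually_subst)
qed

lemma iter_fst: "G \<noteq> bot \<Longrightarrow> iter_filter F G (\<lambda>x y. x) = F"
  by (rule filter_eqI) (simp add: eventually_iter eventually_const_iff)

fun nested_filter :: "'a filter \<Rightarrow> nat \<Rightarrow> 'a list filter" where
  "nested_filter p 0 = principal {[]}"
| "nested_filter p (Suc n) = iter_filter (nested_filter p n) p (\<lambda>rs r. rs @ [r])"

lemma ultra_nest: "ultrafilter p \<Longrightarrow> ultrafilter (nested_filter p n)"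
  by (induction n) (auto intro: ultra_principal_singleton ultra_iter)

lemma eventually_nest:
  assumes "p \<le> principal W"
  shows "eventually (\<lambda>rs. length rs = n \<and> set rs \<subseteq> W) (nested_filter p n)"
proof (induction n)
  case (Suc n)
  have "eventually (\<lambda>r. r \<in> W) p" using assms by (simp add: le_principal)
  then have "eventually (\<lambda>r. length (rs @ [r]) = Suc n \<and> set (rs @ [r]) \<subseteq> W) p"
    if "length rs = n \<and> set rs \<subseteq> W" for rs
    by eventually_elim (use that in auto)
  then show ?case
    using Suc by (auto simp: eventually_iter elim: eventually_mono)
qed (simp add: eventually_principal)

text \<open>The \<open>n\<close>-fold iterated limits along \<open>p\<close> are compatible for different \<open>n\<close>. A single ultrafilter
on sequences that induces all of them allows words of all lengths to be treated at once.\<close>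

lemma sequence_ultrafilter:
  assumes p: "ultrafilter p" "p \<le> principal W" and W: "W \<noteq> {}"
  obtains U where "ultrafilter U" "U \<le> principal {\<sigma>. \<forall>i. \<sigma> i \<in> W}"
    "\<And>n. filtermap (\<lambda>\<sigma>. map \<sigma> [0..<n]) U = nested_filter p n"
proof -
  let ?t = "\<lambda>n (\<sigma> :: nat \<Rightarrow> 'a). map \<sigma> [0..<n]"
  define F where "F n = inf (filtercomap (?t n) (nested_filter p n)) (principal {\<sigma>. \<forall>i. \<sigma> i \<in> W})" for n
  obtain w where w: "w \<in> W" using W by blast
  have "F n \<noteq> bot" for n
  proof
    assume "F n = bot"
    then have "eventually (\<lambda>_. False) (F n)" by simp
    then obtain Q where Q: "eventually Q (nested_filter p n)" "\<And>\<sigma>. Q (?t n \<sigma>) \<Longrightarrow> \<not> (\<forall>i. \<sigma> i \<in> W)"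
      unfolding F_def eventually_inf_principal eventually_filtercomap by auto
    have "eventually (\<lambda>rs. False) (nested_filter p n)"
      using Q(1) eventually_nest[OF p(2), of n]
    proof eventually_elim
      fix rs assume rs: "Q rs" "length rs = n \<and> set rs \<subseteq> W"
      define \<sigma> where "\<sigma> i = (if i < n then rs ! i else w)" for i
      have "?t n \<sigma> = rs" using rs(2) by (auto simp: \<sigma>_def intro!: nth_equalityI)
      moreover have "\<forall>i. \<sigma> i \<in> W" using rs(2) w nth_mem by (fastforce simp: \<sigma>_def)
      ultimately show False using Q(2) rs(1) by metis
    qed
    then show False using ultra_nest[OF p(1), of n] by (simp add: ultrafilter_def trivial_limit_def)
  qed
  moreover have "F (Suc n) \<le> F n" for n
  proof -
    have "filtermap butlast (nested_filter p (Suc n)) = nested_filter p n"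
      using p(1) by (simp add: filtermap_iter iter_fst ultrafilter_def)
    then have "nested_filter p (Suc n) \<le> filtercomap butlast (nested_filter p n)"
      unfolding filtermap_le_iff_le_filtercomap[symmetric] by simp
    then have "filtercomap (?t (Suc n)) (nested_filter p (Suc n)) \<le> filtercomap (?t (Suc n)) (filtercomap butlast (nested_filter p n))"
      by (rule filtercomap_mono)
    also have "\<dots> = filtercomap (?t n) (nested_filter p n)"
      by (simp add: filtercomap_filtercomap)
    finally show ?thesis unfolding F_def by (intro inf_mono) auto
  qed
  then have dec: "F n \<le> F m" if "m \<le> n" for m n
    by (rule lift_Suc_antimono_le) (rule that)
  have "(INF n. F n) \<noteq> bot"
  proof (subst INF_filter_bot_base)
    fix i j show "\<exists>k\<in>UNIV. F k \<le> inf (F i) (F j)"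
      by (rule bexI[of _ "max i j"]) (auto intro: dec)
  qed (use \<open>\<And>n. F n \<noteq> bot\<close> in auto)
  then obtain U where U: "ultrafilter U" "U \<le> (INF n. F n)" using ultra_exists by blast
  then have UF: "U \<le> F n" for n by (simp add: le_INF_iff)
  have "filtermap (?t n) U = nested_filter p n" for n
  proof (rule ultra_le_eq)
    show "filtermap (?t n) U \<le> nested_filter p n"
      using UF[of n] by (simp add: filtermap_le_iff_le_filtercomap F_def)
    show "filtermap (?t n) U \<noteq> bot" using U(1) by (simp add: ultrafilter_def filtermap_bot_iff)
  qed (rule ultra_nest[OF p(1)])
  moreover have "U \<le> principal {\<sigma>. \<forall>i. \<sigma> i \<in> W}" using UF[of 0] by (simp add: F_def)
  ultimately show thesis using that U(1) by blast
qed

text \<open>The subspace whose successive blocks are the variable words \<open>\<sigma> 0, \<sigma> 1, \<dots>\<close>.\<close>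

definition act :: "(nat \<Rightarrow> nat list) \<Rightarrow> nat list \<Rightarrow> nat list" where
  "act \<sigma> v = concat (map (\<lambda>i. subst (v ! i) (\<sigma> i)) [0..<length v])"

lemma subst_0 [simp]: "subst 0 = (\<lambda>r. r)"
  by (auto simp: subst_def fun_eq_iff intro!: map_idI)

lemma subst_subst: "subst d (subst c r) = subst (if c = 0 then d else c) r"
  by (auto simp: subst_def)

lemma subst_concat: "subst d (concat rs) = concat (map (subst d) rs)"
  by (induction rs) (auto simp: subst_def)

text \<open>Every letter contributes one factor \<open>p\<close> or \<open>q\<close> to the product of ultrafilters that describes a block, and
by absorption the product is \<open>p\<close> as soon as one factor is \<open>p\<close>. The first \<open>a\<close> words are carried
along so that consecutive blocks can be treated one after the other.\<close>

lemma filtermap_block: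
  assumes p: "ultrafilter p" "p \<odot> p = p" "p \<odot> q = p" "q \<odot> p = p" "q \<odot> q = q"
    and q: "\<And>c. c \<in> {1..k} \<Longrightarrow> filtermap (subst c) p = q"
    and c: "\<And>m. m < b \<Longrightarrow> c m \<le> k" and ab: "a \<le> b"
  shows "filtermap (\<lambda>rs. (take a rs, concat (map (\<lambda>m. subst (c m) (rs ! m)) [a..<b]))) (nested_filter p b)
    = iter_filter (nested_filter p a) (if b = a then principal {[]} else if \<exists>m\<in>{a..<b}. c m = 0 then p else q) Pair"
  using ab c
proof (induction b rule: dec_induct)
  case base
  have len: "eventually (\<lambda>rs. length rs = a) (nested_filter p a)"
    using eventually_nest[of p UNIV a] by (simp add: top_eq_principal_UNIV[symmetric])
  show ?case
  proof (rule filter_eqI)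
    fix P :: "nat list list \<times> nat list \<Rightarrow> bool"
    have "eventually (\<lambda>rs. P (take a rs, []) \<longleftrightarrow> P (rs, [])) (nested_filter p a)"
      using len by eventually_elim simp
    from eventually_subst[OF this] show "eventually P (filtermap (\<lambda>rs. (take a rs, concat (map (\<lambda>m. subst (c m) (rs ! m)) [a..<a]))) (nested_filter p a))
      = eventually P (iter_filter (nested_filter p a) (if a = a then principal {[]} else if \<exists>m\<in>{a..<a}. c m = 0 then p else q) Pair)"
      by (simp add: eventually_filtermap eventually_iter eventually_principal)
  qed
next
  case (step b)
  let ?R = "\<lambda>b. if b = a then principal {[]} else if \<exists>m\<in>{a..<b}. c m = 0 then p else q"
  let ?f = "\<lambda>b rs. (take a rs, concat (map (\<lambda>m. subst (c m) (rs ! m)) [a..<b]))"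
  have len: "eventually (\<lambda>rs. length rs = b) (nested_filter p b)"
    using eventually_nest[of p UNIV b] by (simp add: top_eq_principal_UNIV[symmetric])
  have pc: "filtermap (subst (c b)) p = (if c b = 0 then p else q)"
    using q[of "c b"] step.prems[of b] by (auto simp: filtermap_ident Suc_le_eq)
  have "{a..<Suc b} = insert b {a..<b}" using step.hyps by auto
  then have R: "?R b \<odot> filtermap (subst (c b)) p = ?R (Suc b)"
    unfolding pc using p(2-) step.hyps
    by (auto simp: filter_eq_iff eventually_iter eventually_principal)
  have "filtermap (?f (Suc b)) (nested_filter p (Suc b)) = iter_filter (nested_filter p b) p (\<lambda>rs r. ?f (Suc b) (rs @ [r]))"
    by (simp add: filtermap_iter)
  also have "\<dots> = iter_filter (nested_filter p b) p (\<lambda>rs r. (fst (?f b rs), snd (?f b rs) @ subst (c b) r))"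
    by (rule iter_cong, use len in eventually_elim) (use step.hyps in \<open>auto simp: nth_append intro!: arg_cong[of _ _ concat]\<close>)
  also have "\<dots> = iter_filter (filtermap (?f b) (nested_filter p b)) (filtermap (subst (c b)) p) (\<lambda>xy z. (fst xy, snd xy @ z))"
    by (simp add: iter_filtermap)
  also have "filtermap (?f b) (nested_filter p b) = iter_filter (nested_filter p a) (?R b) Pair"
    by (rule step.IH) (use step.prems in auto)
  also have "iter_filter (iter_filter (nested_filter p a) (?R b) Pair) (filtermap (subst (c b)) p) (\<lambda>xy z. (fst xy, snd xy @ z))
      = iter_filter (nested_filter p a) (?R b \<odot> filtermap (subst (c b)) p) Pair"
    by (rule filter_eqI) (simp only: eventually_iter fst_conv snd_conv)
  finally show ?case unfolding R .
qed

definition blocks :: "(nat \<Rightarrow> nat) \<Rightarrow> (nat \<Rightarrow> nat \<Rightarrow> nat) \<Rightarrow> nat list list \<Rightarrow> nat \<Rightarrow> nat list" where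
  "blocks N c rs i = concat (map (\<lambda>m. subst (c i m) (rs ! m)) [N i..<N (Suc i)])"

lemma filtermap_blocks:
  assumes p: "ultrafilter p" "p \<odot> p = p" "p \<odot> q = p" "q \<odot> p = p" "q \<odot> q = q"
    and q: "\<And>c. c \<in> {1..k} \<Longrightarrow> filtermap (subst c) p = q"
    and N: "N 0 = 0" "strict_mono N"
    and c: "\<And>i m. m < N (Suc i) \<Longrightarrow> c i m \<le> k" "\<And>i. \<exists>m\<in>{N i..<N (Suc i)}. c i m = 0"
  shows "filtermap (\<lambda>rs. map (blocks N c rs) [0..<n]) (nested_filter p (N n)) = nested_filter p n"
proof (induction n)
  case 0
  then show ?case using N by simp
next
  case (Suc n)
  have lt: "N n < N (Suc n)" using N(2) by (simp add: strict_mono_Suc_iff)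
  let ?f = "\<lambda>rs. (take (N n) rs, blocks N c rs n)"
  have 1: "blocks N c rs i = blocks N c (take (N n) rs) i" if "i < n" for rs i
  proof -
    have "N (Suc i) \<le> N n" using that N(2) by (simp add: strict_mono_less_eq)
    then show ?thesis unfolding blocks_def by (intro arg_cong[of _ _ concat] map_cong) auto
  qed
  have "map (blocks N c rs) [0..<Suc n] = map (blocks N c (take (N n) rs)) [0..<n] @ [blocks N c rs n]" for rs
  proof -
    have "map (blocks N c rs) [0..<n] = map (blocks N c (take (N n) rs)) [0..<n]"
      by (rule map_cong[OF refl], rule 1) simp
    then show ?thesis by simp
  qed
  then have "filtermap (\<lambda>rs. map (blocks N c rs) [0..<Suc n]) (nested_filter p (N (Suc n)))
     = filtermap (\<lambda>(x, y). map (blocks N c x) [0..<n] @ [y]) (filtermap ?f (nested_filter p (N (Suc n))))"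
    unfolding filtermap_filtermap by (simp only: prod.case)
  also have "filtermap ?f (nested_filter p (N (Suc n))) = iter_filter (nested_filter p (N n)) p Pair"
    using filtermap_block[OF p q, where a="N n" and b="N (Suc n)" and c="c n"] c lt unfolding blocks_def by auto
  also have "filtermap (\<lambda>(x, y). map (blocks N c x) [0..<n] @ [y]) \<dots>
      = iter_filter (filtermap (\<lambda>rs. map (blocks N c rs) [0..<n]) (nested_filter p (N n))) (filtermap (\<lambda>x. x) p) (\<lambda>rs r. rs @ [r])"
    by (subst iter_filtermap) (simp add: filtermap_iter)
  also have "\<dots> = nested_filter p (Suc n)" by (simp add: Suc filtermap_ident)
  finally show ?case .
qed

lemma concat_blocks:
  assumes "N 0 = 0" "strict_mono N"
  shows "concat (map f [0..<N n]) = concat (map (\<lambda>i. concat (map f [N i..<N (Suc i)])) [0..<n])"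
proof (induction n)
  case (Suc n)
  have "N n \<le> N (Suc n)" using assms(2) by (simp add: strict_mono_less_eq)
  then have "[0..<N (Suc n)] = [0..<N n] @ [N n..<N (Suc n)]"
    using upt_add_eq_append[of 0 "N n" "N (Suc n) - N n"] by simp
  then show ?case using Suc by simp
qed (simp add: assms)

text \<open>If \<open>\<phi>\<close> is a subspace, then \<open>act \<sigma> \<circ> \<phi> = act \<tau>\<close> on short words, where the \<open>i\<close>-th word of \<open>\<tau>\<close> is the \<open>i\<close>-th block
of \<open>\<phi>\<close> with its letters substituted into the corresponding words of \<open>\<sigma>\<close>. Each block contains the variable, so by
absorption \<open>\<tau>\<close> is distributed along \<open>U\<close> in the same way as \<open>\<sigma>\<close>, as far as finitely many words are concerned.\<close>

lemma stationary_ultrafilter: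
  obtains U where "ultrafilter U" "U \<le> principal {\<sigma>. \<forall>i. \<sigma> i \<in> var_words k}"
    "\<And>\<phi> n (G :: (nat list \<Rightarrow> nat list) \<Rightarrow> real) c. word_subspace k \<phi> \<Longrightarrow>
      (\<And>a b. (\<And>v. v \<in> words k \<Longrightarrow> length v \<le> n \<Longrightarrow> a v = b v) \<Longrightarrow> G a = G b) \<Longrightarrow>
      ((\<lambda>\<sigma>. G (act \<sigma>)) \<longlongrightarrow> c) U \<Longrightarrow> ((\<lambda>\<sigma>. G (\<lambda>v. act \<sigma> (\<phi> v))) \<longlongrightarrow> c) U"
proof -
  obtain p q where p: "ultrafilter p" "p \<odot> p = p" "p \<odot> q = p" "q \<odot> p = p" "q \<odot> q = q"
    and pV: "p \<le> principal (var_words k)" and q: "\<And>c. c \<in> {1..k} \<Longrightarrow> filtermap (subst c) p = q"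
    using absorbing_ultrafilter by metis
  have "[0] \<in> var_words k" by (simp add: var_words_def)
  then have ne: "var_words k \<noteq> {}" by blast
  obtain U where U: "ultrafilter U" "U \<le> principal {\<sigma>. \<forall>i. \<sigma> i \<in> var_words k}"
    "\<And>n. filtermap (\<lambda>\<sigma>. map \<sigma> [0..<n]) U = nested_filter p n"
    using sequence_ultrafilter[OF p(1) pV ne] by blast
  show thesis
  proof (rule that[OF U(1,2)])
    fix \<phi> n and G :: "(nat list \<Rightarrow> nat list) \<Rightarrow> real" and l
    assume \<phi>: "word_subspace k \<phi>"
      and G: "\<And>a b. (\<And>v. v \<in> words k \<Longrightarrow> length v \<le> n \<Longrightarrow> a v = b v) \<Longrightarrow> G a = G b"
      and lim: "((\<lambda>\<sigma>. G (act \<sigma>)) \<longlongrightarrow> l) U"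
    obtain N I w where D: "subspace_data k N I w \<phi>"
      using \<phi> by (auto simp: word_subspace_def)
    have N: "N 0 = 0" "strict_mono N"
      and I: "\<And>i. I (Suc i) \<noteq> {} \<and> I (Suc i) \<subseteq> {1..N (Suc i)} - {1..N i}"
      and w: "\<And>i. length (w (Suc i)) = N (Suc i) \<and> set (w (Suc i)) \<subseteq> {1..k}"
      and len: "\<And>v. v \<in> words k \<Longrightarrow> length (\<phi> v) = N (length v)"
      and \<phi>': "\<And>v i m. v \<in> words k \<Longrightarrow> i < length v \<Longrightarrow> N i < m \<Longrightarrow> m \<le> N (Suc i) \<Longrightarrow>
        \<phi> v ! (m - 1) = (if m \<in> I (Suc i) then v ! i else w (Suc i) ! (m - 1))"
      using D unfolding subspace_data_def by simp_all
    \<comment> \<open>The \<open>i\<close>-th block of \<open>\<phi>\<close> as a variable word: \<open>0\<close> at the varying positions, the fixed letters elsewhere.\<close>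
    define c where "c i m = (if Suc m \<in> I (Suc i) then 0 else w (Suc i) ! m)" for i m
    have wk: "w (Suc i) ! m \<in> {1..k}" if "m < N (Suc i)" for i m
      using w[of i] that nth_mem[of m "w (Suc i)"] by (metis subsetD)
    have c1: "c i m \<le> k" if "m < N (Suc i)" for i m
      using wk[OF that] by (auto simp: c_def)
    have c2: "\<exists>m\<in>{N i..<N (Suc i)}. c i m = 0" for i
    proof -
      obtain m where m: "m \<in> I (Suc i)" using I by blast
      then have "m \<in> {1..N (Suc i)} - {1..N i}" using I[of i] by blast
      then show ?thesis using m by (intro bexI[of _ "m - 1"]) (auto simp: c_def)
    qed
    define G' where "G' rs = G (act (\<lambda>i. rs ! i))" for rs
    have act_cong: "act \<sigma> v = act \<tau> v" if "\<And>i. i < length v \<Longrightarrow> \<sigma> i = \<tau> i" for \<sigma> \<tau> v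
      unfolding act_def using that by (intro arg_cong[of _ _ concat] map_cong) auto
    have "G (act \<sigma>) = G' (map \<sigma> [0..<n])" for \<sigma>
      unfolding G'_def by (intro G act_cong) auto
    then have "((\<lambda>\<sigma>. G' (map \<sigma> [0..<n])) \<longlongrightarrow> l) U" using lim by simp
    then have lim': "(G' \<longlongrightarrow> l) (nested_filter p n)"
      unfolding U(3)[symmetric] filterlim_filtermap .
    have "G (\<lambda>v. act \<sigma> (\<phi> v)) = G' (map (blocks N c (map \<sigma> [0..<N n])) [0..<n])" for \<sigma>
      unfolding G'_def
    proof (rule G)
      fix v assume v: "v \<in> words k" "length v \<le> n"
      have "act \<sigma> (\<phi> v) = concat (map (\<lambda>j. subst (\<phi> v ! j) (\<sigma> j)) [0..<N (length v)])"
        by (simp add: act_def len v)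
      also have "\<dots> = concat (map (\<lambda>i. concat (map (\<lambda>j. subst (\<phi> v ! j) (\<sigma> j)) [N i..<N (Suc i)])) [0..<length v])"
        by (rule concat_blocks[OF N])
      also have "\<dots> = concat (map (\<lambda>i. subst (v ! i) (map (blocks N c (map \<sigma> [0..<N n])) [0..<n] ! i)) [0..<length v])"
      proof (intro arg_cong[of _ _ concat] map_cong refl)
        fix i assume "i \<in> set [0..<length v]"
        then have i: "i < length v" by simp
        have "N (Suc i) \<le> N n" using i v(2) N(2) by (simp add: strict_mono_less_eq)
        moreover have "\<phi> v ! j = (if c i j = 0 then v ! i else c i j)" if "N i \<le> j" "j < N (Suc i)" for j
          using \<phi>'[OF v(1) i, of "Suc j"] that wk[of j i] by (auto simp: c_def)
        ultimately show "concat (map (\<lambda>j. subst (\<phi> v ! j) (\<sigma> j)) [N i..<N (Suc i)])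
            = subst (v ! i) (map (blocks N c (map \<sigma> [0..<N n])) [0..<n] ! i)"
          using i v(2) unfolding blocks_def
          by (auto simp: subst_concat subst_subst o_def intro!: arg_cong[of _ _ concat])
      qed
      also have "\<dots> = act (\<lambda>i. map (blocks N c (map \<sigma> [0..<N n])) [0..<n] ! i) v"
        by (simp add: act_def)
      finally show "act \<sigma> (\<phi> v) = act (\<lambda>i. map (blocks N c (map \<sigma> [0..<N n])) [0..<n] ! i) v" .
    qed
    moreover have "filtermap (\<lambda>rs. map (blocks N c rs) [0..<n]) (nested_filter p (N n)) = nested_filter p n"
      by (rule filtermap_blocks[OF p q N c1 c2])
    then have "(G' \<longlongrightarrow> l) (filtermap (\<lambda>rs. map (blocks N c rs) [0..<n]) (filtermap (\<lambda>\<sigma>. map \<sigma> [0..<N n]) U))"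
      using lim' by (simp only: U(3))
    ultimately show "((\<lambda>\<sigma>. G (\<lambda>v. act \<sigma> (\<phi> v))) \<longlongrightarrow> l) U"
      by (simp only: filterlim_filtermap)
  qed
qed

section \<open>Conditional independence\<close>

text \<open>The right-hand side is countably additive in \<open>A\<close>, so that the condition can be checked for \<open>A\<close> in a generating
\<open>\<pi>\<close>-system.\<close>

definition cond_indep_sets :: "'a measure \<Rightarrow> 'a measure \<Rightarrow> 'a measure \<Rightarrow> 'a measure \<Rightarrow> bool" where
  "cond_indep_sets M F G H \<longleftrightarrow> (\<forall>A\<in>sets F. \<forall>C\<in>sets G.
     measure M (A \<inter> C) = (LINT x:A|M. real_cond_exp M H (indicator C) x))"

lemma subalgebra_trans: "subalgebra M F \<Longrightarrow> subalgebra F H \<Longrightarrow> subalgebra M H"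
  by (auto simp: subalgebra_def)

context prob_space
begin

lemma subalgebra_sigma_finite: "subalgebra M F \<Longrightarrow> sigma_finite_subalgebra M F"
  using finite_measure_subalgebra.intro[OF finite_measure_axioms, of F]
  by (simp add: finite_measure_subalgebra_axioms_def finite_measure_subalgebra_is_sigma_finite)

lemma integrable_boundedI:
  fixes f :: "'a \<Rightarrow> real"
  assumes "f \<in> borel_measurable M" "\<And>x. x \<in> space M \<Longrightarrow> \<bar>f x\<bar> \<le> B"
  shows "integrable M f"
  by (rule integrable_const_bound[of _ B]) (use assms in auto)

lemma integrable_bounded_mult:
  fixes f g :: "'a \<Rightarrow> real"
  assumes f: "f \<in> borel_measurable M" "\<And>x. x \<in> space M \<Longrightarrow> \<bar>f x\<bar> \<le> B" and g: "integrable M g"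
  shows "integrable M (\<lambda>x. f x * g x)"
proof (rule Bochner_Integration.integrable_bound)
  show "integrable M (\<lambda>x. B * g x)" using g by simp
  show "(\<lambda>x. f x * g x) \<in> borel_measurable M" using f g by measurable
  show "AE x in M. norm (f x * g x) \<le> norm (B * g x)"
  proof (rule AE_I2)
    fix x assume x: "x \<in> space M"
    then have "\<bar>f x\<bar> \<le> \<bar>B\<bar>" using f(2)[OF x] by simp
    then show "norm (f x * g x) \<le> norm (B * g x)" by (simp add: abs_mult mult_right_mono)
  qed
qed

lemma integrable_indicator_set: "C \<in> sets M \<Longrightarrow> integrable M (indicator C :: 'a \<Rightarrow> real)"
  by (rule integrable_boundedI[of _ 1]) (auto simp: indicator_def)

lemma cond_exp_unique:
  assumes "subalgebra M F" "integrable M f" "integrable M g" "g \<in> borel_measurable F"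
    "\<And>A. A \<in> sets F \<Longrightarrow> (\<integral>x. f x * indicator A x \<partial>M) = (\<integral>x. g x * indicator A x \<partial>M)"
  shows "AE x in M. real_cond_exp M F f x = g x"
proof -
  interpret F: sigma_finite_subalgebra M F by (rule subalgebra_sigma_finite) fact
  show ?thesis
    by (rule F.real_cond_exp_charact) (use assms in \<open>auto simp: set_lebesgue_integral_def mult.commute\<close>)
qed

lemma cond_exp_move:
  fixes f g :: "'a \<Rightarrow> real"
  assumes F: "subalgebra M F" and f: "f \<in> borel_measurable F" "\<And>x. x \<in> space M \<Longrightarrow> \<bar>f x\<bar> \<le> B"
    and g: "integrable M g"
  shows "(\<integral>x. f x * real_cond_exp M F g x \<partial>M) = (\<integral>x. f x * g x \<partial>M)"
proof -
  interpret F: sigma_finite_subalgebra M F by (rule subalgebra_sigma_finite) fact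
  have fM: "f \<in> borel_measurable M" by (rule measurable_from_subalg[OF F f(1)])
  show ?thesis
    by (rule F.real_cond_exp_intg(2)[OF integrable_bounded_mult[OF fM f(2) g] f(1)]) (use g in auto)
qed

text \<open>Conditional expectation is a self-adjoint projection: both sides are the integral of the product of the two
conditional expectations.\<close>

lemma cond_exp_adjoint:
  fixes f g :: "'a \<Rightarrow> real"
  assumes F: "subalgebra M F"
    and f: "f \<in> borel_measurable M" "\<And>x. x \<in> space M \<Longrightarrow> \<bar>f x\<bar> \<le> B"
    and g: "g \<in> borel_measurable M" "\<And>x. x \<in> space M \<Longrightarrow> \<bar>g x\<bar> \<le> D"
  shows "(\<integral>x. f x * real_cond_exp M F g x \<partial>M) = (\<integral>x. real_cond_exp M F f x * g x \<partial>M)"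
proof -
  interpret F: sigma_finite_subalgebra M F by (rule subalgebra_sigma_finite) fact
  have i: "integrable M f" "integrable M g"
    by (rule integrable_boundedI[OF f], assumption) (rule integrable_boundedI[OF g], assumption)
  have bdd: "AE x in M. \<bar>real_cond_exp M F h x\<bar> \<le> C"
    if "h \<in> borel_measurable M" "\<And>x. x \<in> space M \<Longrightarrow> \<bar>h x\<bar> \<le> C" for h :: "'a \<Rightarrow> real" and C
  proof -
    have h: "integrable M h" by (rule integrable_boundedI[OF that])
    have "AE x in M. real_cond_exp M F h x \<le> C"
      by (rule F.real_cond_exp_le_c[OF h]) (use that(2) in force)
    moreover have "AE x in M. real_cond_exp M F h x \<ge> - C"
      by (rule F.real_cond_exp_ge_c[OF h]) (use that(2) in force)
    ultimately show ?thesis by eventually_elim simp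
  qed
  have prod: "integrable M (\<lambda>x. real_cond_exp M F h x * l x)"
    if "h \<in> borel_measurable M" "\<And>x. x \<in> space M \<Longrightarrow> \<bar>h x\<bar> \<le> C" "integrable M l" for h l :: "'a \<Rightarrow> real" and C
  proof (rule Bochner_Integration.integrable_bound)
    show "integrable M (\<lambda>x. C * l x)" using that by simp
    show "(\<lambda>x. real_cond_exp M F h x * l x) \<in> borel_measurable M" using that by measurable
    have "AE x in M. \<bar>real_cond_exp M F h x\<bar> \<le> C" by (rule bdd) (use that in auto)
    then show "AE x in M. norm (real_cond_exp M F h x * l x) \<le> norm (C * l x)"
      by eventually_elim (simp add: abs_mult mult_right_mono)
  qed
  have "(\<integral>x. f x * real_cond_exp M F g x \<partial>M) = (\<integral>x. real_cond_exp M F g x * f x \<partial>M)"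
    by (simp add: mult.commute)
  also have "\<dots> = (\<integral>x. real_cond_exp M F g x * real_cond_exp M F f x \<partial>M)"
    by (rule F.real_cond_exp_intg(2)[symmetric]) (use prod[OF g i(1)] f in auto)
  also have "\<dots> = (\<integral>x. real_cond_exp M F f x * real_cond_exp M F g x \<partial>M)"
    by (simp add: mult.commute)
  also have "\<dots> = (\<integral>x. real_cond_exp M F f x * g x \<partial>M)"
    by (rule F.real_cond_exp_intg(2)) (use prod[OF f i(2)] g in auto)
  finally show ?thesis .
qed

text \<open>The condition for all \<open>A\<close> in \<open>F\<close> says that conditioning the indicator of \<open>C\<close> on \<open>F\<close> gives the same as
conditioning it on \<open>H\<close>; testing this against \<open>f\<close> and moving the projection over to \<open>f\<close> gives the claim.\<close>

lemma cond_indep_sets_bounded: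
  fixes f :: "'a \<Rightarrow> real"
  assumes ci: "cond_indep_sets M F G H" and F: "subalgebra M F" "subalgebra F H" and C: "C \<in> sets G" "C \<in> sets M"
    and f: "f \<in> borel_measurable F" "\<And>x. x \<in> space M \<Longrightarrow> \<bar>f x\<bar> \<le> B"
  shows "(\<integral>x. f x * indicator C x \<partial>M) = (\<integral>x. real_cond_exp M H f x * indicator C x \<partial>M)"
proof -
  have H: "subalgebra M H" using F by (rule subalgebra_trans)
  interpret H: sigma_finite_subalgebra M H by (rule subalgebra_sigma_finite) fact
  have iC: "integrable M (indicator C :: 'a \<Rightarrow> real)" using integrable_indicator_set C by simp
  have fM: "f \<in> borel_measurable M" by (rule measurable_from_subalg[OF F(1) f(1)])
  have "AE x in M. real_cond_exp M F (indicator C) x = real_cond_exp M H (indicator C) x"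
  proof (rule cond_exp_unique[OF F(1) iC])
    fix A assume A: "A \<in> sets F"
    then have "A \<in> sets M" using F(1) by (auto simp: subalgebra_def)
    then have "(\<integral>x. indicator C x * indicator A x \<partial>M) = measure M (A \<inter> C)"
      using C by (simp add: indicator_inter_arith[symmetric] Int_commute)
    also have "\<dots> = (\<integral>x. real_cond_exp M H (indicator C) x * indicator A x \<partial>M)"
      using ci A C(1) by (simp add: cond_indep_sets_def set_lebesgue_integral_def mult.commute)
    finally show "(\<integral>x. indicator C x * indicator A x \<partial>M) = (\<integral>x. real_cond_exp M H (indicator C) x * indicator A x \<partial>M)" .
  qed (use F(2) iC H.real_cond_exp_int(1) in \<open>auto intro: measurable_from_subalg\<close>)
  then have eq: "(\<integral>x. f x * real_cond_exp M F (indicator C) x \<partial>M) = (\<integral>x. f x * real_cond_exp M H (indicator C) x \<partial>M)"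
    by (intro integral_cong_AE) (use fM in auto)
  have "(\<integral>x. f x * indicator C x \<partial>M) = (\<integral>x. f x * real_cond_exp M F (indicator C) x \<partial>M)"
    by (rule cond_exp_move[OF F(1) f iC, symmetric])
  also note eq
  also have "(\<integral>x. f x * real_cond_exp M H (indicator C) x \<partial>M) = (\<integral>x. real_cond_exp M H f x * indicator C x \<partial>M)"
    by (rule cond_exp_adjoint[OF H fM f(2), where D=1]) (use C in \<open>auto simp: indicator_def\<close>)
  finally show ?thesis .
qed

text \<open>Conditional independence of sets says that a bounded \<open>f\<close> that is \<open>F\<close>-measurable has the same conditional expectation
given \<open>G\<close> as given \<open>H\<close>. So conditioning \<open>f * g\<close> first on \<open>G\<close> and then on \<open>H\<close> factors the product.\<close>

lemma rel_indepI:
  assumes ci: "cond_indep_sets M F G H" and F: "subalgebra M F" "subalgebra F H" and G: "subalgebra M G" "subalgebra G H"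
  shows "rel_indep M F G H"
  unfolding rel_indep_def
proof (intro allI impI)
  fix f g :: "'a \<Rightarrow> real"
  assume f: "f \<in> borel_measurable F" "bounded (f ` space F)" and g: "g \<in> borel_measurable G" "bounded (g ` space G)"
  have sp: "space F = space M" "space G = space M" using F(1) G(1) by (auto simp: subalgebra_def)
  obtain B D where B: "\<And>x. x \<in> space M \<Longrightarrow> \<bar>f x\<bar> \<le> B" and D: "\<And>x. x \<in> space M \<Longrightarrow> \<bar>g x\<bar> \<le> D"
    using f(2) g(2) unfolding bounded_iff sp by auto
  have H: "subalgebra M H" using F by (rule subalgebra_trans)
  interpret H: sigma_finite_subalgebra M H by (rule subalgebra_sigma_finite) fact
  interpret G: sigma_finite_subalgebra M G by (rule subalgebra_sigma_finite) fact
  have [measurable]: "f \<in> borel_measurable M" "g \<in> borel_measurable M"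
    using f(1) g(1) F(1) G(1) by (auto intro: measurable_from_subalg)
  have i: "integrable M f" "integrable M g"
    by (rule integrable_boundedI[of f B]; simp add: B) (rule integrable_boundedI[of g D]; simp add: D)
  have EG: "AE x in M. real_cond_exp M G f x = real_cond_exp M H f x"
  proof (rule cond_exp_unique[OF G(1) i(1) H.real_cond_exp_int(1)[OF i(1)]])
    show "real_cond_exp M H f \<in> borel_measurable G" using G(2) by (auto intro: measurable_from_subalg)
    fix A assume "A \<in> sets G"
    moreover then have "A \<in> sets M" using G(1) by (auto simp: subalgebra_def)
    ultimately show "(\<integral>x. f x * indicator A x \<partial>M) = (\<integral>x. real_cond_exp M H f x * indicator A x \<partial>M)"
      by (rule cond_indep_sets_bounded[OF ci F _ _ f(1) B])
  qed
  have ig: "integrable M (\<lambda>x. g x * real_cond_exp M H f x)"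
    by (rule integrable_bounded_mult[of _ D]) (use i D in auto)
  have ifg: "integrable M (\<lambda>x. g x * f x)"
    by (rule integrable_bounded_mult[of _ D]) (use i D in auto)
  have 1: "AE x in M. real_cond_exp M H (\<lambda>x. real_cond_exp M H f x * g x) x = real_cond_exp M H f x * real_cond_exp M H g x"
    by (rule H.real_cond_exp_mult) (use ig in \<open>auto simp: mult.commute\<close>)
  have 2: "AE x in M. real_cond_exp M G (\<lambda>x. g x * f x) x = g x * real_cond_exp M G f x"
    by (rule G.real_cond_exp_mult) (use g ifg in auto)
  have 3: "AE x in M. real_cond_exp M H (real_cond_exp M G (\<lambda>x. g x * f x)) x = real_cond_exp M H (\<lambda>x. g x * f x) x"
    by (rule H.real_cond_exp_nested_subalg) (use G ifg in auto)
  have 4: "AE x in M. real_cond_exp M H (real_cond_exp M G (\<lambda>x. g x * f x)) x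
      = real_cond_exp M H (\<lambda>x. real_cond_exp M H f x * g x) x"
    by (rule H.real_cond_exp_cong, use 2 EG in eventually_elim) auto
  show "AE x in M. real_cond_exp M H (\<lambda>x. f x * g x) x = real_cond_exp M H f x * real_cond_exp M H g x"
    using 1 3 4 by eventually_elim (simp add: mult.commute)
qed

lemma cond_indep_sets_generatorI:
  assumes F: "subalgebra M F" and H: "subalgebra M H" and G: "subalgebra M G"
    and gen: "sets F = sigma_sets (space M) P" "P \<subseteq> Pow (space M)" "Int_stable P"
    and eq: "\<And>A C. A \<in> P \<Longrightarrow> C \<in> sets G \<Longrightarrow> measure M (A \<inter> C) = (LINT x:A|M. real_cond_exp M H (indicator C) x)"
  shows "cond_indep_sets M F G H"
  unfolding cond_indep_sets_def
proof (intro ballI)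
  fix A C assume A: "A \<in> sets F" and C: "C \<in> sets G"
  interpret H: sigma_finite_subalgebra M H by (rule subalgebra_sigma_finite) fact
  have CM: "C \<in> sets M" using C G by (auto simp: subalgebra_def)
  have sF: "sigma_sets (space M) P \<subseteq> sets M" using F gen(1) by (auto simp: subalgebra_def)
  let ?h = "real_cond_exp M H (indicator C)"
  have iC: "integrable M (indicator C :: 'a \<Rightarrow> real)" using integrable_indicator_set CM by simp
  then have h: "integrable M ?h" by (rule H.real_cond_exp_int(1))
  have hset: "set_integrable M B ?h" if "B \<in> sets M" for B
    unfolding set_integrable_def using integrable_mult_indicator[OF that h] by simp
  have total: "(LINT x:space M|M. ?h x) = measure M C"
    using H.real_cond_exp_int(2)[OF iC] CM
    by (simp add: set_lebesgue_integral_def Bochner_Integration.integral_cong[of M M "\<lambda>x. indicator (space M) x * ?h x" ?h])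
  have "A \<in> sigma_sets (space M) P" using A gen(1) by simp
  from gen(3,2) this show "measure M (A \<inter> C) = (LINT x:A|M. ?h x)"
  proof (induction rule: sigma_sets_induct_disjoint)
    case (basic A)
    then show ?case using eq C by blast
  next
    case empty
    then show ?case by (simp add: set_lebesgue_integral_def)
  next
    case (compl A)
    then have AM: "A \<in> sets M" using sF by auto
    have "(LINT x:A \<union> (space M - A)|M. ?h x) = (LINT x:A|M. ?h x) + (LINT x:space M - A|M. ?h x)"
      using AM by (intro set_integral_Un hset) auto
    moreover have "A \<union> (space M - A) = space M" using sets.sets_into_space[OF AM] by auto
    moreover have "measure M C = measure M (A \<inter> C) + measure M ((space M - A) \<inter> C)"
      using AM CM sets.sets_into_space[OF CM]
      by (subst finite_measure_Union[symmetric]) (auto intro!: arg_cong[of _ _ "measure M"])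
    ultimately show ?case using compl(2) total by simp
  next
    case (union A)
    then have AM: "A i \<in> sets M" for i using sF by auto
    have "(LINT x:(\<Union>i. A i)|M. ?h x) = (\<Sum>i. LINT x:A i|M. ?h x)"
    proof (rule lebesgue_integral_countable_add)
      show "set_integrable M (\<Union>i. A i) ?h" using AM by (intro hset) auto
    qed (use AM union(1) in \<open>auto simp: disjoint_family_on_def\<close>)
    also have "\<dots> = (\<Sum>i. measure M (A i \<inter> C))" using union by simp
    also have "\<dots> = measure M (\<Union>i. A i \<inter> C)"
      by (rule sums_unique[symmetric], rule finite_measure_UNION)
        (use AM CM union(1) in \<open>auto simp: disjoint_family_on_def\<close>)
    also have "(\<Union>i. A i \<inter> C) = (\<Union>i. A i) \<inter> C" by blast
    finally show ?case by (rule sym)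
  qed
qed

end

section \<open>Coding standard Borel spaces\<close>

text \<open>Code a point by its distances to a dense sequence. A sequence of reals is the code of a point if and only if it takes
arbitrarily small values and satisfies the triangle inequalities with the distances inside the dense
sequence, by completeness. These are countably many measurable conditions, so the inverse of
the coding is measurable.\<close>

lemma standard_borel_real_coding:
  fixes X :: "'a measure"
  assumes X: "standard_borel X" "space X \<noteq> {}"
  obtains h :: "nat \<Rightarrow> 'a \<Rightarrow> real" and g :: "(nat \<Rightarrow> real) \<Rightarrow> 'a" where
    "\<And>n. h n \<in> borel_measurable X" "g \<in> measurable (Pi\<^sub>M UNIV (\<lambda>_. borel)) X"
    "\<And>x. x \<in> space X \<Longrightarrow> g (\<lambda>n. h n x) = x"
proof -
  obtain T where T: "completely_metrizable_space T" "second_countable T" "topspace T = space X"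
    "sets X = sigma_sets (topspace T) {U. openin T U}"
    using X(1) unfolding standard_borel_def by blast
  obtain M d where Md: "Metric_space M d" "Metric_space.mcomplete M d" "T = Metric_space.mtopology M d"
    using T(1) unfolding completely_metrizable_space_def by blast
  interpret Metric_space M d by fact
  have M: "M = space X" using T(3) Md(3) by simp
  obtain C where C: "countable C" "C \<subseteq> M" "mtopology closure_of C = M"
    using second_countable_imp_separable_space[OF T(2)] unfolding separable_space_def Md(3) by auto
  have "C \<noteq> {}" using C(3) X(2) M by auto
  define a where "a = from_nat_into C"
  have aM: "a n \<in> M" for n using C(2) from_nat_into[OF \<open>C \<noteq> {}\<close>] by (auto simp: a_def)
  have dense: "\<exists>n. d x (a n) < e" if x: "x \<in> M" and e: "e > 0" for x e
  proof -
    have "x \<in> mtopology closure_of C" using C(3) x by simp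
    then obtain y where "y \<in> C" "y \<in> mball x e"
      using e unfolding metric_closure_of by auto
    moreover then obtain n where "a n = y"
      using from_nat_into_surj[OF C(1)] unfolding a_def by blast
    ultimately show ?thesis by auto
  qed
  define h where "h n x = d x (a n)" for n x
  have openX: "U \<in> sets X" if "openin T U" for U using T(4) that by auto
  have hm: "h n \<in> borel_measurable X" for n
    unfolding borel_measurable_iff_less
  proof
    fix r
    have "{x \<in> space X. h n x < r} = mball (a n) r"
      unfolding M[symmetric] using aM[of n] by (auto simp: h_def commute)
    then show "{x \<in> space X. h n x < r} \<in> sets X" using openX Md(3) by simp
  qed
  let ?B = "Pi\<^sub>M (UNIV :: nat set) (\<lambda>_. borel :: real measure)"
  \<comment> \<open>The set of all codes of points.\<close>
  define G where "G = {z. (\<forall>m. \<exists>n. z n < 1 / real (Suc m)) \<and>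
    (\<forall>n l. \<bar>z n - z l\<bar> \<le> d (a n) (a l) \<and> d (a n) (a l) \<le> z n + z l)}"
  have hG: "(\<lambda>n. h n x) \<in> G" if x: "x \<in> M" for x
    unfolding G_def mem_Collect_eq
  proof (intro conjI allI)
    fix m show "\<exists>n. h n x < 1 / real (Suc m)" using dense[OF x] by (simp add: h_def)
  next
    fix n l
    show "\<bar>h n x - h l x\<bar> \<le> d (a n) (a l)" "d (a n) (a l) \<le> h n x + h l x"
      using triangle[OF x aM aM, of n l] triangle[OF x aM aM, of l n] triangle[OF aM x aM, of n l]
        commute[of "a n" "a l"] commute[of x "a n"] by (auto simp: h_def)
  qed
  have Gex: "\<exists>x\<in>M. \<forall>n. h n x = z n" if z: "z \<in> G" for z
  proof -
    have z1: "\<exists>n. z n < 1 / real (Suc m)" and z2: "\<bar>z n - z l\<bar> \<le> d (a n) (a l)" "d (a n) (a l) \<le> z n + z l" for m n l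
      using z by (auto simp: G_def)
    obtain s where s: "\<And>m. z (s m) < 1 / real (Suc m)" using z1 by metis
    have inv: "(\<lambda>m. 1 / real (Suc m)) \<longlonglongrightarrow> 0" by (rule LIMSEQ_Suc[OF lim_1_over_n])
    have "MCauchy (\<lambda>m. a (s m))"
      unfolding MCauchy_def
    proof (intro conjI allI impI)
      show "range (\<lambda>m. a (s m)) \<subseteq> M" using aM by auto
      fix e :: real assume e: "e > 0"
      then obtain K where K: "\<And>m. m \<ge> K \<Longrightarrow> 1 / real (Suc m) < e / 2"
        using order_tendstoD(2)[OF inv, of "e/2"] by (auto simp: eventually_sequentially)
      show "\<exists>N. \<forall>n n'. N \<le> n \<longrightarrow> N \<le> n' \<longrightarrow> d (a (s n)) (a (s n')) < e"
      proof (intro exI[of _ K] allI impI)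
        fix n n' assume "K \<le> n" "K \<le> n'"
        then show "d (a (s n)) (a (s n')) < e"
          using z2(2)[of "s n" "s n'"] s[of n] s[of n'] K[of n] K[of n'] by linarith
      qed
    qed
    then obtain x where x: "limitin mtopology (\<lambda>m. a (s m)) x sequentially"
      using Md(2) unfolding mcomplete_def by blast
    then have xM: "x \<in> M" using limitin_mspace by blast
    have lim: "(\<lambda>m. d (a (s m)) x) \<longlonglongrightarrow> 0"
      using x by (simp add: limitin_metric_dist_null)
    have "h n x = z n" for n
    proof -
      have "\<bar>z n - h n x\<bar> \<le> 1 / real (Suc m) + d (a (s m)) x" for m
      proof -
        have "\<bar>z n - d (a n) (a (s m))\<bar> \<le> 1 / real (Suc m)"
          using z2[of n "s m"] s[of m] by linarith
        moreover have "\<bar>d (a n) (a (s m)) - d x (a n)\<bar> \<le> d (a (s m)) x"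
          using triangle[OF xM aM aM, of "s m" n] triangle[OF aM aM xM, of n "s m"] triangle[OF aM xM aM, of n "s m"]
            commute[of x "a n"] commute[of x "a (s m)"] commute[of "a n" "a (s m)"] by linarith
        ultimately show ?thesis by (simp add: h_def)
      qed
      moreover have "(\<lambda>m. 1 / real (Suc m) + d (a (s m)) x) \<longlonglongrightarrow> 0"
        using tendsto_add[OF inv lim] by simp
      ultimately have "\<bar>z n - h n x\<bar> \<le> 0"
        by (intro tendsto_lowerbound[of "\<lambda>m. 1 / real (Suc m) + d (a (s m)) x" 0 sequentially] always_eventually) auto
      then show ?thesis by simp
    qed
    then show ?thesis using xM by blast
  qed
  define g where "g z = (if z \<in> G then (SOME x. x \<in> M \<and> (\<forall>n. h n x = z n)) else a 0)" for z
  have gG: "g z \<in> M \<and> (\<forall>n. h n (g z) = z n)" if "z \<in> G" for z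
    using someI_ex[of "\<lambda>x. x \<in> M \<and> (\<forall>n. h n x = z n)"] Gex[OF that] that by (auto simp: g_def)
  have gM: "g z \<in> M" for z using gG aM by (cases "z \<in> G") (auto simp: g_def)
  have inj: "x = y" if xy: "x \<in> M" "y \<in> M" "\<And>n. h n x = h n y" for x y
  proof (rule ccontr)
    assume "x \<noteq> y"
    then have "d x y > 0" using xy by simp
    then obtain n where n: "d x (a n) < d x y / 2" using dense[OF xy(1), of "d x y / 2"] by auto
    then have "d y (a n) < d x y / 2" using xy(3)[of n] by (simp add: h_def)
    then show False using n triangle[OF xy(1) aM xy(2), of n] commute[of y "a n"] by linarith
  qed
  have gh: "g (\<lambda>n. h n x) = x" if "x \<in> M" for x
    using gG[OF hG[OF that]] that inj by auto
  have Gm: "G \<inter> space ?B \<in> sets ?B"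
  proof -
    have "{z \<in> space ?B. (\<forall>m. \<exists>n. z n < 1 / real (Suc m)) \<and>
      (\<forall>n l. \<bar>z n - z l\<bar> \<le> d (a n) (a l) \<and> d (a n) (a l) \<le> z n + z l)} \<in> sets ?B"
      by measurable
    also have "{z \<in> space ?B. (\<forall>m. \<exists>n. z n < 1 / real (Suc m)) \<and>
      (\<forall>n l. \<bar>z n - z l\<bar> \<le> d (a n) (a l) \<and> d (a n) (a l) \<le> z n + z l)} = G \<inter> space ?B"
      by (auto simp: G_def)
    finally show ?thesis .
  qed
  have gm: "g \<in> measurable ?B X"
  proof (rule measurable_sigma_sets[OF T(4)])
    show "{U. openin T U} \<subseteq> Pow (topspace T)" using openin_subset by blast
    show "g \<in> space ?B \<rightarrow> topspace T" using gM M T(3) by auto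
    fix U assume "U \<in> {U. openin T U}"
    then have U: "openin mtopology U" using Md(3) by simp
    \<comment> \<open>The small balls around points of the dense sequence that lie inside \<open>U\<close>; their union is \<open>U\<close>.\<close>
    define K where "K = {(n, m). mball (a n) (1 / real (Suc m)) \<subseteq> U}"
    have gU: "g z \<in> U \<longleftrightarrow> (\<exists>(n, m)\<in>K. z n < 1 / real (Suc m))" if z: "z \<in> G" for z
    proof
      assume "g z \<in> U"
      then obtain r where r: "r > 0" "mball (g z) r \<subseteq> U" using U unfolding openin_mtopology by blast
      obtain m where m: "1 / real (Suc m) < r / 2" using r(1) nat_approx_posE[of "r/2"] by auto
      obtain n where n: "z n < 1 / real (Suc m)" using z unfolding G_def by blast
      have "mball (a n) (1 / real (Suc m)) \<subseteq> U"
      proof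
        fix y assume "y \<in> mball (a n) (1 / real (Suc m))"
        then have y: "y \<in> M" "d (a n) y < 1 / real (Suc m)" by auto
        have "d (g z) (a n) = z n" using gG[OF z] by (simp add: h_def)
        then have "d (g z) y < r" using triangle[OF gM aM y(1), of z n] y(2) n m by linarith
        then show "y \<in> U" using r(2) y(1) gM by auto
      qed
      then show "\<exists>(n, m)\<in>K. z n < 1 / real (Suc m)" using n by (auto simp: K_def)
    next
      assume "\<exists>(n, m)\<in>K. z n < 1 / real (Suc m)"
      then obtain n m where nm: "mball (a n) (1 / real (Suc m)) \<subseteq> U" "z n < 1 / real (Suc m)"
        by (auto simp: K_def)
      have "d (g z) (a n) = z n" using gG[OF z] by (simp add: h_def)
      then have "g z \<in> mball (a n) (1 / real (Suc m))" using gM aM nm(2) commute[of "a n" "g z"] by auto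
      then show "g z \<in> U" using nm(1) by blast
    qed
    have "g -` U \<inter> space ?B = (\<Union>(n, m)\<in>K. (G \<inter> space ?B) \<inter> {z \<in> space ?B. z n < 1 / real (Suc m)}) \<union>
        (if a 0 \<in> U then space ?B - (G \<inter> space ?B) else {})" (is "?L = ?R")
    proof (rule set_eqI)
      fix z show "z \<in> ?L \<longleftrightarrow> z \<in> ?R"
        using gU[of z] by (cases "z \<in> G") (auto simp: g_def)
    qed
    moreover have "(\<Union>(n, m)\<in>K. (G \<inter> space ?B) \<inter> {z \<in> space ?B. z n < 1 / real (Suc m)}) \<in> sets ?B"
    proof (rule sets.countable_UN')
      show "countable K" by (rule countable_subset[of _ UNIV]) auto
      show "(\<lambda>(n, m). (G \<inter> space ?B) \<inter> {z \<in> space ?B. z n < 1 / real (Suc m)}) ` K \<subseteq> sets ?B"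
        using Gm by (auto intro!: sets.Int)
    qed
    ultimately show "g -` U \<inter> space ?B \<in> sets ?B" using Gm by auto
  qed
  show thesis using that[of h g] hm gm gh M by blast
qed

text \<open>Bits are used because finitely many of them take only finitely many values, which makes limits of their joint
distributions trivial to form. A real number is recovered from the rationals above it.\<close>

lemma standard_borel_bit_coding:
  fixes X :: "'a measure"
  assumes X: "standard_borel X" "space X \<noteq> {}"
  obtains B :: "nat \<Rightarrow> 'a set" and g :: "(nat \<Rightarrow> bool) \<Rightarrow> 'a" where
    "\<And>n. B n \<in> sets X" "g \<in> measurable (Pi\<^sub>M UNIV (\<lambda>_. count_space UNIV)) X"
    "\<And>x. x \<in> space X \<Longrightarrow> g (\<lambda>n. x \<in> B n) = x"
proof -
  obtain h :: "nat \<Rightarrow> 'a \<Rightarrow> real" and g where h: "\<And>n. h n \<in> borel_measurable X"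
    and g: "g \<in> measurable (Pi\<^sub>M UNIV (\<lambda>_. borel)) X" and gh: "\<And>x. x \<in> space X \<Longrightarrow> g (\<lambda>n. h n x) = x"
    using standard_borel_real_coding[OF X] by blast
  define q where "q m = (from_nat_into \<rat> m :: real)" for m
  have q: "\<exists>m. r < q m \<and> q m < s" if "r < s" for r s :: real
  proof -
    obtain t where "t \<in> \<rat>" "r < t" "t < s" using Rats_dense_in_real[OF \<open>r < s\<close>] by blast
    then show ?thesis using from_nat_into_surj[OF countable_rat] unfolding q_def by metis
  qed
  define B where "B i = (case prod_decode i of (n, m) \<Rightarrow> {x \<in> space X. h n x < q m})" for i
  define t where "t b n = real_of_ereal (INF m. if b (prod_encode (n, m)) then ereal (q m) else \<infinity>)"
    for b :: "nat \<Rightarrow> bool" and n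
  have th: "t (\<lambda>i. x \<in> B i) n = h n x" if "x \<in> space X" for x n
  proof -
    let ?i = "INF m. if x \<in> B (prod_encode (n, m)) then ereal (q m) else \<infinity>"
    have "?i = ereal (h n x)"
    proof (rule antisym)
      show "ereal (h n x) \<le> ?i"
        by (rule INF_greatest) (auto simp: B_def)
      show "?i \<le> ereal (h n x)"
      proof (rule dense_ge)
        fix y assume y: "ereal (h n x) < y"
        obtain r where r: "h n x < r" "ereal r \<le> y"
        proof (cases y)
          case (real r) then show ?thesis using that[of r] y by auto
        next
          case PInf then show ?thesis using that[of "h n x + 1"] by auto
        qed (use y in auto)
        obtain m where m: "h n x < q m" "q m < r" using q[OF r(1)] by blast
        have "?i
            \<le> (if x \<in> B (prod_encode (n, m)) then ereal (q m) else \<infinity>)"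
          by (rule INF_lower) simp
        also have "\<dots> = ereal (q m)" using m that by (simp add: B_def)
        also have "\<dots> \<le> ereal r" using m by simp
        finally show "?i \<le> y"
          using r(2) by simp
      qed
    qed
    then show ?thesis by (simp add: t_def)
  qed
  have tm: "t \<in> measurable (Pi\<^sub>M UNIV (\<lambda>_. count_space UNIV)) (Pi\<^sub>M UNIV (\<lambda>_. borel))"
  proof (rule measurable_PiM_single')
    show "(\<lambda>b. t b n) \<in> borel_measurable (Pi\<^sub>M UNIV (\<lambda>_. count_space UNIV))" for n
      unfolding t_def by measurable
  qed (auto simp: space_PiM)
  show thesis
  proof (rule that[of B "\<lambda>b. g (t b)"])
    show "B n \<in> sets X" for n
      using h unfolding B_def by (auto split: prod.split)
    show "(\<lambda>b. g (t b)) \<in> measurable (Pi\<^sub>M UNIV (\<lambda>_. count_space UNIV)) X"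
      using measurable_compose[OF tm g] .
    show "g (t (\<lambda>n. x \<in> B n)) = x" if "x \<in> space X" for x
    proof -
      have "t (\<lambda>n. x \<in> B n) = (\<lambda>n. h n x)" by (rule ext) (rule th[OF that])
      then show ?thesis using gh[OF that] by simp
    qed
  qed
qed

text \<open>Satedness is tested on extensions by spaces whose points are real numbers. A finite power of \<open>X\<close> is pressed into such a
space by way of the standard Borel space of all real sequences.\<close>

lemma standard_borel_power_coding:
  fixes X :: "'a measure"
  assumes X: "standard_borel X" "space X \<noteq> {}"
  obtains Y :: "real measure" and c :: "(nat \<Rightarrow> 'a) \<Rightarrow> real" and dec :: "nat \<Rightarrow> real \<Rightarrow> 'a" where
    "standard_borel Y" "c \<in> measurable (Pi\<^sub>M {0..k} (\<lambda>_. X)) Y" "\<And>j. dec j \<in> measurable Y X"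
    "\<And>x j. x \<in> space (Pi\<^sub>M {0..k} (\<lambda>_. X)) \<Longrightarrow> j \<in> {0..k} \<Longrightarrow> dec j (c x) = x j"
proof -
  obtain h :: "nat \<Rightarrow> 'a \<Rightarrow> real" and g where h: "\<And>n. h n \<in> borel_measurable X"
    and g: "g \<in> measurable (Pi\<^sub>M UNIV (\<lambda>_. borel)) X" and gh: "\<And>x. x \<in> space X \<Longrightarrow> g (\<lambda>n. h n x) = x"
    using standard_borel_real_coding[OF X] by blast
  obtain \<B> :: "(nat \<Rightarrow> real) set set" where \<B>: "countable \<B>" "topological_basis \<B>"
    using ex_countable_basis by blast
  then have "second_countable (euclidean :: (nat \<Rightarrow> real) topology)"
    unfolding second_countable_def
    by (intro exI[of _ \<B>]) (auto simp: topological_basis_open elim!: topological_basisE)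
  then have "standard_borel (borel :: (nat \<Rightarrow> real) measure)"
    unfolding standard_borel_def
    by (intro exI[of _ euclidean]) (auto simp: completely_metrizable_space_euclidean borel_def)
  then obtain Y :: "real measure" and f f' where Y: "standard_borel Y" "f \<in> measurable borel Y" "f' \<in> measurable Y borel"
    "\<And>z :: nat \<Rightarrow> real. f' (f z) = z"
    using standard_borel_iso_real[of "borel :: (nat \<Rightarrow> real) measure"] by (metis UNIV_I space_borel)
  have sB: "sets (borel :: (nat \<Rightarrow> real) measure) = sets (Pi\<^sub>M UNIV (\<lambda>_. borel))"
    by (rule sets_PiM_equal_borel[symmetric])
  define e where "e x i = (case prod_decode i of (j, n) \<Rightarrow> if j \<le> k then h n (x j) else 0)"
    for x :: "nat \<Rightarrow> 'a" and i
  define r where "r j z n = z (prod_encode (j, n))" for j n and z :: "nat \<Rightarrow> real"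
  have em: "e \<in> measurable (Pi\<^sub>M {0..k} (\<lambda>_. X)) borel"
    unfolding measurable_cong_sets[OF refl sB]
  proof (rule measurable_PiM_single')
    fix i
    obtain j n where jn: "prod_decode i = (j, n)" by fastforce
    show "(\<lambda>x. e x i) \<in> borel_measurable (Pi\<^sub>M {0..k} (\<lambda>_. X))"
      unfolding e_def jn prod.case
      using measurable_compose[where f = "\<lambda>x. x j" and M = "Pi\<^sub>M {0..k} (\<lambda>_. X)", OF _ h[of n]]
      by (cases "j \<le> k") auto
  qed (auto simp: space_PiM)
  have rm: "r j \<in> measurable borel (Pi\<^sub>M UNIV (\<lambda>_. borel))" for j
    unfolding measurable_cong_sets[OF sB refl]
    by (rule measurable_PiM_single') (auto simp: space_PiM r_def)
  show thesis
  proof (rule that[of Y "\<lambda>x. f (e x)" "\<lambda>j y. g (r j (f' y))"])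
    show "(\<lambda>x. f (e x)) \<in> measurable (Pi\<^sub>M {0..k} (\<lambda>_. X)) Y"
      by (rule measurable_compose[OF em Y(2)])
    show "(\<lambda>y. g (r j (f' y))) \<in> measurable Y X" for j
      by (rule measurable_compose[OF Y(3) measurable_compose[OF rm g]])
    fix x j assume x: "x \<in> space (Pi\<^sub>M {0..k} (\<lambda>_. X))" "j \<in> {0..k}"
    then have "x j \<in> space X" by (auto simp: space_PiM)
    moreover have "r j (e x) = (\<lambda>n. h n (x j))" using x(2) by (auto simp: r_def e_def)
    ultimately show "g (r j (f' (f (e x)))) = x j" using gh Y(4) by simp
  qed fact
qed

section \<open>Ultralimits of laws\<close>

abbreviation bits :: "'j set \<Rightarrow> ('j \<Rightarrow> bool) measure" where
  "bits I \<equiv> Pi\<^sub>M I (\<lambda>_. count_space UNIV)"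

text \<open>Limits of the probabilities of finite bit patterns are consistent and finitely supported, so Kolmogorov's
extension theorem turns them into a law.\<close>

lemma bits_limit:
  fixes K :: "'s \<Rightarrow> 'j \<Rightarrow> 'w set"
  assumes M: "prob_space M" and U: "ultrafilter U" "U \<le> principal S"
    and K: "\<And>s j. s \<in> S \<Longrightarrow> j \<in> I \<Longrightarrow> K s j \<in> sets M"
  obtains Q where "prob_space Q" "sets Q = sets (bits I)"
    "\<And>J. finite J \<Longrightarrow> J \<subseteq> I \<Longrightarrow>
      ((\<lambda>s. measure M {\<omega> \<in> space M. \<forall>j\<in>J. \<omega> \<in> K s j}) \<longlongrightarrow> measure Q {z \<in> space Q. \<forall>j\<in>J. z j}) U"
proof -
  interpret M: prob_space M by fact
  have Ubot: "U \<noteq> bot" using U by (simp add: ultrafilter_def)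
  have US: "eventually (\<lambda>s. s \<in> S) U" using U(2) by (simp add: le_principal)
  define E where "E s J a = {\<omega> \<in> space M. \<forall>j\<in>J. (\<omega> \<in> K s j) = a j}" for s J and a :: "'j \<Rightarrow> bool"
  define W where "W J a = Lim U (\<lambda>s. measure M (E s J a))" for J a
  have tW: "((\<lambda>s. measure M (E s J a)) \<longlongrightarrow> W J a) U" for J a
  proof -
    obtain c where "((\<lambda>s. measure M (E s J a)) \<longlongrightarrow> c) U"
      by (rule ultra_tendsto[OF U(1), of "\<lambda>s. measure M (E s J a)" 1]) simp
    then show ?thesis unfolding W_def using tendsto_Lim[OF Ubot] by metis
  qed
  have W0: "0 \<le> W J a" for J a
    by (rule tendsto_lowerbound[OF tW _ Ubot]) simp
  define A where "A J = (Pi\<^sub>E J (\<lambda>_. UNIV) :: ('j \<Rightarrow> bool) set)" for J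
  have finA: "finite (A J)" if "finite J" for J using that by (simp add: A_def finite_PiE)
  have Em: "E s J a \<in> sets M" if "s \<in> S" "finite J" "J \<subseteq> I" for s J a
  proof -
    have [measurable]: "K s j \<in> sets M" if "j \<in> J" for j using K \<open>s \<in> S\<close> \<open>J \<subseteq> I\<close> that by blast
    show ?thesis unfolding E_def using \<open>finite J\<close> by measurable
  qed
  have Wsum: "W J' a' = (\<Sum>a\<in>{a \<in> A J. restrict a J' = restrict a' J'}. W J a)"
    if J: "finite J" "J \<subseteq> I" "J' \<subseteq> J" for J J' a'
  proof (rule tendsto_unique[OF Ubot tW])
    let ?R = "{a \<in> A J. restrict a J' = restrict a' J'}"
    have "eventually (\<lambda>s. (\<Sum>a\<in>?R. measure M (E s J a)) = measure M (E s J' a')) U"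
      using US
    proof eventually_elim
      fix s assume s: "s \<in> S"
      have "E s J' a' = (\<Union>a\<in>?R. E s J a)"
      proof (intro set_eqI iffI)
        fix \<omega> assume \<omega>: "\<omega> \<in> E s J' a'"
        then have "(\<lambda>j\<in>J. \<omega> \<in> K s j) \<in> ?R" "\<omega> \<in> E s J (\<lambda>j\<in>J. \<omega> \<in> K s j)"
          using J(3) by (auto simp: E_def A_def fun_eq_iff restrict_def)
        then show "\<omega> \<in> (\<Union>a\<in>?R. E s J a)" by blast
      next
        fix \<omega> assume "\<omega> \<in> (\<Union>a\<in>?R. E s J a)"
        then obtain a where a: "restrict a J' = restrict a' J'" "\<omega> \<in> E s J a" by blast
        have "a j = a' j" if "j \<in> J'" for j using fun_cong[OF a(1), of j] that by simp
        then show "\<omega> \<in> E s J' a'" using a(2) J(3) by (auto simp: E_def)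
      qed
      moreover have "measure M (\<Union>a\<in>?R. E s J a) = (\<Sum>a\<in>?R. measure M (E s J a))"
      proof (rule M.finite_measure_finite_Union)
        show "disjoint_family_on (E s J) ?R"
        proof (unfold disjoint_family_on_def, intro ballI impI)
          fix a b assume ab: "a \<in> ?R" "b \<in> ?R" "a \<noteq> b"
          then obtain j where "j \<in> J" "a j \<noteq> b j"
            using PiE_ext[of a J _ b] unfolding A_def by blast
          then show "E s J a \<inter> E s J b = {}" by (auto simp: E_def)
        qed
      qed (use finA[OF J(1)] Em[OF s J(1,2)] in auto)
      ultimately show "(\<Sum>a\<in>?R. measure M (E s J a)) = measure M (E s J' a')" by simp
    qed
    then show "((\<lambda>s. measure M (E s J' a')) \<longlongrightarrow> (\<Sum>a\<in>?R. W J a)) U"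
      by (rule Lim_transform_eventually[rotated]) (intro tendsto_sum tW)
  qed
  have W1: "W {} a = 1" for a
    by (rule tendsto_unique[OF Ubot tW]) (simp add: E_def M.prob_space)
  define w where "w J a = (if a \<in> A J then W J a else 0)" for J a
  have w0: "0 \<le> w J a" for J a using W0 by (simp add: w_def)
  have w1: "(\<integral>\<^sup>+ a. ennreal (w J a) \<partial>count_space UNIV) = 1" if "finite J" "J \<subseteq> I" for J
  proof -
    have "(\<integral>\<^sup>+ a. ennreal (w J a) \<partial>count_space UNIV) = (\<Sum>a\<in>A J. ennreal (w J a))"
      by (rule nn_integral_count_space'[OF finA]) (use that in \<open>auto simp: w_def\<close>)
    also have "\<dots> = ennreal (\<Sum>a\<in>A J. W J a)" using W0 by (simp add: w_def sum_ennreal)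
    also have "A J = {a \<in> A J. restrict a {} = restrict (\<lambda>_. True) {}}" by (simp add: restrict_def)
    also have "(\<Sum>a\<in>\<dots>. W J a) = 1" using Wsum[OF that, of "{}" "\<lambda>_. True"] W1 by simp
    finally show ?thesis by simp
  qed
  define p where "p J = embed_pmf (w J)" for J
  have pmf_p: "pmf (p J) a = w J a" if "finite J" "J \<subseteq> I" for J a
    unfolding p_def by (rule pmf_embed_pmf[OF w0 w1[OF that]])
  have prob_p: "measure (measure_pmf (p J)) B = (\<Sum>a\<in>A J \<inter> B. W J a)" if "finite J" "J \<subseteq> I" for J B
  proof -
    have "measure (measure_pmf (p J)) B = measure (measure_pmf (p J)) (A J \<inter> B)"
    proof (rule measure_pmf.finite_measure_eq_AE)
      show "AE x in measure_pmf (p J). (x \<in> B) = (x \<in> A J \<inter> B)"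
        by (auto simp: AE_measure_pmf_iff set_pmf_iff pmf_p[OF that] w_def split: if_splits)
    qed auto
    also have "\<dots> = (\<Sum>a\<in>A J \<inter> B. pmf (p J) a)"
      by (rule measure_measure_pmf_finite) (use finA[OF that(1)] in auto)
    finally show ?thesis by (simp add: pmf_p[OF that] w_def)
  qed
  have restr: "map_pmf (\<lambda>a. restrict a J') (p J) = p J'" if J: "finite J" "J \<subseteq> I" "J' \<subseteq> J" for J J'
  proof (rule pmf_eqI)
    fix b
    have J': "finite J'" "J' \<subseteq> I" using J finite_subset by auto
    have eq: "A J \<inter> (\<lambda>a. restrict a J') -` {b} = (if b \<in> A J' then {a \<in> A J. restrict a J' = restrict b J'} else {})"
    proof -
      have "restrict a J' \<in> A J'" for a by (simp add: A_def)
      moreover have "restrict b J' = b" if "b \<in> A J'" using that unfolding A_def by (rule PiE_restrict)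
      ultimately show ?thesis by auto
    qed
    have "pmf (map_pmf (\<lambda>a. restrict a J') (p J)) b = (\<Sum>a\<in>A J \<inter> (\<lambda>a. restrict a J') -` {b}. W J a)"
      unfolding pmf_map by (rule prob_p[OF J(1,2)])
    also have "\<dots> = w J' b"
      unfolding eq w_def using Wsum[OF J, of b] by simp
    finally show "pmf (map_pmf (\<lambda>a. restrict a J') (p J)) b = pmf (p J') b" by (simp add: pmf_p[OF J'])
  qed
  \<comment> \<open>Kolmogorov's theorem is applied to real-valued coordinates, so the bits become the numbers \<open>0\<close> and \<open>1\<close>; \<open>g\<close> below turns them back into bits.\<close>
  define f where "f J a = (\<lambda>j\<in>J. of_bool (a j) :: real)" for J and a :: "'j \<Rightarrow> bool"
  define P where "P J = distr (measure_pmf (p J)) (Pi\<^sub>M J (\<lambda>_. borel)) (f J)" for J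
  have fm: "f J \<in> measurable (measure_pmf N) (Pi\<^sub>M J (\<lambda>_. borel))" for J N
    by (auto simp: f_def space_PiM)
  interpret polish_projective I P
  proof (unfold polish_projective_def, rule projective_family.intro)
    fix J H assume JH: "J \<subseteq> H" "finite H" "H \<subseteq> I"
    have "distr (P H) (Pi\<^sub>M J (\<lambda>_. borel)) (\<lambda>f. restrict f J)
        = distr (measure_pmf (p H)) (Pi\<^sub>M J (\<lambda>_. borel)) ((\<lambda>f. restrict f J) \<circ> f H)"
      unfolding P_def by (rule distr_distr[OF measurable_restrict_subset[OF JH(1)] fm])
    also have "(\<lambda>f. restrict f J) \<circ> f H = f J \<circ> (\<lambda>a. restrict a J)"
      using JH(1) by (auto simp: f_def fun_eq_iff restrict_def)
    also have "distr (measure_pmf (p H)) (Pi\<^sub>M J (\<lambda>_. borel)) (f J \<circ> (\<lambda>a. restrict a J))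
        = distr (measure_pmf (map_pmf (\<lambda>a. restrict a J) (p H))) (Pi\<^sub>M J (\<lambda>_. borel)) (f J)"
      unfolding map_pmf_rep_eq by (rule distr_distr[symmetric]) (auto simp: f_def space_PiM)
    also have "\<dots> = P J" unfolding P_def restr[OF JH(2,3,1)] ..
    finally show "P J = distr (P H) (Pi\<^sub>M J (\<lambda>_. borel)) (\<lambda>f. restrict f J)" by (rule sym)
  next
    fix J assume "finite J" "J \<subseteq> I"
    show "prob_space (P J)" unfolding P_def by (rule measure_pmf.prob_space_distr[OF fm])
  qed
  define g where "g z = (\<lambda>i\<in>I. z i = 1)" for z :: "'j \<Rightarrow> real"
  have gm: "g \<in> measurable lim (bits I)"
    unfolding g_def measurable_cong_sets[OF sets_lim refl]
  proof (rule measurable_restrict)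
    fix i assume i: "i \<in> I"
    note [measurable] = measurable_component_singleton[OF i, of "\<lambda>_. borel :: real measure"]
    show "(\<lambda>z. z i = 1) \<in> measurable (Pi\<^sub>M I (\<lambda>_. borel :: real measure)) (count_space UNIV)"
      by measurable
  qed
  define Q where "Q = distr lim (bits I) g"
  show thesis
  proof (rule that[of Q])
    show "prob_space Q" unfolding Q_def by (rule P.prob_space_distr[OF gm])
    show "sets Q = sets (bits I)" by (simp add: Q_def)
    fix J assume J: "finite J" "J \<subseteq> I"
    let ?E = "{z \<in> space (Pi\<^sub>M J (\<lambda>_. borel :: real measure)). \<forall>j\<in>J. z j = 1}"
    have Es: "?E \<in> sets (Pi\<^sub>M J (\<lambda>_. borel))" using J(1) by measurable
    have Qs: "{z \<in> space (bits I). \<forall>j\<in>J. z j} \<in> sets (bits I)"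
    proof -
      have "Measurable.pred (bits I) (\<lambda>z. z j)" if "j \<in> J" for j
        using that J(2) by (auto intro!: measurable_component_singleton)
      then show ?thesis using J(1) by measurable
    qed
    have "measure Q {z \<in> space Q. \<forall>j\<in>J. z j} = measure lim (g -` {z \<in> space (bits I). \<forall>j\<in>J. z j} \<inter> space lim)"
      unfolding Q_def by (subst measure_distr[OF gm]) (use Qs in auto)
    also have "g -` {z \<in> space (bits I). \<forall>j\<in>J. z j} \<inter> space lim = prod_emb I (\<lambda>_. borel) J ?E"
      using J(2) by (auto simp: g_def prod_emb_def space_PiM PiE_iff subset_iff)
    also have "measure lim \<dots> = measure (P J) ?E" by (rule measure_lim_emb[OF J(2,1) Es])
    also have "\<dots> = measure (measure_pmf (p J)) (f J -` ?E)"
      unfolding P_def by (subst measure_distr[OF fm Es]) simp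
    also have "f J -` ?E = {a. \<forall>j\<in>J. a j}" by (auto simp: f_def space_PiM)
    also have "measure (measure_pmf (p J)) {a. \<forall>j\<in>J. a j} = (\<Sum>a\<in>A J \<inter> {a. \<forall>j\<in>J. a j}. W J a)"
      by (rule prob_p[OF J])
    also have "A J \<inter> {a. \<forall>j\<in>J. a j} = {\<lambda>j\<in>J. True}"
      by (auto simp: A_def fun_eq_iff PiE_iff extensional_def)
    also have "(\<Sum>a\<in>{\<lambda>j\<in>J. True}. W J a) = W J (\<lambda>j\<in>J. True)" by simp
    finally have 1: "measure Q {z \<in> space Q. \<forall>j\<in>J. z j} = W J (\<lambda>j\<in>J. True)" .
    have 2: "E s J (\<lambda>j\<in>J. True) = {\<omega> \<in> space M. \<forall>j\<in>J. \<omega> \<in> K s j}" for s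
      by (auto simp: E_def)
    show "((\<lambda>s. measure M {\<omega> \<in> space M. \<forall>j\<in>J. \<omega> \<in> K s j}) \<longlongrightarrow> measure Q {z \<in> space Q. \<forall>j\<in>J. z j}) U"
      using tW[of J "\<lambda>j\<in>J. True"] unfolding 1 2 .
  qed
qed

text \<open>The events that finitely many given bits are all on form a generating \<open>\<pi>\<close>-system.\<close>

lemma bits_law_eqI:
  assumes P: "prob_space P" "sets P = sets (bits I)" and Q: "prob_space Q" "sets Q = sets (bits I)"
    and eq: "\<And>J. finite J \<Longrightarrow> J \<subseteq> I \<Longrightarrow> measure P {z \<in> space P. \<forall>j\<in>J. z j} = measure Q {z \<in> space Q. \<forall>j\<in>J. z j}"
  shows "P = Q"
proof -
  interpret P: prob_space P by fact
  interpret Q: prob_space Q by fact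
  let ?\<Omega> = "Pi\<^sub>E I (\<lambda>_. UNIV :: bool set)"
  define c where "c J = {z \<in> ?\<Omega>. \<forall>j\<in>J. z j}" for J
  let ?E = "{c J | J. finite J \<and> J \<subseteq> I}"
  have sp: "space P = ?\<Omega>" "space Q = ?\<Omega>"
    using sets_eq_imp_space_eq[OF P(2)] sets_eq_imp_space_eq[OF Q(2)] by (simp_all add: space_PiM)
  have sub: "?E \<subseteq> Pow ?\<Omega>" by (auto simp: c_def)
  have gen: "sets (bits I) = sigma_sets ?\<Omega> ?E"
  proof (rule antisym)
    have single: "{z \<in> ?\<Omega>. z i} \<in> sigma_sets ?\<Omega> ?E" if "i \<in> I" for i
      using that by (intro sigma_sets.Basic) (auto simp: c_def intro!: exI[of _ "{i}"])
    have "{z \<in> ?\<Omega>. z i \<in> A} \<in> sigma_sets ?\<Omega> ?E" if "i \<in> I" for i A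
    proof -
      interpret sigma_algebra ?\<Omega> "sigma_sets ?\<Omega> ?E" by (rule sigma_algebra_sigma_sets[OF sub])
      have "{z \<in> ?\<Omega>. z i \<in> A} = (if True \<in> A then {z \<in> ?\<Omega>. z i} else {}) \<union> (if False \<in> A then ?\<Omega> - {z \<in> ?\<Omega>. z i} else {})"
        by auto (metis (full_types))+
      then show ?thesis using single[OF that] by auto
    qed
    then have "{{f \<in> ?\<Omega>. f i \<in> A} |i A. i \<in> I \<and> A \<in> sets (count_space UNIV)} \<subseteq> sigma_sets ?\<Omega> ?E" by auto
    then show "sets (bits I) \<subseteq> sigma_sets ?\<Omega> ?E"
      unfolding sets_PiM_single space_count_space by (rule sigma_sets_mono)
    have "c J \<in> sets (bits I)" if "finite J" "J \<subseteq> I" for J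
    proof -
      have "Measurable.pred (bits I) (\<lambda>z. z j)" if "j \<in> J" for j
        using that \<open>J \<subseteq> I\<close> by (auto intro!: measurable_component_singleton)
      then have "{z \<in> space (bits I). \<forall>j\<in>J. z j} \<in> sets (bits I)" using that(1) by measurable
      then show ?thesis by (simp add: c_def space_PiM)
    qed
    then show "sigma_sets ?\<Omega> ?E \<subseteq> sets (bits I)"
      using sets.sigma_sets_subset[of ?E "bits I"] by (auto simp: space_PiM)
  qed
  show ?thesis
  proof (rule measure_eqI_generator_eq[where E = ?E and \<Omega> = ?\<Omega> and A = "\<lambda>_. ?\<Omega>"])
    show "Int_stable ?E"
    proof (rule Int_stableI, safe)
      fix J J' assume "finite J" "J \<subseteq> I" "finite J'" "J' \<subseteq> I"
      moreover have "c J \<inter> c J' = c (J \<union> J')" by (auto simp: c_def)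
      ultimately show "\<exists>J''. c J \<inter> c J' = c J'' \<and> finite J'' \<and> J'' \<subseteq> I"
        by (intro exI[of _ "J \<union> J'"]) simp
    qed
    show "emeasure P X = emeasure Q X" if "X \<in> ?E" for X
      using that eq unfolding P.emeasure_eq_measure Q.emeasure_eq_measure sp by (auto simp: c_def)
    show "sets P = sigma_sets ?\<Omega> ?E" "sets Q = sigma_sets ?\<Omega> ?E" using P Q gen by auto
    show "range (\<lambda>_. ?\<Omega>) \<subseteq> ?E" by (auto simp: c_def intro!: exI[of _ "{}"])
    show "emeasure P ?\<Omega> \<noteq> \<infinity>" for i :: nat by simp
  qed (use sub in auto)
qed

text \<open>Finite additivity suffices here: countable additivity comes for free from the bound by \<open>\<rho>\<close>.\<close>

definition dominated_additive :: "'a measure \<Rightarrow> 'a measure \<Rightarrow> ('a set \<Rightarrow> real) \<Rightarrow> bool" where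
  "dominated_additive X \<rho> \<nu> \<longleftrightarrow> (\<forall>A\<in>sets X. 0 \<le> \<nu> A \<and> \<nu> A \<le> measure \<rho> A) \<and>
     (\<forall>A\<in>sets X. \<forall>B\<in>sets X. A \<inter> B = {} \<longrightarrow> \<nu> (A \<union> B) = \<nu> A + \<nu> B)"

text \<open>Setwise limits of measures are not well behaved on a whole \<open>\<sigma>\<close>-algebra in general; a common bound by a finite
measure makes the tails of a countable disjoint union uniformly small, and then the usual Dynkin
argument goes through.\<close>

lemma dominated_limit_extends:
  assumes \<rho>: "finite_measure \<rho>" "sets \<rho> = sets X"
    and gen: "sets X = sigma_sets (space X) G" "G \<subseteq> Pow (space X)" "Int_stable G" "space X \<in> G"
    and \<nu>: "eventually (\<lambda>s. dominated_additive X \<rho> (\<nu> s)) U" "dominated_additive X \<rho> \<kappa>"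
    and lim: "\<And>A. A \<in> G \<Longrightarrow> ((\<lambda>s. \<nu> s A) \<longlongrightarrow> \<kappa> A) U"
    and A: "A \<in> sets X"
  shows "((\<lambda>s. \<nu> s A) \<longlongrightarrow> \<kappa> A) U"
proof -
  interpret \<rho>: finite_measure \<rho> by fact
  have bound: "0 \<le> \<mu> A" "\<mu> A \<le> measure \<rho> A" if "dominated_additive X \<rho> \<mu>" "A \<in> sets X" for \<mu> A
    using that by (auto simp: dominated_additive_def)
  have add: "\<mu> (A \<union> B) = \<mu> A + \<mu> B"
    if "dominated_additive X \<rho> \<mu>" "A \<in> sets X" "B \<in> sets X" "A \<inter> B = {}" for \<mu> A B
    using that by (auto simp: dominated_additive_def)
  have sX: "B \<in> sets X" if "B \<in> sigma_sets (space X) G" for B using gen(1) that by simp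
  have "A \<in> sigma_sets (space X) G" using A gen(1) by simp
  with gen(3,2) show ?thesis
  proof (induction rule: sigma_sets_induct_disjoint)
    case (basic A)
    then show ?case by (rule lim)
  next
    case empty
    have "\<mu> {} = 0" if "dominated_additive X \<rho> \<mu>" for \<mu> using bound[OF that, of "{}"] by simp
    then have 0: "\<kappa> {} = 0" "eventually (\<lambda>s. 0 = \<nu> s {}) U" using \<nu> by (auto elim: eventually_mono)
    show ?case unfolding 0(1) by (rule Lim_transform_eventually[OF tendsto_const 0(2)])
  next
    case (compl A)
    have eq: "\<mu> (space X - A) = \<mu> (space X) - \<mu> A" if "dominated_additive X \<rho> \<mu>" for \<mu>
    proof -
      have "A \<union> (space X - A) = space X" using sX[OF compl(1)] sets.sets_into_space by blast
      then show ?thesis using add[OF that sX[OF compl(1)], of "space X - A"] sX[OF compl(1)] by auto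
    qed
    have "eventually (\<lambda>s. \<nu> s (space X) - \<nu> s A = \<nu> s (space X - A)) U"
      using \<nu>(1) by eventually_elim (simp add: eq)
    moreover have "((\<lambda>s. \<nu> s (space X) - \<nu> s A) \<longlongrightarrow> \<kappa> (space X) - \<kappa> A) U"
      by (intro tendsto_diff lim gen(4) compl(2))
    ultimately show ?case
      unfolding eq[OF \<nu>(2)] by (rule Lim_transform_eventually[rotated])
  next
    case (union A)
    have AX: "A i \<in> sets X" for i using sX union(2) by auto
    define H where "H n = (\<Union>i<n. A i)" for n
    define R where "R n = (\<Union>i. A (i + n))" for n
    have HX: "H n \<in> sets X" and RX: "R n \<in> sets X" for n using AX by (auto simp: H_def R_def)
    have HR: "H n \<union> R n = (\<Union>i. A i)" for n
    proof -
      have "A i \<subseteq> H n \<union> R n" for i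
      proof (cases "i < n")
        case False
        then have "A i = A ((i - n) + n)" by simp
        then show ?thesis unfolding R_def by blast
      qed (auto simp: H_def)
      then show ?thesis by (auto simp: H_def R_def)
    qed
    have disj: "H n \<inter> R n = {}" for n
    proof -
      have "A i \<inter> A (j + n) = {}" if "i < n" for i j
        using union(1) that unfolding disjoint_family_on_def by auto
      then show ?thesis unfolding H_def R_def by blast
    qed
    have split: "\<mu> (\<Union>i. A i) = \<mu> (H n) + \<mu> (R n)" if "dominated_additive X \<rho> \<mu>" for \<mu> n
      using add[OF that HX RX disj, of n] HR by simp
    have Hsum: "\<mu> (H n) = (\<Sum>i<n. \<mu> (A i))" if m: "dominated_additive X \<rho> \<mu>" for \<mu> n
    proof (induction n)
      case 0
      then show ?case using bound[OF m, of "{}"] by (simp add: H_def)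
    next
      case (Suc n)
      have "A i \<inter> A n = {}" if "i < n" for i
        using union(1) that unfolding disjoint_family_on_def by auto
      then have "H n \<inter> A n = {}" unfolding H_def by blast
      moreover have "H (Suc n) = H n \<union> A n" by (auto simp: H_def less_Suc_eq)
      ultimately show ?case using add[OF m HX AX, of n n] Suc by simp
    qed
    have limH: "((\<lambda>s. \<nu> s (H n)) \<longlongrightarrow> \<kappa> (H n)) U" for n
    proof -
      have "((\<lambda>s. \<Sum>i<n. \<nu> s (A i)) \<longlongrightarrow> (\<Sum>i<n. \<kappa> (A i))) U" by (intro tendsto_sum union(3))
      moreover have "eventually (\<lambda>s. (\<Sum>i<n. \<nu> s (A i)) = \<nu> s (H n)) U"
        using \<nu>(1) by eventually_elim (simp add: Hsum)
      ultimately show ?thesis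
        unfolding Hsum[OF \<nu>(2)] by (rule Lim_transform_eventually)
    qed
    have "(\<lambda>n. measure \<rho> (R n)) \<longlonglongrightarrow> measure \<rho> (\<Inter>n. R n)"
    proof (rule \<rho>.finite_Lim_measure_decseq)
      show "range R \<subseteq> sets \<rho>" using RX \<rho>(2) by auto
      show "decseq R" unfolding R_def
      proof (rule decseq_SucI)
        fix n
        have "A (i + Suc n) = A (Suc i + n)" for i by simp
        then show "(\<Union>i. A (i + Suc n)) \<subseteq> (\<Union>i. A (i + n))" by blast
      qed
    qed
    moreover have "(\<Inter>n. R n) = {}"
    proof (rule ccontr)
      assume "(\<Inter>n. R n) \<noteq> {}"
      then obtain x where x: "\<And>n. x \<in> R n" by blast
      then obtain i where "x \<in> A i" by (auto simp: R_def)
      then have "x \<in> H (Suc i)" by (auto simp: H_def)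
      then show False using x[of "Suc i"] disj by blast
    qed
    ultimately have R0: "(\<lambda>n. measure \<rho> (R n)) \<longlonglongrightarrow> 0" by simp
    show ?case
    proof (rule tendstoI)
      fix e :: real assume e: "0 < e"
      then obtain n where n: "measure \<rho> (R n) < e / 2"
        using order_tendstoD(2)[OF R0, of "e/2"] by (auto simp: eventually_sequentially)
      have "eventually (\<lambda>s. dist (\<nu> s (H n)) (\<kappa> (H n)) < e / 2) U"
        using tendstoD[OF limH, of "e/2"] e by simp
      with \<nu>(1) show "eventually (\<lambda>s. dist (\<nu> s (\<Union>i. A i)) (\<kappa> (\<Union>i. A i)) < e) U"
      proof eventually_elim
        fix s assume s: "dominated_additive X \<rho> (\<nu> s)" and d: "dist (\<nu> s (H n)) (\<kappa> (H n)) < e / 2"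
        have "\<bar>\<nu> s (R n) - \<kappa> (R n)\<bar> \<le> measure \<rho> (R n)"
          using bound[OF s RX[of n]] bound[OF \<nu>(2) RX[of n]] by linarith
        then show "dist (\<nu> s (\<Union>i. A i)) (\<kappa> (\<Union>i. A i)) < e"
          using d n split[OF s, of n] split[OF \<nu>(2), of n] unfolding dist_real_def by linarith
      qed
    qed
  qed
qed

lemma sets_Collect_finite_mem:
  assumes "finite J" "\<And>i. i \<in> J \<Longrightarrow> f i \<in> measurable N X" "\<And>i. i \<in> J \<Longrightarrow> A i \<in> sets X"
  shows "{x \<in> space N. \<forall>i\<in>J. f i x \<in> A i} \<in> sets N"
proof -
  have "{x \<in> space N. f i x \<in> A i} \<in> sets N" if "i \<in> J" for i
    using measurable_sets[OF assms(2)[OF that] assms(3)[OF that]]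
    by (simp add: vimage_def Int_def conj_commute)
  then show ?thesis using assms(1) by (rule sets.sets_Collect_finite_All)
qed

text \<open>Because the one-dimensional distributions do not depend on \<open>s\<close>, no mass escapes in the limit, and the convergence
holds for all measurable sets instead of only for continuity sets of some topology. The law is
constructed on codes by bits. Convergence is immediate for the sets that are given by finitely many bits, and
is extended to arbitrary sets one coordinate at a time by domination.\<close>

lemma ultralimit_of_laws:
  fixes \<xi> :: "'s \<Rightarrow> 'i \<Rightarrow> 'w \<Rightarrow> 'a" and X :: "'a measure"
  assumes M: "prob_space M" and X: "standard_borel X" "space X \<noteq> {}"
    and U: "ultrafilter U" "U \<le> principal S"
    and \<xi>: "\<And>s i. s \<in> S \<Longrightarrow> i \<in> I \<Longrightarrow> \<xi> s i \<in> measurable M X"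
    and law: "\<And>s i. s \<in> S \<Longrightarrow> i \<in> I \<Longrightarrow> distr M X (\<xi> s i) = \<rho> i"
  obtains Q where "prob_space Q" "sets Q = sets (Pi\<^sub>M I (\<lambda>_. X))"
    "\<And>F. finite F \<Longrightarrow> F \<subseteq> I \<times> sets X \<Longrightarrow>
      ((\<lambda>s. measure M {\<omega> \<in> space M. \<forall>(i, A)\<in>F. \<xi> s i \<omega> \<in> A})
        \<longlongrightarrow> measure Q {x \<in> space Q. \<forall>(i, A)\<in>F. x i \<in> A}) U"
proof -
  interpret M: prob_space M by fact
  have Ubot: "U \<noteq> bot" using U by (simp add: ultrafilter_def)
  have US: "eventually (\<lambda>s. s \<in> S) U" using U(2) by (simp add: le_principal)
  have "S \<noteq> {}" using Ubot U(2) by (auto simp: bot_unique)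
  then obtain s0 where s0: "s0 \<in> S" by blast
  have \<rho>_eq: "measure (\<rho> i) A = measure M {\<omega> \<in> space M. \<xi> s i \<omega> \<in> A}"
    if "s \<in> S" "i \<in> I" "A \<in> sets X" for s i A
    unfolding law[OF that(1,2), symmetric]
    by (subst measure_distr[OF \<xi>[OF that(1,2)] that(3)]) (auto intro!: arg_cong[of _ _ "measure M"])
  have \<rho>: "prob_space (\<rho> i)" "sets (\<rho> i) = sets X" if "i \<in> I" for i
    unfolding law[OF s0 that, symmetric] using M.prob_space_distr[OF \<xi>[OF s0 that]] by auto
  obtain B :: "nat \<Rightarrow> 'a set" and g where B: "\<And>n. B n \<in> sets X"
    and g: "g \<in> measurable (bits UNIV) X" and gB: "\<And>x. x \<in> space X \<Longrightarrow> g (\<lambda>n. x \<in> B n) = x"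
    using standard_borel_bit_coding[OF X] by blast
  define K where "K s = (\<lambda>(i, n). {\<omega> \<in> space M. \<xi> s i \<omega> \<in> B n})" for s
  have Km: "K s j \<in> sets M" if "s \<in> S" "j \<in> I \<times> UNIV" for s j
    using measurable_sets[OF \<xi> B, of s "fst j" "snd j"] that
    by (auto simp: K_def split_beta vimage_def Int_def conj_commute)
  obtain R where R: "prob_space R" "sets R = sets (bits (I \<times> UNIV))"
    and Rlim: "\<And>J. finite J \<Longrightarrow> J \<subseteq> I \<times> UNIV \<Longrightarrow>
      ((\<lambda>s. measure M {\<omega> \<in> space M. \<forall>j\<in>J. \<omega> \<in> K s j}) \<longlongrightarrow> measure R {z \<in> space R. \<forall>j\<in>J. z j}) U"
    by (rule bits_limit[of M U S "I \<times> UNIV" K, OF M U Km]) blast+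
  interpret R: prob_space R by fact
  have spR: "space R = Pi\<^sub>E (I \<times> UNIV) (\<lambda>_. UNIV)"
    using sets_eq_imp_space_eq[OF R(2)] by (simp add: space_PiM)
  have Rcomp: "(\<lambda>z. z (i, n)) \<in> measurable R (count_space UNIV)" if "i \<in> I" for i n
    unfolding measurable_cong_sets[OF R(2) refl] using that by (intro measurable_component_singleton) simp
  define b where "b i z = (\<lambda>n :: nat. z (i, n) :: bool)" for i :: 'i and z
  have bm: "b i \<in> measurable R (bits UNIV)" if "i \<in> I" for i
    by (rule measurable_PiM_single') (use Rcomp[OF that] in \<open>auto simp: b_def space_PiM\<close>)
  \<comment> \<open>The bits at \<open>i\<close> have the distribution of the code of a \<open>\<rho> i\<close>-random point. Hence they almost surely form a genuine code.\<close>
  have code: "AE z in R. \<forall>n. z (i, n) = (g (b i z) \<in> B n)" if i: "i \<in> I" for i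
  proof -
    let ?c = "\<lambda>x n. x \<in> B n"
    have cm: "?c \<in> measurable (\<rho> i) (bits UNIV)"
    proof (rule measurable_PiM_single')
      show "(\<lambda>x. x \<in> B n) \<in> measurable (\<rho> i) (count_space UNIV)" for n
        using B \<rho>(2)[OF i] by (simp add: pred_def) (metis Int_absorb1 Int_def sets.sets_into_space sets_eq_imp_space_eq Collect_mem_eq)
    qed (auto simp: space_PiM)
    have "distr R (bits UNIV) (b i) = distr (\<rho> i) (bits UNIV) ?c"
    proof (rule bits_law_eqI)
      show "prob_space (distr R (bits UNIV) (b i))" "prob_space (distr (\<rho> i) (bits UNIV) ?c)"
        using R.prob_space_distr[OF bm[OF i]] prob_space.prob_space_distr[OF \<rho>(1)[OF i] cm] by auto
      fix J :: "nat set" assume J: "finite J"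
      have Jm: "{z \<in> space (bits UNIV). \<forall>j\<in>J. z j} \<in> sets (bits (UNIV :: nat set))"
        using J by measurable
      have "measure (distr R (bits UNIV) (b i)) {z \<in> space (bits UNIV). \<forall>j\<in>J. z j}
          = measure R {z \<in> space R. \<forall>j\<in>Pair i ` J. z j}"
        by (subst measure_distr[OF bm[OF i] Jm]) (auto simp: b_def space_PiM intro!: arg_cong[of _ _ "measure R"])
      also have "\<dots> = measure (\<rho> i) {x \<in> space (\<rho> i). \<forall>n\<in>J. x \<in> B n}"
      proof (rule tendsto_unique[OF Ubot Rlim])
        have "eventually (\<lambda>s. measure (\<rho> i) {x \<in> space (\<rho> i). \<forall>n\<in>J. x \<in> B n}
            = measure M {\<omega> \<in> space M. \<forall>j\<in>Pair i ` J. \<omega> \<in> K s j}) U"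
          using US
        proof eventually_elim
          fix s assume s: "s \<in> S"
          have "{x \<in> space X. \<forall>n\<in>J. x \<in> B n} \<in> sets X"
          proof -
            note [measurable] = B
            show ?thesis using J by measurable
          qed
          moreover have "space (\<rho> i) = space X" using \<rho>(2)[OF i] by (rule sets_eq_imp_space_eq)
          ultimately show "measure (\<rho> i) {x \<in> space (\<rho> i). \<forall>n\<in>J. x \<in> B n}
            = measure M {\<omega> \<in> space M. \<forall>j\<in>Pair i ` J. \<omega> \<in> K s j}"
            using \<rho>_eq[OF s i] measurable_space[OF \<xi>[OF s i]]
            by (auto simp: K_def intro!: arg_cong[of _ _ "measure M"])
        qed
        then show "((\<lambda>s. measure M {\<omega> \<in> space M. \<forall>j\<in>Pair i ` J. \<omega> \<in> K s j})
            \<longlongrightarrow> measure (\<rho> i) {x \<in> space (\<rho> i). \<forall>n\<in>J. x \<in> B n}) U"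
          by (rule Lim_transform_eventually[OF tendsto_const])
      qed (use J i in auto)
      also have "\<dots> = measure (distr (\<rho> i) (bits UNIV) ?c) {z \<in> space (bits UNIV). \<forall>j\<in>J. z j}"
        by (subst measure_distr[OF cm Jm]) (auto simp: space_PiM intro!: arg_cong[of _ _ "measure (\<rho> i)"])
      finally show "measure (distr R (bits UNIV) (b i)) {z \<in> space (distr R (bits UNIV) (b i)). \<forall>j\<in>J. z j}
          = measure (distr (\<rho> i) (bits UNIV) ?c) {z \<in> space (distr (\<rho> i) (bits UNIV) ?c). \<forall>j\<in>J. z j}"
        by simp
    qed auto
    moreover have P: "{z \<in> space (bits UNIV). \<forall>n. z n = (g z \<in> B n)} \<in> sets (bits UNIV)"
    proof -
      note [measurable] = B g
      show ?thesis by measurable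
    qed
    have "AE z in distr (\<rho> i) (bits UNIV) ?c. \<forall>n. z n = (g z \<in> B n)"
      unfolding AE_distr_iff[OF cm P]
      using gB sets_eq_imp_space_eq[OF \<rho>(2)[OF i]] by (intro AE_I2) simp
    ultimately have "AE z in distr R (bits UNIV) (b i). \<forall>n. z n = (g z \<in> B n)" by (simp only:)
    then show ?thesis unfolding AE_distr_iff[OF bm[OF i] P] by (simp add: b_def)
  qed
  define \<gamma> where "\<gamma> z = (\<lambda>i\<in>I. g (b i z))" for z
  have \<gamma>m: "\<gamma> \<in> measurable R (Pi\<^sub>M I (\<lambda>_. X))"
    unfolding \<gamma>_def by (intro measurable_restrict measurable_compose[OF bm g])
  define Q where "Q = distr R (Pi\<^sub>M I (\<lambda>_. X)) \<gamma>"
  have Q: "prob_space Q" "sets Q = sets (Pi\<^sub>M I (\<lambda>_. X))"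
    unfolding Q_def using R.prob_space_distr[OF \<gamma>m] by auto
  interpret Q: prob_space Q by fact
  have spQ: "space Q = space (Pi\<^sub>M I (\<lambda>_. X))" using Q(2) by (rule sets_eq_imp_space_eq)
  have comp: "(\<lambda>x. x i) \<in> measurable (Pi\<^sub>M I (\<lambda>_. X)) X" if "i \<in> J" "J \<subseteq> I" for i J
    using that by (intro measurable_component_singleton) auto
  \<comment> \<open>The sets described by finitely many bits.\<close>
  define G where "G = {{x \<in> space X. \<forall>n\<in>L. x \<in> B n} | L. finite L}"
  have G_sub: "G \<subseteq> sets X"
  proof -
    note [measurable] = B
    have "{x \<in> space X. \<forall>n\<in>L. x \<in> B n} \<in> sets X" if "finite L" for L using that by measurable
    then show ?thesis by (auto simp: G_def)
  qed
  have G_Int: "Int_stable G"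
  proof (rule Int_stableI)
    fix A A' assume "A \<in> G" "A' \<in> G"
    then obtain L L' where "A = {x \<in> space X. \<forall>n\<in>L. x \<in> B n}" "finite L"
      "A' = {x \<in> space X. \<forall>n\<in>L'. x \<in> B n}" "finite L'" by (auto simp: G_def)
    then show "A \<inter> A' \<in> G" unfolding G_def by (intro CollectI exI[of _ "L \<union> L'"]) auto
  qed
  have G_space: "space X \<in> G" unfolding G_def by (intro CollectI exI[of _ "{}"]) auto
  have G_gen: "sets X = sigma_sets (space X) G"
  proof (rule antisym)
    show "sigma_sets (space X) G \<subseteq> sets X" by (rule sets.sigma_sets_subset[OF G_sub])
    have G_Pow: "G \<subseteq> Pow (space X)" using G_sub sets.space_closed by blast
    let ?N = "sigma (space X) G"
    have N: "sets ?N = sigma_sets (space X) G" "space ?N = space X" using G_Pow by auto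
    have "(\<lambda>x n. x \<in> B n) \<in> measurable ?N (bits UNIV)"
    proof (rule measurable_PiM_single')
      fix n
      have "{x \<in> space X. x \<in> B n} \<in> G" unfolding G_def by (intro CollectI exI[of _ "{n}"]) auto
      then show "(\<lambda>x. x \<in> B n) \<in> measurable ?N (count_space UNIV)"
        unfolding pred_def N by (rule sigma_sets.Basic)
    qed (auto simp: space_PiM)
    then have gc: "(\<lambda>x. g (\<lambda>n. x \<in> B n)) \<in> measurable ?N X" by (rule measurable_compose[OF _ g])
    show "sets X \<subseteq> sigma_sets (space X) G"
    proof
      fix A assume A: "A \<in> sets X"
      have "A = (\<lambda>x. g (\<lambda>n. x \<in> B n)) -` A \<inter> space ?N"
        using gB sets.sets_into_space[OF A] N(2) by auto
      then show "A \<in> sigma_sets (space X) G" using measurable_sets[OF gc A] N(1) by simp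
    qed
  qed
  define m where "m s J A = measure M {\<omega> \<in> space M. \<forall>i\<in>J. \<xi> s i \<omega> \<in> A i}" for s J and A :: "'i \<Rightarrow> 'a set"
  define m0 where "m0 J A = measure Q {x \<in> space Q. \<forall>i\<in>J. x i \<in> A i}" for J and A :: "'i \<Rightarrow> 'a set"
  have m_nonneg: "0 \<le> m s J A" "0 \<le> m0 J A" for s J A by (simp_all add: m_def m0_def)
  have base: "((\<lambda>s. m s J A) \<longlongrightarrow> m0 J A) U" if J: "finite J" "J \<subseteq> I" and A: "\<And>i. i \<in> J \<Longrightarrow> A i \<in> G" for J A
  proof -
    have "\<forall>i\<in>J. \<exists>L. A i = {x \<in> space X. \<forall>n\<in>L. x \<in> B n} \<and> finite L" using A by (auto simp: G_def)
    from bchoice[OF this] obtain L where L: "\<And>i. i \<in> J \<Longrightarrow> A i = {x \<in> space X. \<forall>n\<in>L i. x \<in> B n}"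
        "\<And>i. i \<in> J \<Longrightarrow> finite (L i)"
      by blast
    let ?J = "Sigma J L"
    have sub: "?J \<subseteq> I \<times> UNIV" using J(2) by auto
    have fin: "finite ?J" using J(1) L(2) by auto
    have AX: "A i \<in> sets X" if "i \<in> J" for i using A[OF that] G_sub by blast
    have Qs: "{x \<in> space Q. \<forall>i\<in>J. x i \<in> A i} \<in> sets (Pi\<^sub>M I (\<lambda>_. X))"
      unfolding spQ by (rule sets_Collect_finite_mem[OF J(1) comp[OF _ J(2)] AX])
    have "m0 J A = measure R {z \<in> space R. \<forall>j\<in>?J. z j}"
    proof -
      have "m0 J A = measure R (\<gamma> -` {x \<in> space Q. \<forall>i\<in>J. x i \<in> A i} \<inter> space R)"
        unfolding m0_def by (subst Q_def, rule measure_distr[OF \<gamma>m Qs])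
      also have "\<dots> = measure R {z \<in> space R. \<forall>j\<in>?J. z j}"
      proof (rule R.finite_measure_eq_AE)
        have "AE z in R. \<forall>i\<in>J. \<forall>n. z (i, n) = (g (b i z) \<in> B n)"
          using J code by (intro AE_finite_allI) auto
        moreover have "AE z in R. z \<in> space R" by (rule AE_space)
        ultimately show "AE z in R. (z \<in> \<gamma> -` {x \<in> space Q. \<forall>i\<in>J. x i \<in> A i} \<inter> space R)
            = (z \<in> {z \<in> space R. \<forall>j\<in>?J. z j})"
        proof eventually_elim
          fix z assume z: "\<forall>i\<in>J. \<forall>n. z (i, n) = (g (b i z) \<in> B n)" "z \<in> space R"
          have "\<gamma> z \<in> space Q" using measurable_space[OF \<gamma>m z(2)] spQ by simp
          moreover have "\<gamma> z i \<in> A i \<longleftrightarrow> (\<forall>n\<in>L i. z (i, n))" if i: "i \<in> J" for i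
          proof -
            have iI: "i \<in> I" using i J(2) by blast
            have "g (b i z) \<in> space X" using measurable_space[OF measurable_compose[OF bm[OF iI] g] z(2)] .
            then show ?thesis using z(1) i iI L(1)[OF i] by (simp add: \<gamma>_def)
          qed
          ultimately show "(z \<in> \<gamma> -` {x \<in> space Q. \<forall>i\<in>J. x i \<in> A i} \<inter> space R)
            = (z \<in> {z \<in> space R. \<forall>j\<in>?J. z j})" using z(2) by auto
        qed
        show "\<gamma> -` {x \<in> space Q. \<forall>i\<in>J. x i \<in> A i} \<inter> space R \<in> R.events" by (rule measurable_sets[OF \<gamma>m Qs])
        have "Measurable.pred R (\<lambda>z. z j)" if "j \<in> ?J" for j using that sub Rcomp by (cases j) auto
        then show "{z \<in> space R. \<forall>j\<in>?J. z j} \<in> R.events" using fin by measurable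
      qed
      finally show ?thesis .
    qed
    moreover have "eventually (\<lambda>s. measure M {\<omega> \<in> space M. \<forall>j\<in>?J. \<omega> \<in> K s j} = m s J A) U"
      using US
    proof eventually_elim
      fix s assume s: "s \<in> S"
      have "\<xi> s i \<omega> \<in> space X" if "i \<in> J" "\<omega> \<in> space M" for i \<omega>
        using measurable_space[OF \<xi>[OF s] that(2), of i] that(1) J(2) by blast
      then show "measure M {\<omega> \<in> space M. \<forall>j\<in>?J. \<omega> \<in> K s j} = m s J A"
        unfolding m_def using L(1) by (intro arg_cong[of _ _ "measure M"]) (auto simp: K_def)
    qed
    ultimately show ?thesis using Lim_transform_eventually[OF Rlim[OF fin sub]] by simp
  qed
  \<comment> \<open>Here \<open>D\<close> is the set of coordinates at which the sets are already arbitrary.\<close>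
  have gen: "((\<lambda>s. m s J A) \<longlongrightarrow> m0 J A) U"
    if J: "finite J" "J \<subseteq> I" and D: "finite D" and A: "\<And>i. i \<in> J \<Longrightarrow> A i \<in> sets X" "\<And>i. i \<in> J - D \<Longrightarrow> A i \<in> G" for J D A
    using D A
  proof (induction D arbitrary: A)
    case empty
    then show ?case by (intro base J) auto
  next
    case (insert i0 D)
    show ?case
    proof (cases "i0 \<in> J")
      case False
      then show ?thesis using insert.prems by (intro insert.IH) auto
    next
      case True
      then have iI: "i0 \<in> I" using J(2) by blast
      have meas: "{\<omega> \<in> space M. \<forall>i\<in>J. \<xi> s i \<omega> \<in> A' i} \<in> sets M" if "s \<in> S" "\<And>i. i \<in> J \<Longrightarrow> A' i \<in> sets X" for s A'
        by (rule sets_Collect_finite_mem[OF J(1) \<xi>[OF that(1)] that(2)]) (use J(2) in auto)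
      have meas0: "{x \<in> space Q. \<forall>i\<in>J. x i \<in> A' i} \<in> sets Q" if "\<And>i. i \<in> J \<Longrightarrow> A' i \<in> sets X" for A'
        unfolding spQ Q(2) by (rule sets_Collect_finite_mem[OF J(1) comp[OF _ J(2)] that])
      have upd: "(A(i0 := C)) i \<in> sets X" if "C \<in> sets X" "i \<in> J" for C i
        using that insert.prems(1) by simp
      have "((\<lambda>s. m s J (A(i0 := A i0))) \<longlongrightarrow> m0 J (A(i0 := A i0))) U"
      proof (rule dominated_limit_extends[where \<rho> = "\<rho> i0" and X = X and G = G and \<nu> = "\<lambda>s C. m s J (A(i0 := C))" and \<kappa> = "\<lambda>C. m0 J (A(i0 := C))" and A = "A i0"])
        show "finite_measure (\<rho> i0)" using \<rho>(1)[OF iI] by (rule prob_space.finite_measure)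
        show "G \<subseteq> Pow (space X)" using G_sub sets.space_closed by blast
        have "m s J (A(i0 := C \<union> C')) = m s J (A(i0 := C)) + m s J (A(i0 := C'))"
          if "s \<in> S" "C \<in> sets X" "C' \<in> sets X" "C \<inter> C' = {}" for s C C'
        proof -
          have "{\<omega> \<in> space M. \<forall>i\<in>J. \<xi> s i \<omega> \<in> (A(i0 := C \<union> C')) i}
            = {\<omega> \<in> space M. \<forall>i\<in>J. \<xi> s i \<omega> \<in> (A(i0 := C)) i} \<union> {\<omega> \<in> space M. \<forall>i\<in>J. \<xi> s i \<omega> \<in> (A(i0 := C')) i}"
            by auto
          then show ?thesis unfolding m_def using that True
            by (simp only:) (intro M.finite_measure_Union meas upd, auto)
        qed
        moreover have "m s J (A(i0 := C)) \<le> measure (\<rho> i0) C" if "s \<in> S" "C \<in> sets X" for s C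
          unfolding \<rho>_eq[OF that(1) iI that(2)] m_def using True measurable_sets[OF \<xi>[OF that(1) iI] that(2)]
          by (intro M.finite_measure_mono) (auto simp: vimage_def Int_def conj_commute dest: bspec[of _ _ i0])
        ultimately have "dominated_additive X (\<rho> i0) (\<lambda>C. m s J (A(i0 := C)))" if "s \<in> S" for s
          unfolding dominated_additive_def using that by (blast intro: m_nonneg)
        with US show "eventually (\<lambda>s. dominated_additive X (\<rho> i0) (\<lambda>C. m s J (A(i0 := C)))) U"
          by (rule eventually_mono)
        have "m0 J (A(i0 := C \<union> C')) = m0 J (A(i0 := C)) + m0 J (A(i0 := C'))"
          if "C \<in> sets X" "C' \<in> sets X" "C \<inter> C' = {}" for C C'
        proof -
          have "{x \<in> space Q. \<forall>i\<in>J. x i \<in> (A(i0 := C \<union> C')) i}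
            = {x \<in> space Q. \<forall>i\<in>J. x i \<in> (A(i0 := C)) i} \<union> {x \<in> space Q. \<forall>i\<in>J. x i \<in> (A(i0 := C')) i}"
            by auto
          then show ?thesis unfolding m0_def using that True
            by (simp only:) (intro Q.finite_measure_Union meas0 upd, auto)
        qed
        moreover have "m0 J (A(i0 := C)) \<le> measure (\<rho> i0) C" if C: "C \<in> sets X" for C
        proof -
          have "m0 {i0} (\<lambda>_. D) = measure (\<rho> i0) D" if "D \<in> G" for D
          proof (rule tendsto_unique[OF Ubot base])
            have DX: "D \<in> sets X" using that G_sub by blast
            have "eventually (\<lambda>s. measure (\<rho> i0) D = m s {i0} (\<lambda>_. D)) U"
              using US by eventually_elim (simp add: m_def \<rho>_eq[OF _ iI DX])
            then show "((\<lambda>s. m s {i0} (\<lambda>_. D)) \<longlongrightarrow> measure (\<rho> i0) D) U"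
              by (rule Lim_transform_eventually[OF tendsto_const])
          qed (use iI that in auto)
          have cm: "(\<lambda>x. x i0) \<in> measurable Q X"
            unfolding measurable_cong_sets[OF Q(2) refl] by (rule measurable_component_singleton[OF iI])
          have Dm: "measure (distr Q X (\<lambda>x. x i0)) D = m0 {i0} (\<lambda>_. D)" if "D \<in> sets X" for D
            by (subst measure_distr[OF cm that]) (auto simp: m0_def intro!: arg_cong[of _ _ "measure Q"])
          interpret D: prob_space "distr Q X (\<lambda>x. x i0)" by (rule Q.prob_space_distr[OF cm])
          interpret \<rho>i: prob_space "\<rho> i0" by (rule \<rho>(1)[OF iI])
          have "distr Q X (\<lambda>x. x i0) = \<rho> i0"
          proof (rule measure_eqI_generator_eq[where E = G and \<Omega> = "space X" and A = "\<lambda>_. space X"])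
            show "G \<subseteq> Pow (space X)" using G_sub sets.space_closed by blast
            show "emeasure (distr Q X (\<lambda>x. x i0)) D = emeasure (\<rho> i0) D" if "D \<in> G" for D
              unfolding D.emeasure_eq_measure \<rho>i.emeasure_eq_measure
              using Dm[of D] \<open>\<And>D. D \<in> G \<Longrightarrow> m0 {i0} (\<lambda>_. D) = measure (\<rho> i0) D\<close>[OF that] that G_sub by auto
          qed (use G_Int G_gen G_space \<rho>(2)[OF iI] in \<open>auto simp: D.emeasure_eq_measure\<close>)
          then have "measure (\<rho> i0) C = m0 {i0} (\<lambda>_. C)" using Dm[OF C] by simp
          moreover have "m0 J (A(i0 := C)) \<le> m0 {i0} (\<lambda>_. C)"
          proof -
            have "{x \<in> space Q. x i0 \<in> C} \<in> sets Q"
              using measurable_sets[OF cm C] by (auto simp: vimage_def Int_def conj_commute)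
            then show ?thesis unfolding m0_def using True
              by (intro Q.finite_measure_mono) (auto dest: bspec[of _ _ i0])
          qed
          ultimately show ?thesis by simp
        qed
        ultimately show "dominated_additive X (\<rho> i0) (\<lambda>C. m0 J (A(i0 := C)))"
          unfolding dominated_additive_def by (blast intro: m_nonneg)
        show "((\<lambda>s. m s J (A(i0 := C))) \<longlongrightarrow> m0 J (A(i0 := C))) U" if "C \<in> G" for C
          using that G_sub insert.prems by (intro insert.IH) auto
      qed (use True insert.prems G_gen G_Int G_space \<rho>(2)[OF iI] in auto)
      then show ?thesis by simp
    qed
  qed
  show thesis
  proof (rule that[OF Q])
    fix F assume F: "finite F" "F \<subseteq> I \<times> sets X"
    define J where "J = fst ` F"
    define A where "A i = (\<Inter>C\<in>{C. (i, C) \<in> F}. C)" for i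
    have J: "finite J" "J \<subseteq> I" using F by (auto simp: J_def)
    have finC: "finite {C. (i, C) \<in> F}" for i
      by (rule finite_subset[of _ "snd ` F"]) (use F(1) in force)+
    have "A i \<in> sets X" if "i \<in> J" for i
      unfolding A_def using that F(2) finC by (intro sets.finite_INT) (auto simp: J_def)
    then have "((\<lambda>s. m s J A) \<longlongrightarrow> m0 J A) U" by (intro gen[OF J, of J]) (use J in auto)
    moreover have "(\<forall>i\<in>J. f i \<in> A i) = (\<forall>(i, C)\<in>F. f i \<in> C)" for f :: "'i \<Rightarrow> 'a"
      unfolding J_def A_def by force
    ultimately show "((\<lambda>s. measure M {\<omega> \<in> space M. \<forall>(i, A)\<in>F. \<xi> s i \<omega> \<in> A})
        \<longlongrightarrow> measure Q {x \<in> space Q. \<forall>(i, A)\<in>F. x i \<in> A}) U"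
      by (simp add: m_def m0_def)
  qed
qed

section \<open>Replacing letters in words\<close>

lemma length_subst [simp]: "length (subst c r) = length r" by (simp add: subst_def)

lemma nth_concat_map_upt:
  assumes "i < n" "q < length (f i)"
  shows "concat (map f [0..<n]) ! (length (concat (map f [0..<i])) + q) = f i ! q"
proof -
  have "[0..<n] = [0..<i] @ i # [Suc i..<n]"
    using assms(1) by (metis less_imp_add_positive upt_add_eq_append upt_conv_Cons zero_le add_diff_cancel_left' less_add_same_cancel1 le_add1)
  then show ?thesis using assms(2) by (simp add: nth_append)
qed

lemma act_words:
  assumes \<sigma>: "\<And>i. \<sigma> i \<in> var_words k" and v: "v \<in> words k"
  shows "act \<sigma> v \<in> words k"
proof -
  have nth: "v ! i \<in> {1..k}" if "i < length v" for i using v nth_mem[OF that] by (auto simp: words_def)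
  have ne: "v \<noteq> []" using v by (simp add: words_def)
  have "subst (v ! i) (\<sigma> i) \<noteq> [] \<and> set (subst (v ! i) (\<sigma> i)) \<subseteq> {1..k}" if "i < length v" for i
    using \<sigma>[of i] nth[OF that] by (force simp: subst_def var_words_def)
  then show ?thesis using ne unfolding words_def act_def by fastforce
qed

text \<open>The \<open>i\<close>-th block of the subspace is the word \<open>\<sigma> i\<close>, whose variable positions are the varying ones.\<close>

lemma act_word_subspace:
  assumes k: "1 \<le> k" and \<sigma>: "\<And>i. \<sigma> i \<in> var_words k"
  shows "word_subspace k (act \<sigma>)"
proof -
  define N where "N n = length (concat (map \<sigma> [0..<n]))" for n
  define I where "I n = (case n of 0 \<Rightarrow> {} | Suc i \<Rightarrow> {N i + Suc q | q. q < length (\<sigma> i) \<and> \<sigma> i ! q = 0})" for n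
  define w where "w n = act \<sigma> (replicate n 1)" for n
  have N_Suc: "N (Suc i) = N i + length (\<sigma> i)" for i by (simp add: N_def)
  have pos: "0 < length (\<sigma> i)" for i using \<sigma>[of i] by (auto simp: var_words_def)
  have len: "length (act \<sigma> v) = N (length v)" for v
    by (simp add: act_def N_def length_concat o_def)
  have nth: "act \<sigma> v ! (N i + q) = subst (v ! i) (\<sigma> i) ! q" if "i < length v" "q < length (\<sigma> i)" for v i q
  proof -
    have "N i = length (concat (map (\<lambda>i. subst (v ! i) (\<sigma> i)) [0..<i]))"
      by (simp add: N_def length_concat o_def)
    then show ?thesis
      unfolding act_def using nth_concat_map_upt[of i "length v" q "\<lambda>i. subst (v ! i) (\<sigma> i)"] that by simp
  qed
  have "subspace_data k N I w (act \<sigma>)"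
    unfolding subspace_data_def
  proof (intro conjI allI ballI impI)
    show "N 0 = 0" by (simp add: N_def)
    show "strict_mono N" using pos by (simp add: strict_mono_Suc_iff N_Suc)
    fix i
    obtain q where "q < length (\<sigma> i)" "\<sigma> i ! q = 0"
      using \<sigma>[of i] by (auto simp: var_words_def in_set_conv_nth)
    then show "I (Suc i) \<noteq> {}" by (auto simp: I_def)
    show "I (Suc i) \<subseteq> {1..N (Suc i)} - {1..N i}" by (auto simp: I_def N_Suc)
    show "length (w (Suc i)) = N (Suc i)" by (simp add: w_def len)
    have "replicate (Suc i) 1 \<in> words k" using k by (auto simp: words_def)
    from act_words[OF \<sigma> this] show "set (w (Suc i)) \<subseteq> {1..k}" by (simp add: w_def words_def)
  next
    fix v show "length (act \<sigma> v) = N (length v)" by (rule len)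
    fix i m assume i: "i < length v" and "N i < m \<and> m \<le> N (Suc i)"
    then obtain q where q: "m = N i + Suc q" "q < length (\<sigma> i)"
      by (metis N_Suc Suc_le_eq add_Suc_right less_imp_Suc_add nat_add_left_cancel_le)
    have "m \<in> I (Suc i) \<longleftrightarrow> \<sigma> i ! q = 0" using q by (auto simp: I_def)
    moreover have "w (Suc i) ! (m - 1) = subst 1 (\<sigma> i) ! q"
    proof -
      have "replicate (Suc i) 1 ! i = (1 :: nat)" by (simp only: nth_replicate lessI)
      then show ?thesis
        using nth[of i "replicate (Suc i) 1" q] q by (simp add: w_def del: replicate_Suc)
    qed
    moreover have "act \<sigma> v ! (m - 1) = subst (v ! i) (\<sigma> i) ! q"
      using nth[OF i q(2)] q(1) by simp
    ultimately show "act \<sigma> v ! (m - 1) = (if m \<in> I (Suc i) then v ! i else w (Suc i) ! (m - 1))"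
      using q(2) by (simp add: subst_def)
  qed
  then show ?thesis by (auto simp: word_subspace_def)
qed

definition repl :: "nat set \<Rightarrow> nat \<Rightarrow> nat list \<Rightarrow> nat list" where
  "repl e j = map (\<lambda>b. if b \<in> e then j else b)"

lemma repl_words: "u \<in> words k \<Longrightarrow> j \<in> {1..k} \<Longrightarrow> repl e j u \<in> words k"
  by (auto simp: repl_def words_def)

lemma repl_line:
  assumes u: "u \<in> words k" and e: "set u \<inter> e \<noteq> {}"
  shows "comb_line k (\<lambda>a. repl e a u)"
proof -
  let ?I = "{m \<in> {1..length u}. u ! (m - 1) \<in> e}"
  have "line_data k (length u) ?I (\<lambda>m. u ! (m - 1)) (\<lambda>a. repl e a u)"
    unfolding line_data_def
  proof (intro conjI ballI Pi_I)
    show "1 \<le> length u" using u by (cases u) (auto simp: words_def)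
    obtain p where "p < length u" "u ! p \<in> e" using e by (auto simp: in_set_conv_nth)
    then have "Suc p \<in> ?I" by auto
    then show "?I \<noteq> {}" by blast
    fix m assume "m \<in> {1..length u} - ?I"
    then have "u ! (m - 1) \<in> set u" by auto
    then show "u ! (m - 1) \<in> {1..k}" using u by (auto simp: words_def)
  next
    fix i m assume "m \<in> {1..length u}"
    then show "repl e i u ! (m - 1) = (if m \<in> ?I then i else u ! (m - 1))"
      by (auto simp: repl_def)
  qed (auto simp: repl_def)
  then show ?thesis by (auto simp: comb_line_def)
qed

lemma repl_subst:
  assumes "a \<in> insert j e" "b \<in> insert j e" "0 \<notin> e" "j \<noteq> 0"
  shows "repl e j (subst a r) = repl e j (subst b r)"
  using assms by (auto simp: repl_def subst_def)

text \<open>Substituting letters \<open>a\<close> or \<open>b\<close> from \<open>e \<union> {j}\<close> makes no difference after all letters of \<open>e\<close> have been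
replaced by \<open>j\<close>. This is where the insensitivity of the extension comes from.\<close>

lemma repl_act_line:
  assumes l: "comb_line k l" and j: "j \<in> {1..k}" and e: "e \<subseteq> {1..k}" and ab: "a \<in> insert j e" "b \<in> insert j e"
  shows "repl e j (act \<sigma> (l a)) = repl e j (act \<sigma> (l b))"
proof -
  obtain N I w where D: "line_data k N I w l" using l by (auto simp: comb_line_def)
  have abk: "a \<in> {1..k}" "b \<in> {1..k}" using ab j e by auto
  have len: "length (l a) = N" "length (l b) = N" using D abk by (auto simp: line_data_def)
  have "l a ! i = l b ! i \<or> (l a ! i = a \<and> l b ! i = b)" if "i < N" for i
    using D abk that unfolding line_data_def by (metis Suc_le_eq atLeastAtMost_iff diff_Suc_1 le_add1 plus_1_eq_Suc)
  then have *: "repl e j (subst (l a ! i) (\<sigma> i)) = repl e j (subst (l b ! i) (\<sigma> i))" if "i < N" for i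
    using repl_subst[OF ab, of "\<sigma> i"] that e j by (metis atLeastAtMost_iff not_one_le_zero subsetD)
  have "repl e j (concat rs) = concat (map (repl e j) rs)" for rs
    by (induction rs) (auto simp: repl_def)
  then show ?thesis
    unfolding act_def len using * by (auto simp: o_def intro!: arg_cong[of _ _ concat])
qed

text \<open>Replace the letters of \<open>e\<close> one after the other by \<open>i\<close>: each step moves along a line between two letters of
\<open>e\<close>, and an event in \<open>\<Phi>\<^sub>e\<close> does not notice this.\<close>

lemma Phi_repl:
  assumes A: "A \<in> Phi k X \<mu> e" and e: "e \<subseteq> {1..k}" "i \<in> e" and u: "u \<in> words k"
  shows "AE x in \<mu>. x u \<in> A \<longleftrightarrow> x (repl e i u) \<in> A"
proof -
  have "finite e" using e(1) by (rule finite_subset) simp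
  have "D \<subseteq> e \<longrightarrow> (AE x in \<mu>. x u \<in> A \<longleftrightarrow> x (repl D i u) \<in> A)" if "finite D" for D
    using that
  proof (induction D rule: finite_induct)
    case empty
    then show ?case by (simp add: repl_def)
  next
    case (insert c D)
    let ?u = "repl D i u"
    have uk: "?u \<in> words k" using e u by (intro repl_words) auto
    show ?case
    proof
      assume De: "insert c D \<subseteq> e"
      have ins: "repl (insert c D) i u = repl {c} i ?u" by (auto simp: repl_def)
      have "AE x in \<mu>. x ?u \<in> A \<longleftrightarrow> x (repl {c} i ?u) \<in> A"
      proof (cases "c \<in> set ?u")
        case False
        then have "repl {c} i ?u = ?u" unfolding repl_def[of "{c}"] by (intro map_idI) auto
        then show ?thesis by simp
      next
        case True
        then have "comb_line k (\<lambda>a. repl {c} a ?u)" by (intro repl_line[OF uk]) simp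
        then have ae: "AE x in \<mu>. \<forall>a\<in>e. \<forall>b\<in>e. (indicator A (x (repl {c} a ?u)) :: real) = indicator A (x (repl {c} b ?u))"
          using A by (simp add: Phi_def)
        have c: "repl {c} c ?u = ?u" unfolding repl_def[of "{c}"] by (intro map_idI) auto
        have "c \<in> e" using De by simp
        from ae show ?thesis
        proof eventually_elim
          fix x assume "\<forall>a\<in>e. \<forall>b\<in>e. (indicator A (x (repl {c} a ?u)) :: real) = indicator A (x (repl {c} b ?u))"
          then have "(indicator A (x (repl {c} c ?u)) :: real) = indicator A (x (repl {c} i ?u))"
            using \<open>c \<in> e\<close> e(2) by blast
          then show "x ?u \<in> A \<longleftrightarrow> x (repl {c} i ?u) \<in> A"
            unfolding c by (auto simp: indicator_def split: if_splits)
        qed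
      qed
      moreover have "AE x in \<mu>. x u \<in> A \<longleftrightarrow> x ?u \<in> A" using insert De by auto
      ultimately show "AE x in \<mu>. x u \<in> A \<longleftrightarrow> x (repl (insert c D) i u) \<in> A" unfolding ins by eventually_elim simp
    qed
  qed
  then show ?thesis using \<open>finite e\<close> by auto
qed

section \<open>The insensitive extension\<close>

lemma PiM_law_eqI:
  assumes P: "prob_space P" "sets P = sets (Pi\<^sub>M I M)" and Q: "prob_space Q" "sets Q = sets (Pi\<^sub>M I M)"
    and eq: "\<And>J A. finite J \<Longrightarrow> J \<subseteq> I \<Longrightarrow> (\<And>i. i \<in> J \<Longrightarrow> A i \<in> sets (M i)) \<Longrightarrow>
      measure P {x \<in> space P. \<forall>i\<in>J. x i \<in> A i} = measure Q {x \<in> space Q. \<forall>i\<in>J. x i \<in> A i}"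
  shows "P = Q"
proof (rule measure_eqI_PiM_infinite[OF P(2) Q(2)])
  interpret P: prob_space P by fact
  interpret Q: prob_space Q by fact
  show "finite_measure P" by unfold_locales
  fix A J assume J: "finite J" "J \<subseteq> I" and A: "\<And>i. i \<in> J \<Longrightarrow> A i \<in> sets (M i)"
  have "prod_emb I M J (Pi\<^sub>E J A) = {x \<in> space (Pi\<^sub>M I M). \<forall>i\<in>J. x i \<in> A i}"
    by (auto simp: prod_emb_def space_PiM PiE_iff extensional_def)
  then show "emeasure P (prod_emb I M J (Pi\<^sub>E J A)) = emeasure Q (prod_emb I M J (Pi\<^sub>E J A))"
    using eq[OF J A] sets_eq_imp_space_eq[OF P(2)] sets_eq_imp_space_eq[OF Q(2)]
    by (simp add: P.emeasure_eq_measure Q.emeasure_eq_measure)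
qed

text \<open>The decoding \<open>dec 0\<close> recovers the given process and \<open>dec j\<close> the limit of the processes
\<open>w \<mapsto> x(r\<^sub>j(w))\<close>, where \<open>r\<^sub>j\<close> replaces the letters of \<open>e\<close> by \<open>j\<close>. Invariance of \<open>\<mu>\<close> under
subspaces keeps the law of the zeroth component. The last property is the reason for the construction:
at the word \<open>[i]\<close> the components outside \<open>e\<close>, together with the events of \<open>\<Phi>\<^sub>e\<close> in the zeroth
component, reproduce the line marginal. General events in the zeroth component are out of reach, since the words
\<open>act \<sigma> [i]\<close> may contain letters of \<open>e\<close> other than \<open>i\<close>.\<close>

lemma insensitive_extension:
  fixes X :: "'a measure"
  assumes k: "1 \<le> k" and ss: "strongly_stationary k X \<mu>" and e: "e \<subseteq> {1..k}" "i \<in> e"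
  obtains Y :: "real measure" and \<nu> :: "(nat list \<Rightarrow> real) measure" and dec :: "nat \<Rightarrow> real \<Rightarrow> 'a" where
    "strongly_stationary k Y \<nu>" "\<And>j. dec j \<in> measurable Y X" "law_extension k Y \<nu> (dec 0) X \<mu>"
    "\<And>j A. j \<in> {1..k} \<Longrightarrow> A \<in> sets X \<Longrightarrow> dec j -` A \<inter> space Y \<in> Phi k Y \<nu> (insert j e)"
    "\<And>A. A i \<in> Phi k X \<mu> e \<Longrightarrow> (\<And>j. j \<in> {1..k} - e \<Longrightarrow> A j \<in> sets X) \<Longrightarrow>
      measure \<nu> {y \<in> space \<nu>. dec 0 (y [i]) \<in> A i \<and> (\<forall>j\<in>{1..k} - e. dec j (y [i]) \<in> A j)}
      = measure (line_marginal k X \<mu>) {x \<in> space (line_marginal k X \<mu>). \<forall>j\<in>insert i ({1..k} - e). x j \<in> A j}"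
proof -
  have \<mu>: "standard_borel X" "prob_space \<mu>" and sets_\<mu>: "sets \<mu> = sets (word_space k X)"
    using ss by (auto simp: strongly_stationary_def law_def)
  interpret \<mu>: prob_space \<mu> by fact
  have sp_\<mu>: "space \<mu> = space (word_space k X)" using sets_\<mu> by (rule sets_eq_imp_space_eq)
  have w1: "[a] \<in> words k" if "a \<in> {1..k}" for a using that by (simp add: words_def)
  have i: "i \<in> {1..k}" using e by auto
  obtain x0 where "x0 \<in> space \<mu>" using \<mu>.not_empty by blast
  then have "x0 [1] \<in> space X" using sp_\<mu> w1[of 1] k by (auto simp: space_PiM PiE_iff)
  then have Xne: "space X \<noteq> {}" by blast
  have comp: "(\<lambda>x. x u) \<in> measurable \<mu> X" if "u \<in> words k" for u
    unfolding measurable_cong_sets[OF sets_\<mu> refl] using that by (rule measurable_component_singleton)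
  obtain U where U: "ultrafilter U" "U \<le> principal {\<sigma>. \<forall>i. \<sigma> i \<in> var_words k}"
    and stat: "\<And>\<phi> n (G :: (nat list \<Rightarrow> nat list) \<Rightarrow> real) c. word_subspace k \<phi> \<Longrightarrow>
      (\<And>a b. (\<And>v. v \<in> words k \<Longrightarrow> length v \<le> n \<Longrightarrow> a v = b v) \<Longrightarrow> G a = G b) \<Longrightarrow>
      ((\<lambda>\<sigma>. G (act \<sigma>)) \<longlongrightarrow> c) U \<Longrightarrow> ((\<lambda>\<sigma>. G (\<lambda>v. act \<sigma> (\<phi> v))) \<longlongrightarrow> c) U"
    by (rule stationary_ultrafilter[of k]) blast
  have Ubot: "U \<noteq> bot" using U(1) by (simp add: ultrafilter_def)
  let ?S = "{\<sigma>. \<forall>i. \<sigma> i \<in> var_words k}"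
  have US: "eventually (\<lambda>\<sigma>. \<forall>i. \<sigma> i \<in> var_words k) U" using U(2) by (simp add: le_principal)
  \<comment> \<open>Letters start at \<open>1\<close>, so the index \<open>0\<close> is free for the unchanged process.\<close>
  define r where "r j u = (if j = 0 then u else repl e j u)" for j u
  have r_words: "r j u \<in> words k" if "u \<in> words k" "j \<in> {0..k}" for j u
    using that repl_words[of u k j e] by (auto simp: r_def)
  have act_w: "act \<sigma> v \<in> words k" if "\<sigma> \<in> ?S" "v \<in> words k" for \<sigma> v
    using act_words[of \<sigma> k v] that by auto
  define I where "I = words k \<times> {0..k}"
  let ?PI = "Pi\<^sub>M I (\<lambda>_. X)"
  define \<xi> where "\<xi> \<sigma> = (\<lambda>(v, j) (x :: nat list \<Rightarrow> 'a). x (r j (act \<sigma> v)))" for \<sigma>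
  have \<xi>_word: "r j (act \<sigma> v) \<in> words k" if "\<sigma> \<in> ?S" "(v, j) \<in> I" for \<sigma> v j
    using that by (intro r_words act_w) (auto simp: I_def)
  have \<xi>m: "\<xi> \<sigma> q \<in> measurable \<mu> X" if "\<sigma> \<in> ?S" "q \<in> I" for \<sigma> q
    using that \<xi>_word[of \<sigma> "fst q" "snd q"] by (auto simp: \<xi>_def split_beta intro!: comp)
  have \<xi>law: "distr \<mu> X (\<xi> \<sigma> q) = point_marginal X \<mu>" if "\<sigma> \<in> ?S" "q \<in> I" for \<sigma> q
    using point_marginal_eq[OF ss k \<xi>_word[of \<sigma> "fst q" "snd q"]] that by (simp add: \<xi>_def split_beta)
  obtain Q where Q: "prob_space Q" "sets Q = sets ?PI"
    and Qlim: "\<And>F. finite F \<Longrightarrow> F \<subseteq> I \<times> sets X \<Longrightarrow>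
      ((\<lambda>\<sigma>. measure \<mu> {x \<in> space \<mu>. \<forall>(q, A)\<in>F. \<xi> \<sigma> q x \<in> A})
        \<longlongrightarrow> measure Q {x \<in> space Q. \<forall>(q, A)\<in>F. x q \<in> A}) U"
    by (rule ultralimit_of_laws[OF \<mu>(2,1) Xne U \<xi>m \<xi>law]) blast+
  interpret Q: prob_space Q by fact
  have spQ: "space Q = space ?PI" using Q(2) by (rule sets_eq_imp_space_eq)
  have Qcomp: "(\<lambda>x. x q) \<in> measurable Q X" if "q \<in> I" for q
    unfolding measurable_cong_sets[OF Q(2) refl] using that by (rule measurable_component_singleton)
  have Qlim': "((\<lambda>\<sigma>. measure \<mu> {x \<in> space \<mu>. \<forall>q\<in>J. \<xi> \<sigma> (t q) x \<in> F q})
        \<longlongrightarrow> measure Q {x \<in> space Q. \<forall>q\<in>J. x (t q) \<in> F q}) U"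
    if "finite J" "\<And>q. q \<in> J \<Longrightarrow> t q \<in> I" "\<And>q. q \<in> J \<Longrightarrow> F q \<in> sets X" for J F and t :: "'t \<Rightarrow> nat list \<times> nat"
    using Qlim[of "(\<lambda>q. (t q, F q)) ` J"] that by (simp add: image_subset_iff)
  have Qsets: "{x \<in> space Q. \<forall>q\<in>J. x (t q) \<in> F q} \<in> sets Q"
    if "finite J" "\<And>q. q \<in> J \<Longrightarrow> t q \<in> I" "\<And>q. q \<in> J \<Longrightarrow> F q \<in> sets X" for J F and t :: "'t \<Rightarrow> nat list \<times> nat"
    by (rule sets_Collect_finite_mem[of J "\<lambda>q x. x (t q)" Q X]) (use that Qcomp in auto)
  obtain Y :: "real measure" and c :: "(nat \<Rightarrow> 'a) \<Rightarrow> real" and dec :: "nat \<Rightarrow> real \<Rightarrow> 'a" where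
    Y: "standard_borel Y" and c: "c \<in> measurable (Pi\<^sub>M {0..k} (\<lambda>_. X)) Y" and dec: "\<And>j. dec j \<in> measurable Y X"
    and dec_c: "\<And>x j. x \<in> space (Pi\<^sub>M {0..k} (\<lambda>_. X)) \<Longrightarrow> j \<in> {0..k} \<Longrightarrow> dec j (c x) = x j"
    by (rule standard_borel_power_coding[OF \<mu>(1) Xne, of k]) blast
  define enc where "enc x = (\<lambda>v\<in>words k. c (\<lambda>j\<in>{0..k}. x (v, j)))" for x :: "nat list \<times> nat \<Rightarrow> 'a"
  have fib: "(\<lambda>x. \<lambda>j\<in>{0..k}. x (v, j)) \<in> measurable Q (Pi\<^sub>M {0..k} (\<lambda>_. X))" if "v \<in> words k" for v
    by (intro measurable_restrict Qcomp) (use that in \<open>simp add: I_def\<close>)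
  have encm: "enc \<in> measurable Q (word_space k Y)"
    unfolding enc_def by (intro measurable_restrict measurable_compose[OF fib c])
  have dec_enc: "dec j (enc x v) = x (v, j)" if "x \<in> space Q" "v \<in> words k" "j \<in> {0..k}" for x v j
    using dec_c[OF measurable_space[OF fib[OF that(2)] that(1)] that(3)] that by (simp add: enc_def)
  define \<nu> where "\<nu> = distr Q (word_space k Y) enc"
  have sets_\<nu>: "sets \<nu> = sets (word_space k Y)" by (simp add: \<nu>_def)
  have \<nu>_prob: "prob_space \<nu>" unfolding \<nu>_def by (rule Q.prob_space_distr[OF encm])
  have law\<nu>: "law k Y \<nu>" using Y \<nu>_prob sets_\<nu> by (simp add: law_def)
  have Ycomp: "(\<lambda>y. y u) \<in> measurable \<nu> Y" if "u \<in> words k" for u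
    unfolding measurable_cong_sets[OF sets_\<nu> refl] using that by (rule measurable_component_singleton)
  have ss\<nu>: "strongly_stationary k Y \<nu>"
    unfolding strongly_stationary_def
  proof (intro conjI allI impI law\<nu>)
    fix \<phi> assume \<phi>: "word_subspace k \<phi>"
    define T where "T x = (\<lambda>q\<in>I. x (\<phi> (fst q), snd q))" for x :: "nat list \<times> nat \<Rightarrow> 'a"
    have \<phi>I: "(\<phi> (fst q), snd q) \<in> I" if "q \<in> I" for q
      using that word_subspace_maps[OF \<phi>] by (auto simp: I_def)
    have Tm: "T \<in> measurable Q ?PI"
      unfolding T_def by (intro measurable_restrict Qcomp \<phi>I)
    have TQ: "distr Q ?PI T = Q"
    proof (rule PiM_law_eqI[OF Q.prob_space_distr[OF Tm] _ Q])
      fix J and F :: "nat list \<times> nat \<Rightarrow> 'a set"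
      assume J: "finite J" "J \<subseteq> I" and F: "\<And>q. q \<in> J \<Longrightarrow> F q \<in> sets X"
      define n where "n = Max (insert 0 ((\<lambda>q. length (fst q)) ` J))"
      have n: "length (fst q) \<le> n" if "q \<in> J" for q using that J(1) by (auto simp: n_def)
      define G where "G a = measure \<mu> {x \<in> space \<mu>. \<forall>q\<in>J. x (r (snd q) (a (fst q))) \<in> F q}" for a :: "nat list \<Rightarrow> nat list"
      have Gcong: "G a = G b" if "\<And>v. v \<in> words k \<Longrightarrow> length v \<le> n \<Longrightarrow> a v = b v" for a b
      proof -
        have "a (fst q) = b (fst q)" if "q \<in> J" for q
          using that n J(2) by (intro \<open>\<And>v. v \<in> words k \<Longrightarrow> length v \<le> n \<Longrightarrow> a v = b v\<close>) (auto simp: I_def)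
        then have "(\<forall>q\<in>J. x (r (snd q) (a (fst q))) \<in> F q) = (\<forall>q\<in>J. x (r (snd q) (b (fst q))) \<in> F q)" for x :: "nat list \<Rightarrow> 'a"
          by simp
        then show ?thesis by (simp only: G_def)
      qed
      have "((\<lambda>\<sigma>. G (act \<sigma>)) \<longlongrightarrow> measure Q {x \<in> space Q. \<forall>q\<in>J. x q \<in> F q}) U"
        using Qlim'[of J "\<lambda>q. q" F] J F by (auto simp: G_def \<xi>_def split_beta)
      from stat[OF \<phi> Gcong this]
      have 1: "((\<lambda>\<sigma>. G (\<lambda>v. act \<sigma> (\<phi> v))) \<longlongrightarrow> measure Q {x \<in> space Q. \<forall>q\<in>J. x q \<in> F q}) U" .
      have 2: "((\<lambda>\<sigma>. G (\<lambda>v. act \<sigma> (\<phi> v))) \<longlongrightarrow> measure Q {x \<in> space Q. \<forall>q\<in>J. x (\<phi> (fst q), snd q) \<in> F q}) U"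
        using Qlim'[of J "\<lambda>q. (\<phi> (fst q), snd q)" F, OF J(1) \<phi>I[OF subsetD[OF J(2)]] F]
        by (simp add: G_def \<xi>_def split_beta)
      have Jm: "{x \<in> space ?PI. \<forall>q\<in>J. x q \<in> F q} \<in> sets ?PI"
        using Qsets[of J "\<lambda>q. q" F, OF J(1) subsetD[OF J(2)] F] unfolding spQ Q(2) by blast
      have "measure (distr Q ?PI T) {x \<in> space ?PI. \<forall>q\<in>J. x q \<in> F q}
          = measure Q (T -` {x \<in> space ?PI. \<forall>q\<in>J. x q \<in> F q} \<inter> space Q)"
        by (rule measure_distr[OF Tm Jm])
      also have "T -` {x \<in> space ?PI. \<forall>q\<in>J. x q \<in> F q} \<inter> space Q = {x \<in> space Q. \<forall>q\<in>J. x (\<phi> (fst q), snd q) \<in> F q}"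
        using measurable_space[OF Tm] J(2) by (auto simp: T_def subset_iff)
      also have "measure Q \<dots> = measure Q {x \<in> space Q. \<forall>q\<in>J. x q \<in> F q}"
        by (rule tendsto_unique[OF Ubot 2 1])
      finally show "measure (distr Q ?PI T) {x \<in> space (distr Q ?PI T). \<forall>q\<in>J. x q \<in> F q}
          = measure Q {x \<in> space Q. \<forall>q\<in>J. x q \<in> F q}" by simp
    qed simp
    have pm: "(\<lambda>x. \<lambda>u\<in>words k. x (\<phi> u)) \<in> measurable (word_space k Y) (word_space k Y)"
      by (intro measurable_restrict measurable_component_singleton word_subspace_maps[OF \<phi>])
    have encT: "enc \<in> measurable ?PI (word_space k Y)"
      using encm unfolding measurable_cong_sets[OF Q(2) refl] .
    have "subspace_pullback k Y \<phi> \<nu> = distr Q (word_space k Y) ((\<lambda>x. \<lambda>u\<in>words k. x (\<phi> u)) \<circ> enc)"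
      unfolding subspace_pullback_def \<nu>_def by (rule distr_distr[OF pm encm])
    also have "(\<lambda>x. \<lambda>u\<in>words k. x (\<phi> u)) \<circ> enc = enc \<circ> T"
      using word_subspace_maps[OF \<phi>] by (auto simp: fun_eq_iff enc_def T_def I_def cong: restrict_cong)
    also have "distr Q (word_space k Y) (enc \<circ> T) = distr (distr Q ?PI T) (word_space k Y) enc"
      by (rule distr_distr[OF encT Tm, symmetric])
    also have "\<dots> = \<nu>" unfolding TQ \<nu>_def ..
    finally show "subspace_pullback k Y \<phi> \<nu> = \<nu>" .
  qed
  have ext: "law_extension k Y \<nu> (dec 0) X \<mu>"
    unfolding law_extension_def
  proof (intro conjI law\<nu> dec)
    define p where "p x = (\<lambda>v\<in>words k. x (v, 0))" for x :: "nat list \<times> nat \<Rightarrow> 'a"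
    have pm: "p \<in> measurable Q (word_space k X)"
      unfolding p_def by (intro measurable_restrict Qcomp) (simp add: I_def)
    have dm: "(\<lambda>y. \<lambda>u\<in>words k. dec 0 (y u)) \<in> measurable (word_space k Y) (word_space k X)"
      by (intro measurable_restrict measurable_compose[OF _ dec] measurable_component_singleton)
    have "distr \<nu> (word_space k X) (\<lambda>y. \<lambda>u\<in>words k. dec 0 (y u))
      = distr Q (word_space k X) ((\<lambda>y. \<lambda>u\<in>words k. dec 0 (y u)) \<circ> enc)"
      unfolding \<nu>_def by (rule distr_distr[OF dm encm])
    also have "\<dots> = distr Q (word_space k X) p"
      using dec_enc by (intro distr_cong) (auto simp: p_def)
    also have "\<dots> = \<mu>"
    proof (rule PiM_law_eqI[OF Q.prob_space_distr[OF pm] _ \<mu>(2) sets_\<mu>])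
      fix J and F :: "nat list \<Rightarrow> 'a set"
      assume J: "finite J" "J \<subseteq> words k" and F: "\<And>v. v \<in> J \<Longrightarrow> F v \<in> sets X"
      let ?W = "{x \<in> space (word_space k X). \<forall>v\<in>J. x v \<in> F v}"
      let ?E = "{x \<in> space \<mu>. \<forall>v\<in>J. x v \<in> F v}"
      have Jm: "?W \<in> sets (word_space k X)"
        by (rule sets_Collect_finite_mem[where f = "\<lambda>v x. x v" and X = X])
          (use J F in \<open>auto intro!: measurable_component_singleton\<close>)
      have "measure (distr Q (word_space k X) p) ?W
        = measure Q (p -` ?W \<inter> space Q)"
        by (rule measure_distr[OF pm Jm])
      also have "p -` ?W \<inter> space Q = {x \<in> space Q. \<forall>v\<in>J. x (v, 0) \<in> F v}"
        using measurable_space[OF pm] J(2) by (auto simp: p_def subset_iff)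
      also have "measure Q \<dots> = measure \<mu> ?E"
      proof (rule tendsto_unique[OF Ubot])
        show "((\<lambda>\<sigma>. measure \<mu> {x \<in> space \<mu>. \<forall>v\<in>J. \<xi> \<sigma> (v, 0) x \<in> F v})
            \<longlongrightarrow> measure Q {x \<in> space Q. \<forall>v\<in>J. x (v, 0) \<in> F v}) U"
          by (rule Qlim'[of J "\<lambda>v. (v, 0)" F, OF J(1) _ F]) (use J(2) in \<open>auto simp: I_def\<close>)
        have "eventually (\<lambda>\<sigma>. measure \<mu> ?E
            = measure \<mu> {x \<in> space \<mu>. \<forall>v\<in>J. \<xi> \<sigma> (v, 0) x \<in> F v}) U"
          using US
        proof eventually_elim
          fix \<sigma> :: "nat \<Rightarrow> nat list" assume \<sigma>: "\<forall>i. \<sigma> i \<in> var_words k"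
          have sub: "word_subspace k (act \<sigma>)" using act_word_subspace[OF k, of \<sigma>] \<sigma> by blast
          let ?a = "\<lambda>x. \<lambda>u\<in>words k. x (act \<sigma> u)"
          have am: "?a \<in> measurable \<mu> (word_space k X)"
            by (intro measurable_restrict comp word_subspace_maps[OF sub])
          have "\<mu> = distr \<mu> (word_space k X) ?a"
            using ss sub unfolding strongly_stationary_def subspace_pullback_def by simp
          then have "measure \<mu> ?E
            = measure (distr \<mu> (word_space k X) ?a) ?E"
            by simp
          also have "\<dots> = measure \<mu> (?a -` ?E \<inter> space \<mu>)"
            by (rule measure_distr[OF am]) (use Jm sp_\<mu> in simp)
          also have "?a -` ?E \<inter> space \<mu>
              = {x \<in> space \<mu>. \<forall>v\<in>J. \<xi> \<sigma> (v, 0) x \<in> F v}"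
            using measurable_space[OF am] J(2) sp_\<mu> by (auto simp: \<xi>_def r_def subset_iff)
          finally show "measure \<mu> ?E
            = measure \<mu> {x \<in> space \<mu>. \<forall>v\<in>J. \<xi> \<sigma> (v, 0) x \<in> F v}" .
        qed
        then show "((\<lambda>\<sigma>. measure \<mu> {x \<in> space \<mu>. \<forall>v\<in>J. \<xi> \<sigma> (v, 0) x \<in> F v})
            \<longlongrightarrow> measure \<mu> ?E) U"
          by (rule Lim_transform_eventually[OF tendsto_const])
      qed
      finally show "measure (distr Q (word_space k X) p) {x \<in> space (distr Q (word_space k X) p). \<forall>v\<in>J. x v \<in> F v}
        = measure \<mu> {x \<in> space \<mu>. \<forall>v\<in>J. x v \<in> F v}" by simp
    qed simp
    finally show "distr \<nu> (word_space k X) (\<lambda>y. \<lambda>u\<in>words k. dec 0 (y u)) = \<mu>" .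
  qed
  have ins: "dec j -` A \<inter> space Y \<in> Phi k Y \<nu> (insert j e)" if j: "j \<in> {1..k}" and A: "A \<in> sets X" for j A
    unfolding Phi_def mem_Collect_eq
  proof (intro conjI allI impI)
    let ?A = "dec j -` A \<inter> space Y"
    show AY: "?A \<in> sets Y" by (rule measurable_sets[OF dec A])
    fix l assume l: "comb_line k l"
    have fin: "finite (insert j e)" using e(1) finite_subset by auto
    have lw: "l a \<in> words k" if "a \<in> insert j e" for a
      using that j e(1) by (intro comb_line_in_words[OF l]) auto
    have "AE y in \<nu>. y (l a) \<in> ?A \<longrightarrow> y (l b) \<in> ?A" if ab: "a \<in> insert j e" "b \<in> insert j e" for a b
    proof -
      \<comment> \<open>The event that \<open>x(l a, j)\<close> lies in \<open>A\<close> and \<open>x(l b, j)\<close> does not, as a cylinder event.\<close>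
      let ?t = "\<lambda>s :: bool. ((if s then l a else l b), j)"
      let ?F = "\<lambda>s :: bool. if s then A else space X - A"
      have "measure Q {x \<in> space Q. \<forall>s\<in>UNIV. x (?t s) \<in> ?F s} = 0"
      proof (rule tendsto_unique[OF Ubot Qlim'])
        have "{x \<in> space \<mu>. \<forall>s\<in>UNIV. \<xi> \<sigma> (?t s) x \<in> ?F s} = {}" for \<sigma>
          using repl_act_line[OF l j e(1) ab, of \<sigma>] j by (auto simp: \<xi>_def r_def UNIV_bool)
        then show "((\<lambda>\<sigma>. measure \<mu> {x \<in> space \<mu>. \<forall>s\<in>UNIV. \<xi> \<sigma> (?t s) x \<in> ?F s}) \<longlongrightarrow> 0) U"
          by (simp only: measure_empty tendsto_const)
      qed (use A lw ab j in \<open>auto simp: I_def\<close>)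
      moreover have "{x \<in> space Q. \<forall>s\<in>UNIV. x (?t s) \<in> ?F s} \<in> sets Q"
        by (rule Qsets) (use A lw ab j in \<open>auto simp: I_def\<close>)
      ultimately have "{x \<in> space Q. \<forall>s\<in>UNIV. x (?t s) \<in> ?F s} \<in> null_sets Q"
        by (simp add: null_sets_def Q.emeasure_eq_measure)
      then have "AE x in Q. x \<notin> {x \<in> space Q. \<forall>s\<in>UNIV. x (?t s) \<in> ?F s}" by (rule AE_not_in)
      then have "AE x in Q. enc x (l a) \<in> ?A \<longrightarrow> enc x (l b) \<in> ?A"
        using AE_space
      proof eventually_elim
        fix x assume x: "x \<notin> {x \<in> space Q. \<forall>s\<in>UNIV. x (?t s) \<in> ?F s}" "x \<in> space Q"
        have "enc x (l a) \<in> space Y" "enc x (l b) \<in> space Y"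
          using measurable_space[OF encm x(2)] lw ab by (auto simp: space_PiM PiE_iff)
        moreover have "x (l b, j) \<in> space X"
          using x(2) lw[OF ab(2)] j unfolding spQ by (auto simp: space_PiM PiE_iff I_def)
        ultimately show "enc x (l a) \<in> ?A \<longrightarrow> enc x (l b) \<in> ?A"
          using x dec_enc[OF x(2) lw[OF ab(1)], of j] dec_enc[OF x(2) lw[OF ab(2)], of j] j
          by (auto simp: UNIV_bool)
      qed
      moreover have "{y \<in> space (word_space k Y). y (l a) \<in> ?A \<longrightarrow> y (l b) \<in> ?A} \<in> sets (word_space k Y)"
      proof -
        note [measurable] = AY measurable_component_singleton[OF lw[OF ab(1)], of "\<lambda>_. Y"]
          measurable_component_singleton[OF lw[OF ab(2)], of "\<lambda>_. Y"]
        show ?thesis by measurable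
      qed
      ultimately show ?thesis unfolding \<nu>_def by (simp only: AE_distr_iff[OF encm])
    qed
    then have "AE y in \<nu>. \<forall>a\<in>insert j e. \<forall>b\<in>insert j e. y (l a) \<in> ?A \<longrightarrow> y (l b) \<in> ?A"
      by (intro AE_finite_allI[OF fin]) blast
    then show "AE y in \<nu>. \<forall>a\<in>insert j e. \<forall>b\<in>insert j e. (indicator ?A (y (l a)) :: real) = indicator ?A (y (l b))"
    proof eventually_elim
      fix y assume H: "\<forall>a\<in>insert j e. \<forall>b\<in>insert j e. y (l a) \<in> ?A \<longrightarrow> y (l b) \<in> ?A"
      show "\<forall>a\<in>insert j e. \<forall>b\<in>insert j e. (indicator ?A (y (l a)) :: real) = indicator ?A (y (l b))"
      proof (intro ballI)
        fix a b assume "a \<in> insert j e" "b \<in> insert j e"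
        then have "y (l a) \<in> ?A \<longleftrightarrow> y (l b) \<in> ?A" using H by blast
        then show "(indicator ?A (y (l a)) :: real) = indicator ?A (y (l b))" by (simp only: indicator_def)
      qed
    qed
  qed
  have joint: "measure \<nu> {y \<in> space \<nu>. dec 0 (y [i]) \<in> A i \<and> (\<forall>j\<in>{1..k} - e. dec j (y [i]) \<in> A j)}
      = measure (line_marginal k X \<mu>) {x \<in> space (line_marginal k X \<mu>). \<forall>j\<in>insert i ({1..k} - e). x j \<in> A j}"
    if Ai: "A i \<in> Phi k X \<mu> e" and Aj: "\<And>j. j \<in> {1..k} - e \<Longrightarrow> A j \<in> sets X" for A
  proof -
    let ?J = "insert i ({1..k} - e)"
    let ?t = "\<lambda>j. ([i], if j = i then 0 else j)"
    have AX: "A j \<in> sets X" if "j \<in> ?J" for j using that Ai Aj by (auto simp: Phi_def)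
    have tI: "?t j \<in> I" if "j \<in> ?J" for j using that w1[OF i] by (auto simp: I_def)
    have inotin: "j \<noteq> i" if "j \<in> {1..k} - e" for j using that e(2) by auto
    let ?B = "{x \<in> space (line_marginal k X \<mu>). \<forall>j\<in>?J. x j \<in> A j}"
    let ?D = "{y \<in> space \<nu>. \<forall>j\<in>?J. dec (snd (?t j)) (y [i]) \<in> A j}"
    have fam: "(\<forall>j\<in>?J. f (?t j) \<in> A j) \<longleftrightarrow> f ([i], 0) \<in> A i \<and> (\<forall>j\<in>{1..k} - e. f ([i], j) \<in> A j)"
      for f :: "nat list \<times> nat \<Rightarrow> 'a"
      using inotin by auto
    have dm: "(\<lambda>y. dec j (y [i])) \<in> measurable \<nu> X" for j
      by (rule measurable_compose[OF Ycomp[OF w1[OF i]] dec])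
    have S: "?D \<in> sets \<nu>"
      by (rule sets_Collect_finite_mem[OF _ dm AX]) auto
    have sp\<nu>: "space \<nu> = space (word_space k Y)" by (simp add: \<nu>_def)
    have E: "{y \<in> space \<nu>. dec 0 (y [i]) \<in> A i \<and> (\<forall>j\<in>{1..k} - e. dec j (y [i]) \<in> A j)}
        = ?D"
      using inotin by auto
    have "measure \<nu> {y \<in> space \<nu>. dec 0 (y [i]) \<in> A i \<and> (\<forall>j\<in>{1..k} - e. dec j (y [i]) \<in> A j)}
        = measure \<nu> ?D"
      by (simp only: E)
    also have "\<dots> = measure Q (enc -` ?D \<inter> space Q)"
      using S unfolding sets_\<nu> by (subst (1) \<nu>_def) (rule measure_distr[OF encm])
    also have "enc -` ?D \<inter> space Q = {x \<in> space Q. \<forall>j\<in>?J. x (?t j) \<in> A j}"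
      using measurable_space[OF encm] sp\<nu> dec_enc[OF _ w1[OF i]] tI by (auto simp: I_def)
    also have "measure Q \<dots> = measure (line_marginal k X \<mu>) ?B"
    proof (rule tendsto_unique[OF Ubot Qlim'])
      have "eventually (\<lambda>\<sigma>. measure (line_marginal k X \<mu>) ?B
          = measure \<mu> {x \<in> space \<mu>. \<forall>j\<in>?J. \<xi> \<sigma> (?t j) x \<in> A j}) U"
        using US
      proof eventually_elim
        fix \<sigma> :: "nat \<Rightarrow> nat list" assume \<sigma>: "\<forall>i. \<sigma> i \<in> var_words k"
        define u where "u = act \<sigma> [i]"
        have u: "u \<in> words k" unfolding u_def using \<sigma> w1[OF i] by (intro act_w) auto
        have "u = subst i (\<sigma> 0)" by (simp add: u_def act_def)
        then have "i \<in> set u" using \<sigma>[rule_format, of 0] by (force simp: var_words_def subst_def)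
        then have line: "comb_line k (\<lambda>a. repl e a u)" using e(2) by (intro repl_line[OF u]) auto
        let ?L = "\<lambda>x. \<lambda>a\<in>{1..k}. x (repl e a u)"
        let ?W = "{x \<in> space \<mu>. \<forall>j\<in>?J. \<xi> \<sigma> (?t j) x \<in> A j}"
        let ?Z = "{x \<in> space (Pi\<^sub>M {1..k} (\<lambda>_. X)). \<forall>j\<in>?J. x j \<in> A j}"
        have Lm: "?L \<in> measurable \<mu> (Pi\<^sub>M {1..k} (\<lambda>_. X))"
          by (intro measurable_restrict comp repl_words[OF u])
        have Jk: "?J \<subseteq> {1..k}" using i by auto
        have AS: "?Z \<in> sets (Pi\<^sub>M {1..k} (\<lambda>_. X))"
          by (rule sets_Collect_finite_mem[where f = "\<lambda>j x. x j" and X = X])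
            (use Jk AX in \<open>auto intro!: measurable_component_singleton\<close>)
        have "measure (line_marginal k X \<mu>) ?B
          = measure (distr \<mu> (Pi\<^sub>M {1..k} (\<lambda>_. X)) ?L) ?Z"
          unfolding line_marginal_eq[OF ss k line] by (simp add: line_marginal_def)
        also have "\<dots> = measure \<mu> (?L -` ?Z \<inter> space \<mu>)"
          by (rule measure_distr[OF Lm AS])
        also have "\<dots> = measure \<mu> ?W"
        proof (rule \<mu>.finite_measure_eq_AE)
          show "AE x in \<mu>. (x \<in> ?L -` ?Z \<inter> space \<mu>)
            = (x \<in> ?W)"
            using Phi_repl[OF Ai e u] AE_space
          proof eventually_elim
            fix x assume x: "x u \<in> A i \<longleftrightarrow> x (repl e i u) \<in> A i" "x \<in> space \<mu>"
            have x1: "\<xi> \<sigma> ([i], 0) x = x u" and x2: "\<And>j. j \<in> {1..k} - e \<Longrightarrow> \<xi> \<sigma> ([i], j) x = x (repl e j u)"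
              by (auto simp: \<xi>_def r_def u_def)
            have "(\<forall>j\<in>?J. \<xi> \<sigma> (?t j) x \<in> A j) \<longleftrightarrow> x u \<in> A i \<and> (\<forall>j\<in>{1..k} - e. x (repl e j u) \<in> A j)"
              unfolding fam[of "\<lambda>q. \<xi> \<sigma> q x"] x1 using x2 by auto
            moreover have "(\<forall>j\<in>?J. ?L x j \<in> A j) \<longleftrightarrow> x (repl e i u) \<in> A i \<and> (\<forall>j\<in>{1..k} - e. x (repl e j u) \<in> A j)"
              using i by auto
            ultimately show "(x \<in> ?L -` ?Z \<inter> space \<mu>)
              = (x \<in> ?W)"
              using x measurable_space[OF Lm x(2)] unfolding Int_iff vimage_eq mem_Collect_eq by blast
          qed
          show "?L -` ?Z \<inter> space \<mu> \<in> \<mu>.events"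
            by (rule measurable_sets[OF Lm AS])
          show "?W \<in> \<mu>.events"
            by (rule sets_Collect_finite_mem[OF _ \<xi>m AX]) (use \<sigma> tI in auto)
        qed
        finally show "measure (line_marginal k X \<mu>) ?B
          = measure \<mu> {x \<in> space \<mu>. \<forall>j\<in>?J. \<xi> \<sigma> (?t j) x \<in> A j}" .
      qed
      then show "((\<lambda>\<sigma>. measure \<mu> {x \<in> space \<mu>. \<forall>j\<in>?J. \<xi> \<sigma> (?t j) x \<in> A j})
          \<longlongrightarrow> measure (line_marginal k X \<mu>) ?B) U"
        by (rule Lim_transform_eventually[OF tendsto_const])
    qed (use tI AX in auto)
    finally show ?thesis .
  qed
  show thesis using that[OF ss\<nu> dec ext ins joint] .
qed

section \<open>Satedness on a line\<close>

lemma law_space: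
  assumes "law k X \<mu>" "x \<in> space \<mu>" "u \<in> words k"
  shows "x u \<in> space X"
proof -
  have "sets \<mu> = sets (word_space k X)" using assms(1) by (simp add: law_def)
  from sets_eq_imp_space_eq[OF this] show ?thesis
    using assms(2,3) by (auto simp: space_PiM PiE_iff)
qed

lemma Phi_sigma_algebra:
  assumes law: "law k X \<mu>" and e: "e \<subseteq> {1..k}"
  shows "sigma_algebra (space X) (Phi k X \<mu> e)"
  unfolding sigma_algebra_iff2
proof (intro conjI ballI allI impI)
  show "Phi k X \<mu> e \<subseteq> Pow (space X)" using sets.space_closed[of X] by (auto simp: Phi_def)
  show "{} \<in> Phi k X \<mu> e" by (simp add: Phi_def)
next
  fix A assume A: "A \<in> Phi k X \<mu> e"
  show "space X - A \<in> Phi k X \<mu> e"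
    unfolding Phi_def mem_Collect_eq
  proof (intro conjI allI impI)
    show "space X - A \<in> sets X" using A by (auto simp: Phi_def)
    fix l assume l: "comb_line k l"
    have "AE x in \<mu>. \<forall>i\<in>e. \<forall>j\<in>e. (indicator A (x (l i)) :: real) = indicator A (x (l j))"
      using A l by (auto simp: Phi_def)
    then show "AE x in \<mu>. \<forall>i\<in>e. \<forall>j\<in>e. (indicator (space X - A) (x (l i)) :: real) = indicator (space X - A) (x (l j))"
      using AE_space
    proof eventually_elim
      fix x assume x: "\<forall>i\<in>e. \<forall>j\<in>e. (indicator A (x (l i)) :: real) = indicator A (x (l j))" "x \<in> space \<mu>"
      have sp: "x (l i) \<in> space X" if "i \<in> e" for i
        using law_space[OF law x(2) comb_line_in_words[OF l]] that e by auto
      show "\<forall>i\<in>e. \<forall>j\<in>e. (indicator (space X - A) (x (l i)) :: real) = indicator (space X - A) (x (l j))"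
      proof (intro ballI)
        fix i j assume ij: "i \<in> e" "j \<in> e"
        have "(indicator A (x (l i)) :: real) = indicator A (x (l j))" using x(1) ij by blast
        then have "x (l i) \<in> A \<longleftrightarrow> x (l j) \<in> A" by (simp add: indicator_def of_bool_eq_iff)
        then show "(indicator (space X - A) (x (l i)) :: real) = indicator (space X - A) (x (l j))"
          using sp[OF ij(1)] sp[OF ij(2)] by (simp add: indicator_def)
      qed
    qed
  qed
next
  fix A :: "nat \<Rightarrow> 'a set" assume A: "range A \<subseteq> Phi k X \<mu> e"
  show "(\<Union>n. A n) \<in> Phi k X \<mu> e"
    unfolding Phi_def mem_Collect_eq
  proof (intro conjI allI impI)
    show "(\<Union>n. A n) \<in> sets X" using A by (auto simp: Phi_def)
    fix l assume l: "comb_line k l"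
    have "AE x in \<mu>. \<forall>i\<in>e. \<forall>j\<in>e. (indicator (A n) (x (l i)) :: real) = indicator (A n) (x (l j))" for n
      using A l by (auto simp: Phi_def)
    then have "AE x in \<mu>. \<forall>n. \<forall>i\<in>e. \<forall>j\<in>e. (indicator (A n) (x (l i)) :: real) = indicator (A n) (x (l j))"
      by (simp add: AE_all_countable)
    then show "AE x in \<mu>. \<forall>i\<in>e. \<forall>j\<in>e. (indicator (\<Union>n. A n) (x (l i)) :: real) = indicator (\<Union>n. A n) (x (l j))"
    proof eventually_elim
      fix x assume x: "\<forall>n. \<forall>i\<in>e. \<forall>j\<in>e. (indicator (A n) (x (l i)) :: real) = indicator (A n) (x (l j))"
      show "\<forall>i\<in>e. \<forall>j\<in>e. (indicator (\<Union>n. A n) (x (l i)) :: real) = indicator (\<Union>n. A n) (x (l j))"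
      proof (intro ballI)
        fix i j assume ij: "i \<in> e" "j \<in> e"
        have "x (l i) \<in> A n \<longleftrightarrow> x (l j) \<in> A n" for n
        proof -
          have "(indicator (A n) (x (l i)) :: real) = indicator (A n) (x (l j))" using x ij by blast
          then show ?thesis by (simp add: indicator_def of_bool_eq_iff)
        qed
        then show "(indicator (\<Union>n. A n) (x (l i)) :: real) = indicator (\<Union>n. A n) (x (l j))"
          by (simp add: indicator_def)
      qed
    qed
  qed
qed

lemma Phi_antimono:
  assumes "e \<subseteq> e'"
  shows "Phi k X \<mu> e' \<subseteq> Phi k X \<mu> e"
proof
  fix A assume A: "A \<in> Phi k X \<mu> e'"
  have "AE x in \<mu>. \<forall>i\<in>e. \<forall>j\<in>e. (indicator A (x (l i)) :: real) = indicator A (x (l j))" if "comb_line k l" for l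
  proof -
    have "AE x in \<mu>. \<forall>i\<in>e'. \<forall>j\<in>e'. (indicator A (x (l i)) :: real) = indicator A (x (l j))"
      using A that by (simp add: Phi_def)
    then show ?thesis by eventually_elim (use assms in blast)
  qed
  then show "A \<in> Phi k X \<mu> e" using A by (simp add: Phi_def)
qed

definition above :: "nat \<Rightarrow> nat set \<Rightarrow> nat set set" where
  "above k e = {a. e \<subset> a \<and> a \<subseteq> {1..k}}"

lemma sets_Phi_join: "sets (Phi_join k X \<mu> \<I>) = sigma_sets (space X) (\<Union>e\<in>\<I>. Phi k X \<mu> e)"
  and space_Phi_join: "space (Phi_join k X \<mu> \<I>) = space X"
proof -
  have "(\<Union>e\<in>\<I>. Phi k X \<mu> e) \<subseteq> Pow (space X)" using sets.space_closed[of X] by (auto simp: Phi_def)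
  then show "sets (Phi_join k X \<mu> \<I>) = sigma_sets (space X) (\<Union>e\<in>\<I>. Phi k X \<mu> e)"
    "space (Phi_join k X \<mu> \<I>) = space X" by (simp_all add: Phi_join_def)
qed

lemma Phi_join_above_subset:
  assumes "law k X \<mu>" "e \<subseteq> {1..k}"
  shows "sets (Phi_join k X \<mu> (above k e)) \<subseteq> Phi k X \<mu> e"
proof -
  interpret sigma_algebra "space X" "Phi k X \<mu> e" by (rule Phi_sigma_algebra[OF assms])
  have "(\<Union>a\<in>above k e. Phi k X \<mu> a) \<subseteq> Phi k X \<mu> e"
    by (intro UN_least Phi_antimono) (auto simp: above_def)
  then show ?thesis unfolding sets_Phi_join by (rule sigma_sets_subset)
qed

text \<open>In the extension provided by \<open>insensitive_extension\<close> the components \<open>j \<notin> e\<close> are measurable for the join over the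
proper supersets of \<open>e\<close>, because \<open>e \<union> {j}\<close> is one of them. Satedness allows the indicator of \<open>A\<close> to be replaced by
its conditional expectation \<open>F\<close> on that join when integrated against them. Both \<open>A\<close> and \<open>F\<close> are measurable for
\<open>\<Phi>\<^sub>e\<close>, so the identity can be carried back to the line marginal.\<close>

lemma sated_line_factor:
  fixes X :: "'a measure"
  assumes k: "1 \<le> k" and ss: "strongly_stationary k X \<mu>" and e: "e \<subseteq> {1..k}" "i \<in> e"
    and sat: "sated k X \<mu> (above k e)" and A: "A \<in> Phi k X \<mu> e"
  obtains F :: "'a \<Rightarrow> real" where
    "F \<in> borel_measurable (Phi_join k X \<mu> (above k e))" "\<And>x. 0 \<le> F x \<and> F x \<le> 1"
    "\<And>E. E \<in> sets (Pi\<^sub>M ({1..k} - e) (\<lambda>_. X)) \<Longrightarrow>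
      (\<integral>x. indicator A (x i) * indicator E (restrict x ({1..k} - e)) \<partial>line_marginal k X \<mu>)
      = (\<integral>x. F (x i) * indicator E (restrict x ({1..k} - e)) \<partial>line_marginal k X \<mu>)"
proof -
  have law: "law k X \<mu>" using ss by (simp add: strongly_stationary_def)
  have i: "i \<in> {1..k}" using e by auto
  define D where "D = {1..k} - e"
  have iD: "i \<notin> D" using e(2) by (simp add: D_def)
  obtain Y :: "real measure" and \<nu> and dec :: "nat \<Rightarrow> real \<Rightarrow> 'a" where
    ss\<nu>: "strongly_stationary k Y \<nu>" and dec: "\<And>j. dec j \<in> measurable Y X" and ext: "law_extension k Y \<nu> (dec 0) X \<mu>"
    and ins: "\<And>j A. j \<in> {1..k} \<Longrightarrow> A \<in> sets X \<Longrightarrow> dec j -` A \<inter> space Y \<in> Phi k Y \<nu> (insert j e)"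
    and joint: "\<And>A. A i \<in> Phi k X \<mu> e \<Longrightarrow> (\<And>j. j \<in> {1..k} - e \<Longrightarrow> A j \<in> sets X) \<Longrightarrow>
      measure \<nu> {y \<in> space \<nu>. dec 0 (y [i]) \<in> A i \<and> (\<forall>j\<in>{1..k} - e. dec j (y [i]) \<in> A j)}
      = measure (line_marginal k X \<mu>) {x \<in> space (line_marginal k X \<mu>). \<forall>j\<in>insert i ({1..k} - e). x j \<in> A j}"
    by (rule insensitive_extension[OF k ss e]) blast
  have law\<nu>: "law k Y \<nu>" using ss\<nu> by (simp add: strongly_stationary_def)
  have sets_\<nu>: "sets \<nu> = sets (word_space k Y)" and "prob_space \<nu>" using law\<nu> by (auto simp: law_def)
  interpret \<nu>: prob_space \<nu> by fact
  have w1: "[a] \<in> words k" if "a \<in> {1..k}" for a using that by (simp add: words_def)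
  have Ycomp: "(\<lambda>y. y u) \<in> measurable \<nu> Y" if "u \<in> words k" for u
    unfolding measurable_cong_sets[OF sets_\<nu> refl] using that by (rule measurable_component_singleton)
  let ?L = "line_marginal k X \<mu>"
  interpret L: prob_space ?L by (rule prob_space_line_marginal[OF law])
  have spL: "space ?L = space (Pi\<^sub>M {1..k} (\<lambda>_. X))" and setsL: "sets ?L = sets (Pi\<^sub>M {1..k} (\<lambda>_. X))"
    by (simp_all add: line_marginal_def)
  have Lcomp: "(\<lambda>x. x j) \<in> measurable ?L X" if "j \<in> {1..k}" for j
    unfolding measurable_cong_sets[OF setsL refl] using that by (rule measurable_component_singleton)
  define \<nu>1 where "\<nu>1 = point_marginal Y \<nu>"
  have \<nu>1: "\<nu>1 = distr \<nu> Y (\<lambda>y. y [i])" unfolding \<nu>1_def by (rule point_marginal_eq[OF ss\<nu> k w1[OF i], symmetric])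
  have sets_\<nu>1: "sets \<nu>1 = sets Y" and sp_\<nu>1: "space \<nu>1 = space Y" by (simp_all add: \<nu>1)
  interpret \<nu>1: prob_space \<nu>1 unfolding \<nu>1 by (rule \<nu>.prob_space_distr[OF Ycomp[OF w1[OF i]]])
  have dec1: "dec j \<in> measurable \<nu>1 X" for j unfolding measurable_cong_sets[OF sets_\<nu>1 refl] by (rule dec)
  define \<mu>1 where "\<mu>1 = point_marginal X \<mu>"
  have sets_\<mu>1: "sets \<mu>1 = sets X" "space \<mu>1 = space X" by (simp_all add: \<mu>1_def point_marginal_def)
  have one: "[1] \<in> words k" using k by (intro w1) simp
  have \<mu>1: "distr \<nu>1 X (dec 0) = \<mu>1"
  proof -
    have m: "(\<lambda>y. \<lambda>u\<in>words k. dec 0 (y u)) \<in> measurable \<nu> (word_space k X)"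
      by (intro measurable_restrict measurable_compose[OF Ycomp dec])
    have "\<mu>1 = distr (distr \<nu> (word_space k X) (\<lambda>y. \<lambda>u\<in>words k. dec 0 (y u))) X (\<lambda>x. x [1])"
      using ext by (simp add: law_extension_def \<mu>1_def point_marginal_def)
    also have "\<dots> = distr \<nu> X ((\<lambda>x. x [1]) \<circ> (\<lambda>y. \<lambda>u\<in>words k. dec 0 (y u)))"
      by (rule distr_distr[OF measurable_component_singleton[OF one] m])
    also have "\<dots> = distr \<nu> X (dec 0 \<circ> (\<lambda>y. y [1]))" using one by (simp add: o_def)
    also have "\<dots> = distr (distr \<nu> Y (\<lambda>y. y [1])) X (dec 0)"
      by (rule distr_distr[OF dec Ycomp[OF one], symmetric])
    also have "\<dots> = distr \<nu>1 X (dec 0)" by (simp add: \<nu>1_def point_marginal_def)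
    finally show ?thesis ..
  qed
  interpret \<mu>1: prob_space \<mu>1 unfolding \<mu>1[symmetric] by (rule \<nu>1.prob_space_distr[OF dec1])
  define \<Psi> where "\<Psi> = Phi_join k X \<mu> (above k e)"
  have \<Psi>: "subalgebra \<mu>1 \<Psi>" unfolding \<mu>1_def \<Psi>_def by (rule subalgebra_Phi_join)
  have sp\<Psi>: "space \<Psi> = space X" by (simp add: \<Psi>_def space_Phi_join)
  have AX: "A \<in> sets X" using A by (simp add: Phi_def)
  define F0 where "F0 = real_cond_exp \<mu>1 \<Psi> (indicator A)"
  \<comment> \<open>A version of the conditional expectation that is bounded everywhere.\<close>
  define F where "F x = max 0 (min 1 (F0 x))" for x
  have F0m: "F0 \<in> borel_measurable \<Psi>" by (simp add: F0_def)
  then have Fm: "F \<in> borel_measurable \<Psi>" unfolding F_def by measurable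
  have F01: "0 \<le> F x \<and> F x \<le> 1" for x by (simp add: F_def)
  have iA: "integrable \<mu>1 (indicator A :: 'a \<Rightarrow> real)"
    using AX sets_\<mu>1 by (intro \<mu>1.integrable_indicator_set) simp
  interpret S: sigma_finite_subalgebra \<mu>1 \<Psi> by (rule \<mu>1.subalgebra_sigma_finite[OF \<Psi>])
  have "AE x in \<mu>1. F0 x \<ge> 0" unfolding F0_def by (rule S.real_cond_exp_ge_c[OF iA]) simp
  moreover have "AE x in \<mu>1. F0 x \<le> 1" unfolding F0_def by (rule S.real_cond_exp_le_c[OF iA]) (simp add: indicator_def)
  ultimately have FF0: "AE x in \<mu>1. F0 x = F x" by eventually_elim (simp add: F_def)
  have FX: "F \<in> borel_measurable \<mu>1" by (rule measurable_from_subalg[OF \<Psi> Fm])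
  have F_int: "(\<integral>x. indicator A x * indicator B x \<partial>\<mu>1) = (\<integral>x. F x * indicator B x \<partial>\<mu>1)" if B: "B \<in> sets \<Psi>" for B
  proof -
    have BM: "B \<in> sets \<mu>1" using B \<Psi> by (auto simp: subalgebra_def)
    have "(\<integral>x. indicator A x * indicator B x \<partial>\<mu>1) = (\<integral>x. F0 x * indicator B x \<partial>\<mu>1)"
      using S.real_cond_exp_intA[OF iA B] by (simp add: set_lebesgue_integral_def F0_def mult.commute)
    also have "\<dots> = (\<integral>x. F x * indicator B x \<partial>\<mu>1)"
      by (rule integral_cong_AE) (use FF0 FX BM in \<open>auto simp: F0_def\<close>)
    finally show ?thesis .
  qed
  let ?\<Xi> = "vimage_algebra (space Y) (dec 0) \<Psi>"
  have \<Xi>: "subalgebra \<nu>1 ?\<Xi>" unfolding \<nu>1_def \<Psi>_def by (rule subalgebra_vimage_Phi_join[OF dec])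
  have rel: "rel_indep \<nu>1 (vimage_algebra (space Y) (dec 0) X) (Phi_join k Y \<nu> (above k e)) ?\<Xi>"
    using sat ss\<nu> ext unfolding sated_def \<nu>1_def \<Psi>_def by blast
  have dec\<Xi>: "dec 0 \<in> measurable ?\<Xi> \<Psi>"
    by (rule measurable_vimage_algebra1) (use dec[of 0] in \<open>auto simp: sp\<Psi> measurable_def\<close>)
  have F\<Xi>: "(\<lambda>y. F (dec 0 y)) \<in> borel_measurable ?\<Xi>" by (rule measurable_compose[OF dec\<Xi> Fm])
  have Fdec: "(\<lambda>y. F (dec 0 y)) \<in> borel_measurable \<nu>1" by (rule measurable_from_subalg[OF \<Xi> F\<Xi>])
  have iFdec: "integrable \<nu>1 (\<lambda>y. F (dec 0 y))"
    by (rule \<nu>1.integrable_boundedI[of _ 1, OF Fdec]) (use F01 in auto)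
  define f where "f y = (indicator A (dec 0 y) :: real)" for y
  have fm: "f \<in> borel_measurable \<nu>1"
    unfolding f_def using AX by (intro measurable_compose[OF dec1] borel_measurable_indicator)
  have if': "integrable \<nu>1 f"
    by (rule \<nu>1.integrable_boundedI[of _ 1, OF fm]) (auto simp: f_def indicator_def)
  have push: "(\<integral>y. h (dec 0 y) \<partial>\<nu>1) = (\<integral>x. h x \<partial>\<mu>1)" if "h \<in> borel_measurable \<mu>1" for h :: "'a \<Rightarrow> real"
  proof -
    have "h \<in> borel_measurable X" using that by (simp add: measurable_cong_sets[OF sets_\<mu>1(1) refl])
    then show ?thesis unfolding \<mu>1[symmetric] by (rule integral_distr[OF dec1, symmetric])
  qed
  have Ef: "AE y in \<nu>1. real_cond_exp \<nu>1 ?\<Xi> f y = F (dec 0 y)"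
  proof (rule \<nu>1.cond_exp_unique[OF \<Xi> if' iFdec F\<Xi>])
    fix B assume "B \<in> sets ?\<Xi>"
    moreover have "dec 0 \<in> space Y \<rightarrow> space \<Psi>" using measurable_space[OF dec] sp\<Psi> by auto
    ultimately obtain B' where B': "B' \<in> sets \<Psi>" "B = dec 0 -` B' \<inter> space Y"
      by (auto simp: sets_vimage_algebra2)
    have B'M: "B' \<in> sets \<mu>1" using B' \<Psi> by (auto simp: subalgebra_def)
    have "(\<integral>y. f y * indicator B y \<partial>\<nu>1) = (\<integral>y. (\<lambda>x. indicator A x * indicator B' x) (dec 0 y) \<partial>\<nu>1)"
      by (rule Bochner_Integration.integral_cong) (auto simp: f_def B'(2) sp_\<nu>1 indicator_def)
    also have "\<dots> = (\<integral>x. indicator A x * indicator B' x \<partial>\<mu>1)"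
      by (rule push) (use AX sets_\<mu>1 B'M in simp)
    also have "\<dots> = (\<integral>x. F x * indicator B' x \<partial>\<mu>1)" by (rule F_int[OF B'(1)])
    also have "\<dots> = (\<integral>y. (\<lambda>x. F x * indicator B' x) (dec 0 y) \<partial>\<nu>1)"
      by (rule push[symmetric]) (use FX B'M in simp)
    also have "\<dots> = (\<integral>y. F (dec 0 y) * indicator B y \<partial>\<nu>1)"
      by (rule Bochner_Integration.integral_cong) (auto simp: B'(2) sp_\<nu>1 indicator_def)
    finally show "(\<integral>y. f y * indicator B y \<partial>\<nu>1) = (\<integral>y. F (dec 0 y) * indicator B y \<partial>\<nu>1)" .
  qed
  have key: "(\<integral>y. f y * g y \<partial>\<nu>1) = (\<integral>y. F (dec 0 y) * g y \<partial>\<nu>1)"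
    if g: "g \<in> borel_measurable (Phi_join k Y \<nu> (above k e))" "\<And>y. \<bar>g y\<bar> \<le> 1" for g
  proof -
    have subY: "subalgebra \<nu>1 (Phi_join k Y \<nu> (above k e))" unfolding \<nu>1_def by (rule subalgebra_Phi_join)
    have gm: "g \<in> borel_measurable \<nu>1" by (rule measurable_from_subalg[OF subY g(1)])
    have ig: "integrable \<nu>1 g" by (rule \<nu>1.integrable_boundedI[of _ 1, OF gm]) (use g(2) in auto)
    have ifg: "integrable \<nu>1 (\<lambda>y. f y * g y)"
      by (rule \<nu>1.integrable_bounded_mult[of _ 1, OF fm _ ig]) (auto simp: f_def indicator_def)
    have "f \<in> borel_measurable (vimage_algebra (space Y) (dec 0) X)"
      unfolding f_def using AX measurable_space[OF dec]
      by (intro measurable_compose[OF measurable_vimage_algebra1] borel_measurable_indicator) auto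
    moreover have "bounded (f ` S)" for S by (auto simp: bounded_iff f_def indicator_def intro!: exI[of _ 1])
    moreover have "bounded (g ` S)" for S using g(2) by (auto simp: bounded_iff)
    ultimately have R: "AE y in \<nu>1. real_cond_exp \<nu>1 ?\<Xi> (\<lambda>x. f x * g x) y = real_cond_exp \<nu>1 ?\<Xi> f y * real_cond_exp \<nu>1 ?\<Xi> g y"
      using rel g(1) unfolding rel_indep_def by blast
    interpret \<Xi>: sigma_finite_subalgebra \<nu>1 ?\<Xi> by (rule \<nu>1.subalgebra_sigma_finite[OF \<Xi>])
    have "(\<integral>y. f y * g y \<partial>\<nu>1) = (\<integral>y. real_cond_exp \<nu>1 ?\<Xi> (\<lambda>y. f y * g y) y \<partial>\<nu>1)"
      by (rule \<Xi>.real_cond_exp_int(2)[OF ifg, symmetric])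
    also have "\<dots> = (\<integral>y. F (dec 0 y) * real_cond_exp \<nu>1 ?\<Xi> g y \<partial>\<nu>1)"
    proof (rule integral_cong_AE)
      show "AE y in \<nu>1. real_cond_exp \<nu>1 ?\<Xi> (\<lambda>y. f y * g y) y = F (dec 0 y) * real_cond_exp \<nu>1 ?\<Xi> g y"
        using R Ef by eventually_elim simp
    qed (use Fdec in auto)
    also have "\<dots> = (\<integral>y. F (dec 0 y) * g y \<partial>\<nu>1)"
      by (rule \<nu>1.cond_exp_move[OF \<Xi> F\<Xi> _ ig, of 1]) (use F01 in auto)
    finally show ?thesis .
  qed
  interpret PH: sigma_algebra "space X" "Phi k X \<mu> e" by (rule Phi_sigma_algebra[OF law e(1)])
  \<comment> \<open>Coordinate \<open>i\<close> carries only \<open>\<Phi>\<^sub>e\<close>: the extension is compared with the line marginal on these events.\<close>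
  define N where "N = sigma (space X) (Phi k X \<mu> e)"
  have N: "sets N = Phi k X \<mu> e" "space N = space X"
    unfolding N_def using PH.space_closed by (simp_all add: PH.sigma_sets_eq)
  define M' where "M' j = (if j = i then N else X)" for j
  let ?P = "Pi\<^sub>M (insert i D) M'"
  have M'X: "sets (M' j) \<subseteq> sets X" "space (M' j) = space X" for j using N by (auto simp: M'_def Phi_def)
  define t where "t j = (if j = i then 0 else j)" for j :: nat
  have toM': "h \<in> measurable Z (M' j)" if "h \<in> measurable Z X" for h and Z :: "'z measure" and j
    using that M'X[of j] by (auto simp: measurable_def)
  have ti: "t i = 0" by (simp add: t_def)
  have tD: "t j = j" if "j \<in> D" for j using that iD by (auto simp: t_def)
  define a where "a y = (\<lambda>j\<in>insert i D. dec (t j) (y [i]))" for y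
  define b where "b x = (restrict x (insert i D))" for x :: "nat \<Rightarrow> 'a"
  have iDk: "insert i D \<subseteq> {1..k}" using i by (auto simp: D_def)
  have am: "a \<in> measurable \<nu> ?P"
    unfolding a_def by (intro measurable_restrict toM' measurable_compose[OF Ycomp[OF w1[OF i]] dec])
  have bm: "b \<in> measurable ?L ?P"
    unfolding b_def using iDk by (intro measurable_restrict toM' Lcomp) auto
  have eqlaw: "distr \<nu> ?P a = distr ?L ?P b"
  proof (rule PiM_law_eqI[OF \<nu>.prob_space_distr[OF am] _ L.prob_space_distr[OF bm]])
    fix J and C :: "nat \<Rightarrow> 'a set"
    assume J: "finite J" "J \<subseteq> insert i D" and C: "\<And>j. j \<in> J \<Longrightarrow> C j \<in> sets (M' j)"
    let ?C = "{x \<in> space ?P. \<forall>j\<in>J. x j \<in> C j}"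
    \<comment> \<open>Coordinates outside \<open>J\<close> are unconstrained.\<close>
    define C' where "C' j = (if j \<in> J then C j else space X)" for j
    have C'i: "C' i \<in> Phi k X \<mu> e" using C[of i] PH.top N by (auto simp: C'_def M'_def)
    have C'j: "C' j \<in> sets X" for j using C[of j] M'X(1)[of j] by (auto simp: C'_def)
    have Cm: "?C \<in> sets ?P"
    proof -
      have "{x \<in> space ?P. x j \<in> C j} \<in> sets ?P" if "j \<in> J" for j
        using measurable_sets[OF measurable_component_singleton[of j "insert i D" M'] C[OF that]] that J(2)
        by (auto simp: vimage_def Int_def conj_commute subset_iff)
      then show ?thesis using J(1) by (intro sets.sets_Collect_finite_All)
    qed
    have "measure (distr \<nu> ?P a) ?C
        = measure \<nu> (a -` ?C \<inter> space \<nu>)"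
      by (rule measure_distr[OF am Cm])
    also have "a -` ?C \<inter> space \<nu>
        = {y \<in> space \<nu>. dec 0 (y [i]) \<in> C' i \<and> (\<forall>j\<in>{1..k} - e. dec j (y [i]) \<in> C' j)}"
    proof (rule set_eqI)
      fix y
      have sp: "dec j (y [i]) \<in> space X" if "y \<in> space \<nu>" for j
        using measurable_space[OF measurable_compose[OF Ycomp[OF w1[OF i]] dec] that] .
      have 1: "(\<forall>j\<in>J. a y j \<in> C j) \<longleftrightarrow> (\<forall>j\<in>insert i D. dec (t j) (y [i]) \<in> C' j)" if "y \<in> space \<nu>"
        using J(2) sp[OF that] by (auto simp: C'_def a_def)
      have 2: "(\<forall>j\<in>insert i D. dec (t j) (y [i]) \<in> C' j) \<longleftrightarrow> dec 0 (y [i]) \<in> C' i \<and> (\<forall>j\<in>D. dec j (y [i]) \<in> C' j)"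
        by (simp add: ti tD)
      show "y \<in> a -` ?C \<inter> space \<nu>
        \<longleftrightarrow> y \<in> {y \<in> space \<nu>. dec 0 (y [i]) \<in> C' i \<and> (\<forall>j\<in>{1..k} - e. dec j (y [i]) \<in> C' j)}"
        using measurable_space[OF am, of y] 1 unfolding 2 D_def[symmetric] vimage_eq Int_iff mem_Collect_eq by blast
    qed
    also have "measure \<nu> \<dots> = measure ?L {x \<in> space ?L. \<forall>j\<in>insert i ({1..k} - e). x j \<in> C' j}"
      by (rule joint[of C', OF C'i C'j])
    also have "{x \<in> space ?L. \<forall>j\<in>insert i ({1..k} - e). x j \<in> C' j}
        = b -` ?C \<inter> space ?L"
    proof (rule set_eqI)
      fix x
      have sp: "x j \<in> space X" if "x \<in> space ?L" "j \<in> insert i D" for j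
        using measurable_space[OF Lcomp that(1)] that(2) iDk by blast
      have "(\<forall>j\<in>J. b x j \<in> C j) \<longleftrightarrow> (\<forall>j\<in>insert i ({1..k} - e). x j \<in> C' j)" if "x \<in> space ?L"
        unfolding D_def[symmetric] using J(2) sp[OF that] by (auto simp: C'_def b_def)
      then show "x \<in> {x \<in> space ?L. \<forall>j\<in>insert i ({1..k} - e). x j \<in> C' j}
        \<longleftrightarrow> x \<in> b -` ?C \<inter> space ?L"
        using measurable_space[OF bm, of x] unfolding vimage_eq Int_iff mem_Collect_eq by blast
    qed
    also have "measure ?L \<dots> = measure (distr ?L ?P b) ?C"
      by (rule measure_distr[OF bm Cm, symmetric])
    finally show "measure (distr \<nu> ?P a) {x \<in> space (distr \<nu> ?P a). \<forall>j\<in>J. x j \<in> C j}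
      = measure (distr ?L ?P b) {x \<in> space (distr ?L ?P b). \<forall>j\<in>J. x j \<in> C j}"
      by simp
  qed simp_all
  have transfer: "(\<integral>x. H (x i) * indicator E (restrict x D) \<partial>?L)
      = (\<integral>y. H (dec 0 y) * indicator E (\<lambda>j\<in>D. dec j y) \<partial>\<nu>1)"
    if H: "H \<in> borel_measurable N" and E: "E \<in> sets (Pi\<^sub>M D (\<lambda>_. X))" for H :: "'a \<Rightarrow> real" and E
  proof -
    define h where "h z = H (z i) * indicator E (restrict z D)" for z :: "nat \<Rightarrow> 'a"
    have hi: "(\<lambda>z. z i) \<in> measurable ?P N"
      using measurable_component_singleton[of i "insert i D" M'] by (simp add: M'_def)
    have hD: "(\<lambda>z. restrict z D) \<in> measurable ?P (Pi\<^sub>M D (\<lambda>_. X))"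
    proof (rule measurable_restrict)
      fix j assume "j \<in> D"
      then show "(\<lambda>z. z j) \<in> measurable ?P X"
        using measurable_component_singleton[of j "insert i D" M'] iD by (auto simp: M'_def split: if_splits)
    qed
    have hm: "h \<in> borel_measurable ?P"
      unfolding h_def
      by (intro borel_measurable_times measurable_compose[OF hi H] measurable_compose[OF hD] borel_measurable_indicator E)
    have aD: "restrict (a y) D = (\<lambda>j\<in>D. dec j (y [i]))" and ai: "a y i = dec 0 (y [i])" for y
      using iD by (auto simp: a_def t_def fun_eq_iff restrict_def)
    have bD: "restrict (b x) D = restrict x D" "b x i = x i" for x by (auto simp: b_def fun_eq_iff restrict_def)
    have decD: "(\<lambda>y. \<lambda>j\<in>D. dec j y) \<in> measurable Y (Pi\<^sub>M D (\<lambda>_. X))"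
      by (intro measurable_restrict dec)
    have HX: "H \<in> borel_measurable X"
      using H M'X(1)[of i] N by (auto simp: measurable_def M'_def)
    have gm: "(\<lambda>y. H (dec 0 y) * indicator E (\<lambda>j\<in>D. dec j y)) \<in> borel_measurable Y"
      by (intro borel_measurable_times measurable_compose[OF dec HX] measurable_compose[OF decD] borel_measurable_indicator E)
    have "(\<integral>x. H (x i) * indicator E (restrict x D) \<partial>?L) = (\<integral>x. h (b x) \<partial>?L)"
      by (simp add: h_def bD)
    also have "\<dots> = (\<integral>z. h z \<partial>distr ?L ?P b)" by (rule integral_distr[OF bm hm, symmetric])
    also have "\<dots> = (\<integral>z. h z \<partial>distr \<nu> ?P a)" by (simp only: eqlaw)
    also have "\<dots> = (\<integral>y. h (a y) \<partial>\<nu>)" by (rule integral_distr[OF am hm])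
    also have "\<dots> = (\<integral>y. (\<lambda>y. H (dec 0 y) * indicator E (\<lambda>j\<in>D. dec j y)) (y [i]) \<partial>\<nu>)"
      by (simp add: h_def aD ai)
    also have "\<dots> = (\<integral>y. H (dec 0 y) * indicator E (\<lambda>j\<in>D. dec j y) \<partial>\<nu>1)"
      unfolding \<nu>1 by (rule integral_distr[OF Ycomp[OF w1[OF i]] gm, symmetric])
    finally show ?thesis .
  qed
  show thesis
  proof (rule that[of F])
    show "F \<in> borel_measurable (Phi_join k X \<mu> (above k e))" using Fm by (simp add: \<Psi>_def)
    show "0 \<le> F x \<and> F x \<le> 1" for x by (rule F01)
    fix E assume "E \<in> sets (Pi\<^sub>M ({1..k} - e) (\<lambda>_. X))"
    then have E: "E \<in> sets (Pi\<^sub>M D (\<lambda>_. X))" by (simp add: D_def)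
    have "(\<integral>x. (indicator A (x i) :: real) * indicator E (restrict x D) \<partial>?L)
        = (\<integral>y. indicator A (dec 0 y) * indicator E (\<lambda>j\<in>D. dec j y) \<partial>\<nu>1)"
      by (rule transfer[of "indicator A" E, OF _ E]) (rule borel_measurable_indicator, simp add: N A)
    also have "\<dots> = (\<integral>y. F (dec 0 y) * indicator E (\<lambda>j\<in>D. dec j y) \<partial>\<nu>1)"
    proof (rule key[unfolded f_def])
      have "dec j \<in> measurable (Phi_join k Y \<nu> (above k e)) X" if "j \<in> D" for j
      proof (rule measurableI)
        show "dec j y \<in> space X" if "y \<in> space (Phi_join k Y \<nu> (above k e))" for y
          using measurable_space[OF dec] that by (simp add: space_Phi_join)
        fix B assume B: "B \<in> sets X"
        have "insert j e \<in> above k e" using \<open>j \<in> D\<close> e by (auto simp: above_def D_def)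
        then show "dec j -` B \<inter> space (Phi_join k Y \<nu> (above k e)) \<in> sets (Phi_join k Y \<nu> (above k e))"
          unfolding sets_Phi_join space_Phi_join using ins[of j B] B \<open>j \<in> D\<close>
          by (intro sigma_sets.Basic) (auto simp: D_def)
      qed
      then have "(\<lambda>y. \<lambda>j\<in>D. dec j y) \<in> measurable (Phi_join k Y \<nu> (above k e)) (Pi\<^sub>M D (\<lambda>_. X))"
        by (rule measurable_restrict)
      then show "(\<lambda>y. indicator E (\<lambda>j\<in>D. dec j y)) \<in> borel_measurable (Phi_join k Y \<nu> (above k e))"
        by (rule measurable_compose) (rule borel_measurable_indicator[OF E])
    qed (auto simp: indicator_def)
    also have "\<dots> = (\<integral>x. F (x i) * indicator E (restrict x D) \<partial>?L)"
    proof (rule transfer[of F E, OF _ E, symmetric])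
      have "sets \<Psi> \<subseteq> sets N" unfolding \<Psi>_def N by (rule Phi_join_above_subset[OF law e(1)])
      then show "F \<in> borel_measurable N" using Fm N(2) sp\<Psi> by (auto simp: measurable_def)
    qed
    finally show "(\<integral>x. indicator A (x i) * indicator E (restrict x ({1..k} - e)) \<partial>?L)
      = (\<integral>x. F (x i) * indicator E (restrict x ({1..k} - e)) \<partial>?L)" by (simp add: D_def)
  qed
qed

section \<open>Oblique joins\<close>

text \<open>Adjoining null sets to a \<open>\<sigma>\<close>-algebra changes its members by null sets only. This removes completions from the
discussion of oblique copies.\<close>

lemma sigma_sets_null_approx:
  assumes M: "sigma_algebra \<Omega> \<C>" and \<Omega>: "\<Omega> = space M"
    and G: "\<And>B. B \<in> G \<Longrightarrow> \<exists>C\<in>\<C>. AE x in M. x \<in> B \<longleftrightarrow> x \<in> C"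
    and B: "B \<in> sigma_sets \<Omega> G"
  shows "\<exists>C\<in>\<C>. AE x in M. x \<in> B \<longleftrightarrow> x \<in> C"
  using B
proof (induction rule: sigma_sets.induct)
  interpret sigma_algebra \<Omega> \<C> by fact
  {
    case (Basic B)
    then show ?case by (rule G)
  next
    case Empty
    show ?case by (rule bexI[of _ "{}"]) auto
  next
    case (Compl B)
    then obtain C where C: "C \<in> \<C>" "AE x in M. x \<in> B \<longleftrightarrow> x \<in> C" by blast
    have "AE x in M. x \<in> \<Omega> - B \<longleftrightarrow> x \<in> \<Omega> - C" using C(2) by eventually_elim simp
    then show ?case using C(1) by blast
  next
    case (Union B)
    then have "\<forall>n. \<exists>C. C \<in> \<C> \<and> (AE x in M. x \<in> B n \<longleftrightarrow> x \<in> C)" by blast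
    from choice[OF this] obtain C where C: "\<And>n. C n \<in> \<C>" "\<And>n. AE x in M. x \<in> B n \<longleftrightarrow> x \<in> C n" by blast
    have "AE x in M. \<forall>n. x \<in> B n \<longleftrightarrow> x \<in> C n" using C(2) by (simp add: AE_all_countable)
    then have "AE x in M. x \<in> (\<Union>n. B n) \<longleftrightarrow> x \<in> (\<Union>n. C n)" by eventually_elim simp
    moreover have "(\<Union>n. C n) \<in> \<C>" using C(1) by auto
    ultimately show ?case by blast
  }
qed

context
  fixes k :: nat and X :: "'a measure" and \<mu> :: "(nat list \<Rightarrow> 'a) measure"
  assumes k: "1 \<le> k" and ss: "strongly_stationary k X \<mu>"
begin

lemma law_\<mu>: "law k X \<mu>" using ss by (simp add: strongly_stationary_def)

abbreviation "\<Lambda> \<equiv> line_marginal k X \<mu>"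
abbreviation "O_join \<equiv> oblique_join k X \<mu>"

lemma prob_completion: "prob_space (completion \<Lambda>)"
  using prob_space.prob_space_completion[OF prob_space_line_marginal[OF law_\<mu>]] .

lemma line_component: "j \<in> {1..k} \<Longrightarrow> (\<lambda>y. y j) \<in> measurable \<Lambda> X"
  by (auto simp: line_marginal_def intro!: measurable_component_singleton)

lemma oblique_subset:
  assumes "e \<subseteq> {1..k}" "i \<in> e"
  shows "oblique k X \<mu> e \<subseteq> sets (completion \<Lambda>)"
  unfolding oblique_eq[OF law_\<mu> assms] completed_copy_def
  using sets.sigma_sets_subset[OF coordinate_copy_completion_sets[OF assms]] by simp

lemma oblique_join_sets:
  assumes "up_set k \<I>"
  shows "sets (O_join \<I>) = sigma_sets (space \<Lambda>) (\<Union>e\<in>\<I>. oblique k X \<mu> e)"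
    and "space (O_join \<I>) = space \<Lambda>"
    and "(\<Union>e\<in>\<I>. oblique k X \<mu> e) \<subseteq> Pow (space \<Lambda>)"
proof -
  have "oblique k X \<mu> e \<subseteq> Pow (space \<Lambda>)" if "e \<in> \<I>" for e
  proof -
    have e: "e \<subseteq> {1..k}" "2 \<le> card e" using assms that unfolding up_set_def by blast+
    then obtain i where "i \<in> e" by fastforce
    then show ?thesis
      using oblique_subset[OF e(1)] sets.space_closed[of "completion \<Lambda>"] by auto
  qed
  then show 1: "(\<Union>e\<in>\<I>. oblique k X \<mu> e) \<subseteq> Pow (space \<Lambda>)" by blast
  show "sets (O_join \<I>) = sigma_sets (space \<Lambda>) (\<Union>e\<in>\<I>. oblique k X \<mu> e)"
    "space (O_join \<I>) = space \<Lambda>"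
    unfolding oblique_join_def using 1 by simp_all
qed

lemma oblique_join_mono:
  assumes "up_set k \<I>" "up_set k \<J>" "\<I> \<subseteq> \<J>"
  shows "sets (O_join \<I>) \<subseteq> sets (O_join \<J>)"
  unfolding oblique_join_sets(1)[OF assms(1)] oblique_join_sets(1)[OF assms(2)]
  by (rule sigma_sets_mono') (use assms(3) in blast)

lemma oblique_in_join: "up_set k \<I> \<Longrightarrow> e \<in> \<I> \<Longrightarrow> oblique k X \<mu> e \<subseteq> sets (O_join \<I>)"
  unfolding oblique_join_sets(1) by auto

lemma oblique_approx:
  assumes e: "e \<subseteq> {1..k}" "i \<in> e" and A: "A \<in> oblique k X \<mu> e"
  shows "\<exists>A'\<in>Phi k X \<mu> e. AE y in completion \<Lambda>. y \<in> A \<longleftrightarrow> y i \<in> A'"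
proof -
  interpret PH: sigma_algebra "space X" "Phi k X \<mu> e" by (rule Phi_sigma_algebra[OF law_\<mu> e(1)])
  define \<C> where "\<C> = sets (vimage_algebra (space \<Lambda>) (\<lambda>y. y i) (sigma (space X) (Phi k X \<mu> e)))"
  have i: "i \<in> {1..k}" using e by auto
  have f: "(\<lambda>y. y i) \<in> space \<Lambda> \<rightarrow> space (sigma (space X) (Phi k X \<mu> e))"
    using measurable_space[OF line_component[OF i]] PH.space_closed by auto
  have C: "\<C> = {(\<lambda>y. y i) -` A \<inter> space \<Lambda> | A. A \<in> Phi k X \<mu> e}"
    unfolding \<C>_def sets_vimage_algebra2[OF f] using PH.space_closed by (simp add: PH.sigma_sets_eq)
  have "\<exists>C\<in>\<C>. AE x in completion \<Lambda>. x \<in> A \<longleftrightarrow> x \<in> C"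
  proof (rule sigma_sets_null_approx)
    show "sigma_algebra (space \<Lambda>) \<C>"
      unfolding \<C>_def using sets.sigma_algebra_axioms[of "vimage_algebra (space \<Lambda>) (\<lambda>y. y i) (sigma (space X) (Phi k X \<mu> e))"] by simp
    show "A \<in> sigma_sets (space \<Lambda>) (coordinate_copy k X \<mu> i e \<union> null_sets (completion \<Lambda>))"
      using A unfolding oblique_eq[OF law_\<mu> e] completed_copy_def .
    fix B assume "B \<in> coordinate_copy k X \<mu> i e \<union> null_sets (completion \<Lambda>)"
    then show "\<exists>C\<in>\<C>. AE x in completion \<Lambda>. x \<in> B \<longleftrightarrow> x \<in> C"
    proof
      assume "B \<in> coordinate_copy k X \<mu> i e"
      then have "B \<in> \<C>" unfolding C coordinate_copy_def .
      then show ?thesis by (intro bexI[of _ B]) auto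
    next
      assume "B \<in> null_sets (completion \<Lambda>)"
      then have "AE x in completion \<Lambda>. x \<notin> B" by (rule AE_not_in)
      moreover have "{} \<in> \<C>" unfolding \<C>_def by simp
      ultimately show ?thesis by (intro bexI[of _ "{}"]) auto
    qed
  qed simp
  then obtain A' where A': "A' \<in> Phi k X \<mu> e" "AE x in completion \<Lambda>. x \<in> A \<longleftrightarrow> x \<in> (\<lambda>y. y i) -` A' \<inter> space \<Lambda>"
    unfolding C by blast
  have "AE x in completion \<Lambda>. x \<in> A \<longleftrightarrow> x i \<in> A'"
    using A'(2) AE_space by eventually_elim simp
  then show ?thesis using A'(1) by blast
qed

text \<open>An event of the oblique copy of \<open>\<Phi>\<^sub>a\<close> can be read off from any coordinate in \<open>a\<close>, in particular from one
outside \<open>e\<close>.\<close>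

lemma oblique_join_approx:
  assumes J: "up_set k \<J>" "\<And>a. a \<in> \<J> \<Longrightarrow> \<not> a \<subseteq> e" and e: "e \<subseteq> {1..k}" and B: "B \<in> sets (O_join \<J>)"
  shows "\<exists>E\<in>sets (Pi\<^sub>M ({1..k} - e) (\<lambda>_. X)). AE y in completion \<Lambda>. y \<in> B \<longleftrightarrow> restrict y ({1..k} - e) \<in> E"
proof -
  define D where "D = {1..k} - e"
  have rm: "(\<lambda>y. restrict y D) \<in> measurable \<Lambda> (Pi\<^sub>M D (\<lambda>_. X))"
    by (intro measurable_restrict line_component) (simp add: D_def)
  define \<C> where "\<C> = sets (vimage_algebra (space \<Lambda>) (\<lambda>y. restrict y D) (Pi\<^sub>M D (\<lambda>_. X)))"
  have f: "(\<lambda>y. restrict y D) \<in> space \<Lambda> \<rightarrow> space (Pi\<^sub>M D (\<lambda>_. X))"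
    using measurable_space[OF rm] by auto
  have C: "\<C> = {(\<lambda>y. restrict y D) -` E \<inter> space \<Lambda> | E. E \<in> sets (Pi\<^sub>M D (\<lambda>_. X))}"
    unfolding \<C>_def by (rule sets_vimage_algebra2[OF f])
  have "\<exists>C\<in>\<C>. AE x in completion \<Lambda>. x \<in> B \<longleftrightarrow> x \<in> C"
  proof (rule sigma_sets_null_approx)
    show "sigma_algebra (space \<Lambda>) \<C>"
      unfolding \<C>_def using sets.sigma_algebra_axioms[of "vimage_algebra (space \<Lambda>) (\<lambda>y. restrict y D) (Pi\<^sub>M D (\<lambda>_. X))"] by simp
    show "B \<in> sigma_sets (space \<Lambda>) (\<Union>a\<in>\<J>. oblique k X \<mu> a)"
      using B unfolding oblique_join_sets(1)[OF J(1)] .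
    fix B assume "B \<in> (\<Union>a\<in>\<J>. oblique k X \<mu> a)"
    then obtain a where a: "a \<in> \<J>" "B \<in> oblique k X \<mu> a" by blast
    have ak: "a \<subseteq> {1..k}" using J(1) a(1) by (auto simp: up_set_def)
    obtain j where j: "j \<in> a" "j \<notin> e" using J(2)[OF a(1)] by blast
    then have jD: "j \<in> D" using ak by (auto simp: D_def)
    obtain A' where A': "A' \<in> Phi k X \<mu> a" "AE y in completion \<Lambda>. y \<in> B \<longleftrightarrow> y j \<in> A'"
      using oblique_approx[OF ak j(1) a(2)] by blast
    have A'X: "A' \<in> sets X" using A'(1) by (simp add: Phi_def)
    define E where "E = (\<lambda>z. z j) -` A' \<inter> space (Pi\<^sub>M D (\<lambda>_. X))"
    have "E \<in> sets (Pi\<^sub>M D (\<lambda>_. X))"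
      unfolding E_def by (rule measurable_sets[OF measurable_component_singleton[OF jD] A'X])
    then have "(\<lambda>y. restrict y D) -` E \<inter> space \<Lambda> \<in> \<C>" unfolding C by blast
    moreover have "AE y in completion \<Lambda>. y \<in> B \<longleftrightarrow> y \<in> (\<lambda>y. restrict y D) -` E \<inter> space \<Lambda>"
      using A'(2) AE_space
    proof eventually_elim
      fix y assume y: "y \<in> B \<longleftrightarrow> y j \<in> A'" "y \<in> space (completion \<Lambda>)"
      then show "y \<in> B \<longleftrightarrow> y \<in> (\<lambda>y. restrict y D) -` E \<inter> space \<Lambda>"
        using measurable_space[OF rm, of y] jD by (simp add: E_def)
    qed
    ultimately show "\<exists>C\<in>\<C>. AE x in completion \<Lambda>. x \<in> B \<longleftrightarrow> x \<in> C" by blast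
  qed simp
  then obtain E where E: "E \<in> sets (Pi\<^sub>M D (\<lambda>_. X))"
    "AE x in completion \<Lambda>. x \<in> B \<longleftrightarrow> x \<in> (\<lambda>y. restrict y D) -` E \<inter> space \<Lambda>"
    unfolding C by blast
  have "AE x in completion \<Lambda>. x \<in> B \<longleftrightarrow> restrict x D \<in> E"
    using E(2) AE_space by eventually_elim simp
  then show ?thesis using E(1) unfolding D_def by blast
qed

lemma up_set_above:
  assumes "2 \<le> card e" "e \<subseteq> {1..k}"
  shows "up_set k (above k e)"
proof -
  have "2 \<le> card a" if "e \<subseteq> a" "a \<subseteq> {1..k}" for a
    using card_mono[OF finite_subset[OF that(2)] that(1)] assms(1) by simp
  then show ?thesis unfolding up_set_def above_def by blast
qed

text \<open>For \<open>e = {1..k}\<close> there is no proper superset and satedness says nothing, but then \<open>\<J>\<close> is empty, its join is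
trivial, and a constant does the job. Otherwise no member of \<open>\<J>\<close> is contained in \<open>e\<close>, so
the join over \<open>\<J>\<close> lives on the coordinates outside \<open>e\<close> and \<open>sated_line_factor\<close> applies.\<close>

lemma oblique_factor:
  assumes sat: "fully_sated k X \<mu>" and e: "e \<subseteq> {1..k}" "2 \<le> card e"
    and J: "up_set k \<J>" "e \<notin> \<J>" "above k e \<subseteq> \<J>" and A: "A \<in> oblique k X \<mu> e"
  obtains f :: "(nat \<Rightarrow> 'a) \<Rightarrow> real" where "f \<in> borel_measurable (O_join (above k e))" "\<And>y. 0 \<le> f y \<and> f y \<le> 1"
    "\<And>B. B \<in> sets (O_join \<J>) \<Longrightarrow>
      measure (completion \<Lambda>) (A \<inter> B) = (\<integral>y. f y * indicator B y \<partial>completion \<Lambda>)"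
proof -
  interpret L: prob_space \<Lambda> by (rule prob_space_line_marginal[OF law_\<mu>])
  interpret C: prob_space "completion \<Lambda>" by (rule prob_completion)
  obtain i where i: "i \<in> e" using e(2) by fastforce
  have ik: "i \<in> {1..k}" using i e by auto
  have AC: "A \<in> sets (completion \<Lambda>)" using A oblique_subset[OF e(1) i] by blast
  have BC: "B \<in> sets (completion \<Lambda>)" if "B \<in> sets (O_join \<J>)" for B
    using that subalgebra_oblique_join[OF J(1), of X \<mu>] by (auto simp: subalgebra_def)
  show thesis
  proof (cases "e = {1..k}")
    case True
    have "\<J> = {}"
    proof (rule ccontr)
      assume "\<J> \<noteq> {}"
      then obtain a where "a \<in> \<J>" by blast
      then have "{1..k} \<in> \<J>" using J(1) unfolding up_set_def by (metis (no_types, lifting) mem_Collect_eq order_refl subsetD)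
      then show False using J(2) True by simp
    qed
    then have triv: "sets (O_join \<J>) \<subseteq> {{}, space \<Lambda>}"
      unfolding oblique_join_sets(1)[OF J(1)] by (simp add: sigma_sets_empty_eq)
    show thesis
    proof (rule that[of "\<lambda>_. measure (completion \<Lambda>) A"])
      fix B assume "B \<in> sets (O_join \<J>)"
      then have "B = {} \<or> B = space \<Lambda>" using triv by blast
      then show "measure (completion \<Lambda>) (A \<inter> B) = (\<integral>y. measure (completion \<Lambda>) A * indicator B y \<partial>completion \<Lambda>)"
      proof
        assume "B = space \<Lambda>"
        then show ?thesis
          using sets.sets_into_space[OF AC] C.prob_space by (simp add: Int_absorb2)
      qed simp
    qed auto
  next
    case False
    have "{1..k} \<in> above k e" using False e(1) by (auto simp: above_def)
    then have sat': "sated k X \<mu> (above k e)"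
      using sat up_set_above[OF e(2,1)] unfolding fully_sated_def by blast
    obtain A' where A': "A' \<in> Phi k X \<mu> e" "AE y in completion \<Lambda>. y \<in> A \<longleftrightarrow> y i \<in> A'"
      using oblique_approx[OF e(1) i A] by blast
    obtain F :: "'a \<Rightarrow> real" where F: "F \<in> borel_measurable (Phi_join k X \<mu> (above k e))" "\<And>x. 0 \<le> F x \<and> F x \<le> 1"
      and Fint: "\<And>E. E \<in> sets (Pi\<^sub>M ({1..k} - e) (\<lambda>_. X)) \<Longrightarrow>
      (\<integral>x. indicator A' (x i) * indicator E (restrict x ({1..k} - e)) \<partial>\<Lambda>)
      = (\<integral>x. F (x i) * indicator E (restrict x ({1..k} - e)) \<partial>\<Lambda>)"
      by (rule sated_line_factor[OF k ss e(1) i sat' A'(1)]) blast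
    have Fm: "(\<lambda>y. F (y i)) \<in> borel_measurable (O_join (above k e))"
    proof (rule measurable_compose[OF _ F(1)])
      show "(\<lambda>y. y i) \<in> measurable (O_join (above k e)) (Phi_join k X \<mu> (above k e))"
      proof (rule measurable_sigma_sets[OF sets_Phi_join])
        show "(\<Union>e\<in>above k e. Phi k X \<mu> e) \<subseteq> Pow (space X)" using sets.space_closed[of X] by (auto simp: Phi_def)
        show "(\<lambda>y. y i) \<in> space (O_join (above k e)) \<rightarrow> space X"
          using measurable_space[OF line_component[OF ik]] oblique_join_sets(2)[OF up_set_above[OF e(2,1)]] by auto
        fix B assume "B \<in> (\<Union>e\<in>above k e. Phi k X \<mu> e)"
        then obtain a where a: "a \<in> above k e" "B \<in> Phi k X \<mu> a" by blast
        then have ak: "a \<subseteq> {1..k}" "i \<in> a" using i by (auto simp: above_def)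
        have "(\<lambda>y. y i) -` B \<inter> space \<Lambda> \<in> oblique k X \<mu> a"
          unfolding oblique_eq[OF law_\<mu> ak] completed_copy_def coordinate_copy_def using a(2) by blast
        then show "(\<lambda>y. y i) -` B \<inter> space (O_join (above k e)) \<in> sets (O_join (above k e))"
          using oblique_in_join[OF up_set_above[OF e(2,1)] a(1)] oblique_join_sets(2)[OF up_set_above[OF e(2,1)]] by auto
      qed
    qed
    have Fc: "(\<lambda>y. F (y i)) \<in> borel_measurable (completion \<Lambda>)"
      by (rule measurable_from_subalg[OF subalgebra_oblique_join[OF up_set_above[OF e(2,1)]] Fm])
    have JE: "\<not> a \<subseteq> e" if "a \<in> \<J>" for a
      using J(1,2) that e(1) unfolding up_set_def by blast
    show thesis
    proof (rule that[of "\<lambda>y. F (y i)"])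
      show "(\<lambda>y. F (y i)) \<in> borel_measurable (O_join (above k e))" by (rule Fm)
      show "0 \<le> F (y i) \<and> F (y i) \<le> 1" for y by (rule F(2))
      fix B assume B: "B \<in> sets (O_join \<J>)"
      obtain E where E: "E \<in> sets (Pi\<^sub>M ({1..k} - e) (\<lambda>_. X))"
        and BE: "AE y in completion \<Lambda>. y \<in> B \<longleftrightarrow> restrict y ({1..k} - e) \<in> E"
        using oblique_join_approx[OF J(1) JE e(1) B] by blast
      have rm: "(\<lambda>y. restrict y ({1..k} - e)) \<in> measurable \<Lambda> (Pi\<^sub>M ({1..k} - e) (\<lambda>_. X))"
        by (intro measurable_restrict line_component) simp
      have Em: "(\<lambda>y. indicator E (restrict y ({1..k} - e)) :: real) \<in> borel_measurable \<Lambda>"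
        by (rule measurable_compose[OF rm borel_measurable_indicator[OF E]])
      have "A' \<in> sets X" using A'(1) by (simp add: Phi_def)
      then have A'm: "(\<lambda>y. indicator A' (y i) :: real) \<in> borel_measurable \<Lambda>"
        by (intro measurable_compose[OF line_component[OF ik]] borel_measurable_indicator)
      have "sets (Phi_join k X \<mu> (above k e)) \<subseteq> sets X"
        using subalgebra_Phi_join[of X \<mu> k "above k e"] by (simp add: subalgebra_def point_marginal_def)
      then have "F \<in> borel_measurable X" using F(1) by (auto simp: measurable_def space_Phi_join)
      then have FL: "(\<lambda>y. F (y i)) \<in> borel_measurable \<Lambda>" by (rule measurable_compose[OF line_component[OF ik]])
      have "measure (completion \<Lambda>) (A \<inter> B) = (\<integral>y. indicator (A \<inter> B) y \<partial>completion \<Lambda>)"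
        using sets.Int[OF AC BC[OF B]] sets.Int_space_eq2[OF sets.Int[OF AC BC[OF B]]] by simp
      also have "\<dots> = (\<integral>y. indicator A' (y i) * indicator E (restrict y ({1..k} - e)) \<partial>completion \<Lambda>)"
      proof (rule integral_cong_AE)
        show "AE y in completion \<Lambda>. (indicator (A \<inter> B) y :: real) = indicator A' (y i) * indicator E (restrict y ({1..k} - e))"
          using A'(2) BE by eventually_elim (simp add: indicator_def)
        show "(\<lambda>y. indicator A' (y i) * indicator E (restrict y ({1..k} - e)) :: real) \<in> borel_measurable (completion \<Lambda>)"
          by (intro measurable_completion borel_measurable_times A'm Em)
      qed (use AC BC[OF B] in auto)
      also have "\<dots> = (\<integral>y. indicator A' (y i) * indicator E (restrict y ({1..k} - e)) \<partial>\<Lambda>)"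
        by (rule integral_completion) (intro borel_measurable_times A'm Em)
      also have "\<dots> = (\<integral>y. F (y i) * indicator E (restrict y ({1..k} - e)) \<partial>\<Lambda>)" by (rule Fint[OF E])
      also have "\<dots> = (\<integral>y. F (y i) * indicator E (restrict y ({1..k} - e)) \<partial>completion \<Lambda>)"
        by (rule integral_completion[symmetric]) (intro borel_measurable_times FL Em)
      also have "\<dots> = (\<integral>y. F (y i) * indicator B y \<partial>completion \<Lambda>)"
      proof (rule integral_cong_AE)
        show "AE y in completion \<Lambda>. F (y i) * indicator E (restrict y ({1..k} - e)) = F (y i) * indicator B y"
          using BE by eventually_elim (simp add: indicator_def)
        show "(\<lambda>y. F (y i) * indicator E (restrict y ({1..k} - e))) \<in> borel_measurable (completion \<Lambda>)"
          by (intro measurable_completion borel_measurable_times FL Em)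
      qed (use Fc BC[OF B] in auto)
      finally show "measure (completion \<Lambda>) (A \<inter> B) = (\<integral>y. F (y i) * indicator B y \<partial>completion \<Lambda>)" .
    qed
  qed
qed

lemma up_set_upward:
  assumes "up_set k \<I>" "u \<in> \<I>" "u \<subseteq> v" "v \<subseteq> {1..k}"
  shows "v \<in> \<I>"
proof -
  have "\<forall>u v. u \<in> \<I> \<and> u \<subseteq> v \<and> v \<subseteq> {1..k} \<longrightarrow> v \<in> \<I>"
    using assms(1) unfolding up_set_def by (rule conjunct2)
  from this[THEN spec, THEN spec, THEN mp, of u v] show ?thesis using assms(2-4) by simp
qed

lemma up_set_Int:
  assumes "up_set k \<I>" "up_set k \<I>'"
  shows "up_set k (\<I> \<inter> \<I>')"
  unfolding up_set_def
proof (intro conjI allI impI)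
  show "\<I> \<inter> \<I>' \<subseteq> {e. e \<subseteq> {1..k} \<and> 2 \<le> card e}" using assms(1) unfolding up_set_def by (simp add: le_infI1)
  fix u v assume "u \<in> \<I> \<inter> \<I>' \<and> u \<subseteq> v \<and> v \<subseteq> {1..k}"
  then show "v \<in> \<I> \<inter> \<I>'" using up_set_upward[OF assms(1), of u v] up_set_upward[OF assms(2), of u v] by blast
qed

lemma up_set_Un:
  assumes "up_set k \<I>" "up_set k \<I>'"
  shows "up_set k (\<I> \<union> \<I>')"
  unfolding up_set_def
proof (intro conjI allI impI)
  show "\<I> \<union> \<I>' \<subseteq> {e. e \<subseteq> {1..k} \<and> 2 \<le> card e}" using assms unfolding up_set_def by simp
  fix u v assume "u \<in> \<I> \<union> \<I>' \<and> u \<subseteq> v \<and> v \<subseteq> {1..k}"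
  then show "v \<in> \<I> \<union> \<I>'" using up_set_upward[OF assms(1), of u v] up_set_upward[OF assms(2), of u v] by blast
qed

lemma subalgebra_join:
  assumes "up_set k \<I>" "up_set k \<J>" "\<I> \<subseteq> \<J>"
  shows "subalgebra (O_join \<J>) (O_join \<I>)"
  using oblique_join_mono[OF assms] oblique_join_sets(2)[OF assms(1)] oblique_join_sets(2)[OF assms(2)]
  by (simp add: subalgebra_def)

text \<open>For \<open>A\<close> in the oblique copy of \<open>\<Phi>\<^sub>e\<close>, \<open>C\<close> in the join over \<open>\<I>\<^sub>0 = \<I> - {e}\<close> and \<open>D\<close> in the join over \<open>\<I>'\<close>, the
set \<open>C \<inter> D\<close> belongs to the join over \<open>\<I>\<^sub>0 \<union> \<I>'\<close>. Hence \<open>A\<close> may be replaced by a function \<open>f\<close> that is measurable for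
the join over the proper supersets of \<open>e\<close>, all of which are in \<open>\<I>\<^sub>0\<close>. The induction hypothesis
applies to \<open>f\<close> times the indicator of \<open>C\<close>. Such sets \<open>A \<inter> C\<close> generate the join over \<open>\<I>\<close>.\<close>

lemma oblique_joins_cond_indep:
  assumes sat: "fully_sated k X \<mu>"
  shows "up_set k \<I> \<Longrightarrow> up_set k \<I>' \<Longrightarrow>
    cond_indep_sets (completion \<Lambda>) (O_join \<I>) (O_join \<I>') (O_join (\<I> \<inter> \<I>'))"
proof (induction "card (\<I> - \<I>')" arbitrary: \<I> rule: less_induct)
  case less
  let ?M = "completion \<Lambda>"
  interpret prob_space ?M by (rule prob_completion)
  let ?H = "O_join (\<I> \<inter> \<I>')"
  have uH: "up_set k (\<I> \<inter> \<I>')" using less.prems by (rule up_set_Int)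
  have sub: "subalgebra ?M (O_join \<J>)" if "up_set k \<J>" for \<J> by (rule subalgebra_oblique_join[OF that])
  interpret H: sigma_finite_subalgebra ?M ?H by (rule subalgebra_sigma_finite[OF sub[OF uH]])
  have fin: "finite \<I>"
    by (rule finite_subset[of _ "Pow {1..k}"]) (use less.prems(1) in \<open>auto simp: up_set_def\<close>)
  show ?case
  proof (cases "\<I> \<subseteq> \<I>'")
    case True
    then have eq: "\<I> \<inter> \<I>' = \<I>" by blast
    show ?thesis
      unfolding cond_indep_sets_def
    proof (intro ballI)
      fix A C assume A: "A \<in> sets (O_join \<I>)" and C: "C \<in> sets (O_join \<I>')"
      have AM: "A \<in> sets ?M" and CM: "C \<in> sets ?M"
        using A C sub[OF less.prems(1)] sub[OF less.prems(2)] by (auto simp: subalgebra_def)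
      have "measure ?M (A \<inter> C) = (LINT x:A|?M. indicator C x)"
        using sets.Int[OF AM CM] sets.Int_space_eq2[OF sets.Int[OF AM CM]]
        by (simp add: set_lebesgue_integral_def indicator_inter_arith[symmetric])
      also have "\<dots> = (LINT x:A|?M. real_cond_exp ?M ?H (indicator C) x)"
        by (rule H.real_cond_exp_intA[OF integrable_indicator_set[OF CM]]) (use A eq in simp)
      finally show "measure ?M (A \<inter> C) = (LINT x:A|?M. real_cond_exp ?M ?H (indicator C) x)" .
    qed
  next
    case False
    obtain e where e: "e \<in> \<I> - \<I>'" "\<And>a. a \<in> \<I> - \<I>' \<Longrightarrow> card e \<le> card a"
      using ex_min_if_finite[of "card ` (\<I> - \<I>')"] fin False
      by (metis (no_types, lifting) Diff_eq_empty_iff arg_min_if_finite(1) arg_min_least finite_Diff)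
    have ek: "e \<subseteq> {1..k}" "2 \<le> card e" using e(1) less.prems(1) by (auto simp: up_set_def)
    have fe: "finite e" using ek(1) finite_subset by auto
    have up: "v \<in> \<I>" if "u \<in> \<I>" "u \<subseteq> v" "v \<subseteq> {1..k}" for u v
      using up_set_upward[OF less.prems(1)] that .
    have up': "v \<in> \<I>'" if "u \<in> \<I>'" "u \<subseteq> v" "v \<subseteq> {1..k}" for u v
      using up_set_upward[OF less.prems(2)] that .
    define \<I>0 where "\<I>0 = \<I> - {e}"
    have u0: "up_set k \<I>0"
      unfolding up_set_def
    proof (intro conjI allI impI)
      show "\<I>0 \<subseteq> {e. e \<subseteq> {1..k} \<and> 2 \<le> card e}" using less.prems(1) unfolding up_set_def \<I>0_def by (meson Diff_subset order_trans)
      fix u v assume uv: "u \<in> \<I>0 \<and> u \<subseteq> v \<and> v \<subseteq> {1..k}"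
      have "v \<noteq> e"
      proof
        \<comment> \<open>If \<open>v = e\<close>, then \<open>u\<close> would be a smaller set in \<open>\<I> - \<I>'\<close>.\<close>
        assume "v = e"
        then have "u \<subset> e" using uv by (auto simp: \<I>0_def)
        then have "card u < card e" using fe by (rule psubset_card_mono[rotated])
        moreover have "u \<notin> \<I>'" using up'[of u e] \<open>u \<subset> e\<close> e(1) ek(1) by blast
        ultimately show False using e(2)[of u] uv by (auto simp: \<I>0_def)
      qed
      then show "v \<in> \<I>0" using uv up by (auto simp: \<I>0_def)
    qed
    have above0: "above k e \<subseteq> \<I>0" using e(1) up by (auto simp: above_def \<I>0_def)
    have int0: "\<I>0 \<inter> \<I>' = \<I> \<inter> \<I>'" using e(1) by (auto simp: \<I>0_def)
    have "\<I>0 - \<I>' \<subset> \<I> - \<I>'" using e(1) by (auto simp: \<I>0_def)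
    then have "card (\<I>0 - \<I>') < card (\<I> - \<I>')" using fin by (intro psubset_card_mono) auto
    from less.hyps[OF this u0 less.prems(2)] have IH: "cond_indep_sets ?M (O_join \<I>0) (O_join \<I>') ?H" unfolding int0 .
    define \<J> where "\<J> = \<I>0 \<union> \<I>'"
    have uJ: "up_set k \<J>" unfolding \<J>_def by (rule up_set_Un[OF u0 less.prems(2)])
    have eJ: "e \<notin> \<J>" "above k e \<subseteq> \<J>" using e(1) above0 by (auto simp: \<J>_def \<I>0_def)
    have sub0: "subalgebra (O_join \<I>0) ?H" unfolding int0[symmetric] by (rule subalgebra_join) (use u0 uH int0 in auto)
    have mJ: "sets (O_join \<I>0) \<subseteq> sets (O_join \<J>)" "sets (O_join \<I>') \<subseteq> sets (O_join \<J>)" "sets ?H \<subseteq> sets (O_join \<I>')"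
      by (rule oblique_join_mono; use u0 uJ uH less.prems(2) in \<open>auto simp: \<J>_def\<close>)+
    have ua: "up_set k (above k e)" by (rule up_set_above[OF ek(2,1)])
    obtain i where i: "i \<in> e" using ek(2) by fastforce
    have sp: "space (O_join \<K>) = space \<Lambda>" if "up_set k \<K>" for \<K> by (rule oblique_join_sets(2)[OF that])
    let ?P = "{A \<inter> C | A C. A \<in> oblique k X \<mu> e \<and> C \<in> sets (O_join \<I>0)}"
    have alg: "sigma_algebra (space \<Lambda>) (oblique k X \<mu> e)"
      unfolding oblique_eq[OF law_\<mu> ek(1) i] completed_copy_def
      by (rule sigma_algebra_sigma_sets)
        (use coordinate_copy_completion_sets[OF ek(1) i, of X \<mu>] sets.space_closed[of ?M] in auto)
    interpret OB: sigma_algebra "space \<Lambda>" "oblique k X \<mu> e" by (rule alg)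
    have oM: "oblique k X \<mu> e \<subseteq> sets ?M" by (rule oblique_subset[OF ek(1) i])
    have sM: "sets (O_join \<K>) \<subseteq> sets ?M" if "up_set k \<K>" for \<K> using sub[OF that] by (simp add: subalgebra_def)
    show ?thesis
    proof (rule cond_indep_sets_generatorI[OF sub[OF less.prems(1)] sub[OF uH] sub[OF less.prems(2)]])
      show "?P \<subseteq> Pow (space ?M)" using OB.space_closed by auto
      show "Int_stable ?P"
      proof (rule Int_stableI)
        fix a b assume "a \<in> ?P" "b \<in> ?P"
        then obtain A C A' C' where "a = A \<inter> C" "b = A' \<inter> C'" "A \<in> oblique k X \<mu> e" "A' \<in> oblique k X \<mu> e"
          "C \<in> sets (O_join \<I>0)" "C' \<in> sets (O_join \<I>0)" by blast
        then show "a \<inter> b \<in> ?P"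
          by (intro CollectI exI[of _ "A \<inter> A'"] exI[of _ "C \<inter> C'"]) auto
      qed
      show "sets (O_join \<I>) = sigma_sets (space ?M) ?P"
      proof (rule antisym)
        have "(\<Union>a\<in>\<I>. oblique k X \<mu> a) \<subseteq> ?P"
        proof
          fix B assume "B \<in> (\<Union>a\<in>\<I>. oblique k X \<mu> a)"
          then obtain a where a: "a \<in> \<I>" "B \<in> oblique k X \<mu> a" by blast
          show "B \<in> ?P"
          proof (cases "a = e")
            case True
            then have "B = B \<inter> space (O_join \<I>0)" using a(2) OB.space_closed sp[OF u0] by auto
            then show ?thesis using True a(2) by (metis (mono_tags, lifting) mem_Collect_eq sets.top)
          next
            case False
            then have B: "B \<in> sets (O_join \<I>0)" using oblique_in_join[OF u0, of a] a by (auto simp: \<I>0_def)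
            then have "B = space \<Lambda> \<inter> B" using sets.sets_into_space[OF B] sp[OF u0] by auto
            then show ?thesis using B OB.top by blast
          qed
        qed
        then show "sets (O_join \<I>) \<subseteq> sigma_sets (space ?M) ?P"
          unfolding oblique_join_sets(1)[OF less.prems(1)] space_completion by (rule sigma_sets_mono')
        have "?P \<subseteq> sets (O_join \<I>)"
          using oblique_in_join[OF less.prems(1), of e] e(1) oblique_join_mono[OF u0 less.prems(1)]
          by (auto simp: \<I>0_def)
        then show "sigma_sets (space ?M) ?P \<subseteq> sets (O_join \<I>)"
          using sets.sigma_sets_subset[of ?P "O_join \<I>"] sp[OF less.prems(1)] by simp
      qed
      fix B D assume "B \<in> ?P" and D: "D \<in> sets (O_join \<I>')"
      then obtain A C where AC: "A \<in> oblique k X \<mu> e" "C \<in> sets (O_join \<I>0)" "B = A \<inter> C" by blast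
      obtain f where f: "f \<in> borel_measurable (O_join (above k e))" "\<And>y. 0 \<le> f y \<and> f y \<le> 1"
        and fint: "\<And>B. B \<in> sets (O_join \<J>) \<Longrightarrow> measure ?M (A \<inter> B) = (\<integral>y. f y * indicator B y \<partial>?M)"
        by (rule oblique_factor[OF sat ek uJ eJ AC(1)]) blast
      have "f \<in> borel_measurable (O_join \<I>0)"
        by (rule measurable_from_subalg[OF subalgebra_join[OF ua u0 above0] f(1)])
      then have f0: "(\<lambda>y. f y * indicator C y) \<in> borel_measurable (O_join \<I>0)" using AC(2) by measurable
      have fM: "(\<lambda>y. f y * indicator C y) \<in> borel_measurable ?M" by (rule measurable_from_subalg[OF sub[OF u0] f0])
      have fb: "\<bar>f y * indicator C y\<bar> \<le> 1" for y using f(2)[of y] by (auto simp: indicator_def)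
      have ifC: "integrable ?M (\<lambda>y. f y * indicator C y)" by (rule integrable_boundedI[OF fM, of 1]) (rule fb)
      have BM: "B \<in> sets ?M" and DM: "D \<in> sets ?M"
        using AC oM sM[OF u0] D sM[OF less.prems(2)] by auto
      have step: "measure ?M (B \<inter> D') = (\<integral>y. (f y * indicator C y) * indicator D' y \<partial>?M)" if "D' \<in> sets (O_join \<I>')" for D'
      proof -
        have "C \<inter> D' \<in> sets (O_join \<J>)" using that AC(2) mJ by auto
        from fint[OF this] show ?thesis
          unfolding AC(3) by (simp add: Int_assoc indicator_inter_arith mult.assoc)
      qed
      have E: "AE y in ?M. real_cond_exp ?M ?H (indicator B) y = real_cond_exp ?M ?H (\<lambda>y. f y * indicator C y) y"
      proof (rule cond_exp_unique[OF sub[OF uH] integrable_indicator_set[OF BM]])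
        show "integrable ?M (real_cond_exp ?M ?H (\<lambda>y. f y * indicator C y))" by (rule H.real_cond_exp_int(1)[OF ifC])
        fix D' assume D': "D' \<in> sets ?H"
        then have D'M: "D' \<in> sets ?M" using sM[OF uH] by blast
        have "(\<integral>y. indicator B y * indicator D' y \<partial>?M) = measure ?M (B \<inter> D')"
          using sets.Int[OF BM D'M] sets.Int_space_eq2[OF sets.Int[OF BM D'M]]
          by (simp add: indicator_inter_arith[symmetric])
        also have "\<dots> = (\<integral>y. (f y * indicator C y) * indicator D' y \<partial>?M)" using D' mJ(3) by (intro step) auto
        also have "\<dots> = (\<integral>y. real_cond_exp ?M ?H (\<lambda>y. f y * indicator C y) y * indicator D' y \<partial>?M)"
          using H.real_cond_exp_intA[OF ifC D'] by (simp add: set_lebesgue_integral_def mult.commute)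
        finally show "(\<integral>y. indicator B y * indicator D' y \<partial>?M) = (\<integral>y. real_cond_exp ?M ?H (\<lambda>y. f y * indicator C y) y * indicator D' y \<partial>?M)" .
      qed auto
      have "measure ?M (B \<inter> D) = (\<integral>y. (f y * indicator C y) * indicator D y \<partial>?M)" by (rule step[OF D])
      also have "\<dots> = (\<integral>y. real_cond_exp ?M ?H (\<lambda>y. f y * indicator C y) y * indicator D y \<partial>?M)"
        by (rule cond_indep_sets_bounded[OF IH sub[OF u0] sub0 D DM f0, of 1]) (rule fb)
      also have "\<dots> = (\<integral>y. real_cond_exp ?M ?H (indicator B) y * indicator D y \<partial>?M)"
        by (rule integral_cong_AE) (use E DM in auto)
      also have "\<dots> = (\<integral>y. indicator B y * real_cond_exp ?M ?H (indicator D) y \<partial>?M)"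
        by (rule cond_exp_adjoint[OF sub[OF uH], where B = 1 and D = 1, symmetric]) (use BM DM in \<open>auto simp: indicator_def\<close>)
      finally show "measure ?M (B \<inter> D) = (LINT y:B|?M. real_cond_exp ?M ?H (indicator D) y)"
        by (simp add: set_lebesgue_integral_def)
    qed
  qed
qed

end

theorem theorem6p3:
  fixes k :: nat and X :: "'a measure" and \<mu> :: "(nat list \<Rightarrow> 'a) measure"
    and \<I> \<I>' :: "nat set set"
  assumes "1 \<le> k"
    and "standard_borel X"
    and "strongly_stationary k X \<mu>"
    and "fully_sated k X \<mu>"
    and "up_set k \<I>"
    and "up_set k \<I>'"
  shows "rel_indep (completion (line_marginal k X \<mu>))
           (oblique_join k X \<mu> \<I>) (oblique_join k X \<mu> \<I>') (oblique_join k X \<mu> (\<I> \<inter> \<I>'))"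
proof (rule prob_space.rel_indepI)
  note ctx = assms(1,3)
  have u: "up_set k (\<I> \<inter> \<I>')" by (rule up_set_Int[OF ctx assms(5,6)])
  show "prob_space (completion (line_marginal k X \<mu>))" by (rule prob_completion[OF ctx])
  show "cond_indep_sets (completion (line_marginal k X \<mu>))
           (oblique_join k X \<mu> \<I>) (oblique_join k X \<mu> \<I>') (oblique_join k X \<mu> (\<I> \<inter> \<I>'))"
    by (rule oblique_joins_cond_indep[OF ctx assms(4-6)])
  show "subalgebra (completion (line_marginal k X \<mu>)) (oblique_join k X \<mu> \<I>)"
    "subalgebra (completion (line_marginal k X \<mu>)) (oblique_join k X \<mu> \<I>')"
    by (rule subalgebra_oblique_join; fact)+
  show "subalgebra (oblique_join k X \<mu> \<I>) (oblique_join k X \<mu> (\<I> \<inter> \<I>'))"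
    "subalgebra (oblique_join k X \<mu> \<I>') (oblique_join k X \<mu> (\<I> \<inter> \<I>'))"
    by (rule subalgebra_join[OF ctx u]; use assms in auto)+
qed

end
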